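(* Let $k$ be an arbitrary field and let $H$ be a finite-dimensional cocommutative Hopf algebra over $k$. Then $H$ is local if and only if the subalgebra of $H$ generated by $H_1$ is local.
   Context: For a Hopf algebra $H$ with counit $\varepsilon$ and comultiplication $\Delta$: the coradical $H_0$ is the sum of all simple subcoalgebras of $H$, and for $n\ge 1$ one sets inductively $H_n=\Delta^{-1}(H\otimes H_{n-1}+H_0\otimes H)$; the chain $H_0\subseteq H_1\subseteq\cdots$ is the coradical filtration. An algebra is local if it has a unique maximal one-sided ideal. *)

theory Defs
  imports "HOL-Library.Function_Algebras"
begin

text \<open>A finite-dimensional algebra/coalgebra over a field 'k with basis indexed by the
finite type 'n.  Vectors are functions 'n \<Rightarrow> 'k, elements of H \<otimes> H are functions
'n \<times> 'n \<Rightarrow> 'k.  The structure maps are given by structure constants: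
  e_i e_j = sum_l m i j l e_l,   1 = sum_l u l e_l,
  Delta(e_l) = sum_{i,j} c l i j e_i \<otimes> e_j,  eps(e_l) = e l,  S(e_l) = sum_i s l i e_i.\<close>

type_synonym ('n,'k) vec = "'n \<Rightarrow> 'k"

definition bvec :: "'n \<Rightarrow> ('n,'k::field) vec" where
  "bvec i = (\<lambda>j. if j = i then 1 else 0)"

definition hmul :: "('n::finite \<Rightarrow> 'n \<Rightarrow> 'n \<Rightarrow> 'k::field) \<Rightarrow> ('n,'k) vec \<Rightarrow> ('n,'k) vec \<Rightarrow> ('n,'k) vec" where
  "hmul m x y = (\<lambda>l. \<Sum>i\<in>UNIV. \<Sum>j\<in>UNIV. x i * y j * m i j l)"

definition hcomul :: "('n::finite \<Rightarrow> 'n \<Rightarrow> 'n \<Rightarrow> 'k::field) \<Rightarrow> ('n,'k) vec \<Rightarrow> ('n \<times> 'n \<Rightarrow> 'k)" where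
  "hcomul c x = (\<lambda>(i,j). \<Sum>l\<in>UNIV. x l * c l i j)"

definition hcounit :: "('n::finite \<Rightarrow> 'k::field) \<Rightarrow> ('n,'k) vec \<Rightarrow> 'k" where
  "hcounit e x = (\<Sum>l\<in>UNIV. x l * e l)"

definition hantipode :: "('n::finite \<Rightarrow> 'n \<Rightarrow> 'k::field) \<Rightarrow> ('n,'k) vec \<Rightarrow> ('n,'k) vec" where
  "hantipode s x = (\<lambda>i. \<Sum>l\<in>UNIV. x l * s l i)"

definition tensor :: "('n,'k::field) vec \<Rightarrow> ('n,'k) vec \<Rightarrow> ('n \<times> 'n \<Rightarrow> 'k)" where
  "tensor v w = (\<lambda>(i,j). v i * w j)"

definition tmul :: "('n::finite \<Rightarrow> 'n \<Rightarrow> 'n \<Rightarrow> 'k::field) \<Rightarrow> ('n \<times> 'n \<Rightarrow> 'k) \<Rightarrow> ('n \<times> 'n \<Rightarrow> 'k) \<Rightarrow> ('n \<times> 'n \<Rightarrow> 'k)" where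
  "tmul m t t' = (\<lambda>(a,b). \<Sum>i\<in>UNIV. \<Sum>j\<in>UNIV. \<Sum>i'\<in>UNIV. \<Sum>j'\<in>UNIV.
       t (i,j) * t' (i',j') * m i i' a * m j j' b)"

definition comul_left :: "('n::finite \<Rightarrow> 'n \<Rightarrow> 'n \<Rightarrow> 'k::field) \<Rightarrow> ('n \<times> 'n \<Rightarrow> 'k) \<Rightarrow> ('n \<times> 'n \<times> 'n \<Rightarrow> 'k)" where
  "comul_left c t = (\<lambda>(a,b,d). \<Sum>l\<in>UNIV. t (l,d) * c l a b)"

definition comul_right :: "('n::finite \<Rightarrow> 'n \<Rightarrow> 'n \<Rightarrow> 'k::field) \<Rightarrow> ('n \<times> 'n \<Rightarrow> 'k) \<Rightarrow> ('n \<times> 'n \<times> 'n \<Rightarrow> 'k)" where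
  "comul_right c t = (\<lambda>(a,b,d). \<Sum>l\<in>UNIV. t (a,l) * c l b d)"

definition hopf_algebra ::
  "('n::finite \<Rightarrow> 'n \<Rightarrow> 'n \<Rightarrow> 'k::field) \<Rightarrow> ('n,'k) vec \<Rightarrow> ('n \<Rightarrow> 'n \<Rightarrow> 'n \<Rightarrow> 'k)
     \<Rightarrow> ('n \<Rightarrow> 'k) \<Rightarrow> ('n \<Rightarrow> 'n \<Rightarrow> 'k) \<Rightarrow> bool" where
  "hopf_algebra m u c e s \<longleftrightarrow>
     (\<forall>x y z. hmul m (hmul m x y) z = hmul m x (hmul m y z)) \<and>
     (\<forall>x. hmul m u x = x \<and> hmul m x u = x) \<and>
     (\<forall>x. comul_left c (hcomul c x) = comul_right c (hcomul c x)) \<and>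
     (\<forall>x j. (\<Sum>l\<in>UNIV. hcomul c x (l,j) * e l) = x j) \<and>
     (\<forall>x i. (\<Sum>l\<in>UNIV. hcomul c x (i,l) * e l) = x i) \<and>
     (\<forall>x y. hcomul c (hmul m x y) = tmul m (hcomul c x) (hcomul c y)) \<and>
     hcomul c u = tensor u u \<and>
     (\<forall>x y. hcounit e (hmul m x y) = hcounit e x * hcounit e y) \<and>
     hcounit e u = 1 \<and>
     (\<forall>x. (\<lambda>l. \<Sum>i\<in>UNIV. \<Sum>j\<in>UNIV.
            hcomul c x (i,j) * hmul m (hantipode s (bvec i)) (bvec j) l) = (\<lambda>l. hcounit e x * u l)) \<and>
     (\<forall>x. (\<lambda>l. \<Sum>i\<in>UNIV. \<Sum>j\<in>UNIV.
            hcomul c x (i,j) * hmul m (bvec i) (hantipode s (bvec j)) l) = (\<lambda>l. hcounit e x * u l))"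

definition cocommutative :: "('n::finite \<Rightarrow> 'n \<Rightarrow> 'n \<Rightarrow> 'k::field) \<Rightarrow> bool" where
  "cocommutative c \<longleftrightarrow> (\<forall>x i j. hcomul c x (i,j) = hcomul c x (j,i))"

definition ksubspace :: "('a \<Rightarrow> 'k::field) set \<Rightarrow> bool" where
  "ksubspace V \<longleftrightarrow> 0 \<in> V \<and> (\<forall>x\<in>V. \<forall>y\<in>V. x + y \<in> V) \<and> (\<forall>a. \<forall>x\<in>V. (\<lambda>i. a * x i) \<in> V)"

definition kspan :: "('a \<Rightarrow> 'k::field) set \<Rightarrow> ('a \<Rightarrow> 'k) set" where
  "kspan S = \<Inter>{V. ksubspace V \<and> S \<subseteq> V}"

definition tens_sub :: "('n,'k::field) vec set \<Rightarrow> ('n,'k) vec set \<Rightarrow> ('n \<times> 'n \<Rightarrow> 'k) set" where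
  "tens_sub V W = kspan {tensor v w | v w. v \<in> V \<and> w \<in> W}"

definition subcoalgebra :: "('n::finite \<Rightarrow> 'n \<Rightarrow> 'n \<Rightarrow> 'k::field) \<Rightarrow> ('n,'k) vec set \<Rightarrow> bool" where
  "subcoalgebra c C \<longleftrightarrow> ksubspace C \<and> (\<forall>x\<in>C. hcomul c x \<in> tens_sub C C)"

definition simple_subcoalgebra :: "('n::finite \<Rightarrow> 'n \<Rightarrow> 'n \<Rightarrow> 'k::field) \<Rightarrow> ('n,'k) vec set \<Rightarrow> bool" where
  "simple_subcoalgebra c C \<longleftrightarrow> subcoalgebra c C \<and> C \<noteq> {0} \<and>
     (\<forall>D. subcoalgebra c D \<and> D \<subseteq> C \<longrightarrow> D = {0} \<or> D = C)"

definition coradical :: "('n::finite \<Rightarrow> 'n \<Rightarrow> 'n \<Rightarrow> 'k::field) \<Rightarrow> ('n,'k) vec set" where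
  "coradical c = kspan (\<Union>{C. simple_subcoalgebra c C})"

definition coradical_one :: "('n::finite \<Rightarrow> 'n \<Rightarrow> 'n \<Rightarrow> 'k::field) \<Rightarrow> ('n,'k) vec set" where
  "coradical_one c = {x. hcomul c x \<in>
      {a + b | a b. a \<in> tens_sub UNIV (coradical c) \<and> b \<in> tens_sub (coradical c) UNIV}}"

definition subalgebra :: "('n::finite \<Rightarrow> 'n \<Rightarrow> 'n \<Rightarrow> 'k::field) \<Rightarrow> ('n,'k) vec \<Rightarrow> ('n,'k) vec set \<Rightarrow> bool" where
  "subalgebra m u A \<longleftrightarrow> ksubspace A \<and> u \<in> A \<and> (\<forall>x\<in>A. \<forall>y\<in>A. hmul m x y \<in> A)"

definition gen_subalgebra :: "('n::finite \<Rightarrow> 'n \<Rightarrow> 'n \<Rightarrow> 'k::field) \<Rightarrow> ('n,'k) vec \<Rightarrow> ('n,'k) vec set \<Rightarrow> ('n,'k) vec set" where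
  "gen_subalgebra m u S = \<Inter>{A. subalgebra m u A \<and> S \<subseteq> A}"

text \<open>Left ideals of a subalgebra A (with the induced multiplication).  Since A contains
the scalars k\<cdot>1, additive subgroups closed under left multiplication by A are subspaces.\<close>
definition left_ideal :: "('n::finite \<Rightarrow> 'n \<Rightarrow> 'n \<Rightarrow> 'k::field) \<Rightarrow> ('n,'k) vec set \<Rightarrow> ('n,'k) vec set \<Rightarrow> bool" where
  "left_ideal m A I \<longleftrightarrow> I \<subseteq> A \<and> 0 \<in> I \<and> (\<forall>x\<in>I. \<forall>y\<in>I. x + y \<in> I) \<and> (\<forall>x\<in>I. - x \<in> I) \<and>
      (\<forall>a\<in>A. \<forall>x\<in>I. hmul m a x \<in> I)"

definition maximal_left_ideal :: "('n::finite \<Rightarrow> 'n \<Rightarrow> 'n \<Rightarrow> 'k::field) \<Rightarrow> ('n,'k) vec set \<Rightarrow> ('n,'k) vec set \<Rightarrow> bool" where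
  "maximal_left_ideal m A I \<longleftrightarrow> left_ideal m A I \<and> I \<noteq> A \<and>
      (\<forall>J. left_ideal m A J \<and> I \<subseteq> J \<and> J \<noteq> A \<longrightarrow> J = I)"

definition local_algebra :: "('n::finite \<Rightarrow> 'n \<Rightarrow> 'n \<Rightarrow> 'k::field) \<Rightarrow> ('n,'k) vec set \<Rightarrow> bool" where
  "local_algebra m A \<longleftrightarrow> (\<exists>!I. maximal_left_ideal m A I)"

end

theory Submission
  imports Defs "HOL.Vector_Spaces" "HOL-Computational_Algebra.Primes"
begin

text \<open>
  Work in the commutative algebra \<open>H\<^sup>*\<close>, on which \<open>H\<close> acts by transposed left and right
  multiplication; \<open>H\<close> and \<open>H\<^sup>*\<close> are both coordinatised by functions \<open>'n \<Rightarrow> 'k\<close>, with evaluation \<open>pair\<close>.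
  That \<open>H\<close> is local means that every nonzero stable subspace \<open>V\<close> of \<open>H\<^sup>*\<close> contains the unit of
  \<open>H\<^sup>*\<close>. Let the subalgebra \<open>A\<close> generated by \<open>H\<^sub>1\<close> be local, so that \<open>A \<inter> ker \<epsilon>\<close> acts nilpotently
  on \<open>H\<^sup>*\<close>, and let \<open>V\<close> be minimal. It suffices to find a reduced sub-bialgebra \<open>Q \<supseteq> V\<close> of \<open>H\<^sup>*\<close>:
  the annihilator of \<open>H\<^sub>0\<close> consists of nilpotent elements, so that every functional on \<open>Q\<close> is
  represented by an element of \<open>H\<^sub>0 \<subseteq> A\<close>, and a vector of \<open>V\<close> killed by \<open>A \<inter> ker \<epsilon>\<close> is killed by \<open>ker \<epsilon>\<close>.

  In characteristic \<open>p\<close> take for \<open>Q\<close> the stable term of the chain \<open>Q \<mapsto> k Q\<^sup>p\<close> starting at \<open>H\<^sup>*\<close>.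
  The point is that \<open>V \<subseteq> Q\<close> implies \<open>V \<subseteq> k Q\<^sup>p\<close>. The functionals on \<open>Q\<close> that are primitive act by
  derivations, and they act nilpotently because those on \<open>H\<^sup>*\<close>, the primitive elements of \<open>H\<close>, lie in
  \<open>H\<^sub>1\<close>; hence some nonzero \<open>f \<in> V\<close> is killed by all of them, and such an \<open>f\<close> lies in \<open>k Q\<^sup>p\<close>,
  since \<open>Q\<close> has enough invariant derivations. In characteristic \<open>0\<close> a primitive element that acts
  nilpotently vanishes, so that \<open>H\<^sup>*\<close> has an integral not killed by its counit, and a trace
  argument shows that \<open>H\<^sup>*\<close> itself is reduced.
\<close>

section \<open>Linear algebra on spaces of functions\<close>

definition scl :: "'k::field \<Rightarrow> ('n \<Rightarrow> 'k) \<Rightarrow> ('n \<Rightarrow> 'k)" where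
  "scl a x = (\<lambda>i. a * x i)"

lemma scl_apply: "scl a x i = a * x i"
  by (simp add: scl_def)

lemma sum_fun_apply: "(\<Sum>i\<in>A. f i) x = (\<Sum>i\<in>A. f i x)"
  by (induction A rule: infinite_finite_induct) auto

lemmas fapply = zero_fun_apply plus_fun_apply minus_apply uminus_apply sum_fun_apply scl_apply

declare zero_fun_apply [simp del] plus_fun_apply [simp del] minus_apply [simp del] uminus_apply [simp del]

lemma bvec_apply: "bvec i j = (if j = i then 1 else 0)"
  by (simp add: bvec_def)

global_interpretation fv: vector_space "scl :: 'k::field \<Rightarrow> ('n \<Rightarrow> 'k) \<Rightarrow> _"
  by unfold_locales (auto simp: fun_eq_iff fapply algebra_simps)

lemma bvec_expand: "x = (\<Sum>i\<in>UNIV. scl (x i) (bvec i))" for x :: "'n::finite \<Rightarrow> 'k::field"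
  by (auto simp: fun_eq_iff fapply bvec_apply if_distrib[of "\<lambda>z. _ * z"] cong: if_cong)

global_interpretation fv: finite_dimensional_vector_space
  "scl :: 'k::field \<Rightarrow> ('n::finite \<Rightarrow> 'k) \<Rightarrow> _" "range bvec"
proof
  show "finite (range (bvec :: 'n \<Rightarrow> 'n \<Rightarrow> 'k))" by simp
  have inj: "inj (bvec :: 'n \<Rightarrow> 'n \<Rightarrow> 'k)"
    by (auto simp: inj_on_def bvec_def fun_eq_iff)
  show "fv.independent (range (bvec :: 'n \<Rightarrow> 'n \<Rightarrow> 'k))"
  proof (rule fv.independent_if_scalars_zero)
    fix f :: "('n \<Rightarrow> 'k) \<Rightarrow> 'k" and x
    assume "(\<Sum>x\<in>range bvec. scl (f x) x) = 0" and "x \<in> range (bvec :: 'n \<Rightarrow> 'n \<Rightarrow> 'k)"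
    then obtain i where i: "x = bvec i" by auto
    have "0 = (\<Sum>x\<in>range bvec. scl (f x) x) i" using \<open>_ = 0\<close> by (simp add: fapply)
    also have "\<dots> = (\<Sum>j\<in>UNIV. f (bvec j) * bvec j i)"
      by (simp add: fapply sum.reindex[OF inj])
    also have "\<dots> = f x" by (simp add: i bvec_apply if_distrib[of "\<lambda>z. _ * z"] cong: if_cong)
    finally show "f x = 0" by simp
  qed simp_all
  show "fv.span (range (bvec :: 'n \<Rightarrow> 'n \<Rightarrow> 'k)) = UNIV"
    using bvec_expand by (metis (no_types, lifting) UNIV_eq_I fv.span_base fv.span_scale fv.span_sum rangeI)
qed

abbreviation "flinear \<equiv> Vector_Spaces.linear scl scl"

lemma flinearI:
  "(\<And>x y. T (x + y) = T x + T y) \<Longrightarrow> (\<And>a x. T (scl a x) = scl a (T x)) \<Longrightarrow> flinear T"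
  by (auto simp: Vector_Spaces.linear_iff fv.vector_space_axioms)

lemma
  assumes "flinear T"
  shows flinear_add: "T (x + y) = T x + T y" and flinear_scl: "T (scl a x) = scl a (T x)"
  using assms by (auto simp: Vector_Spaces.linear_iff)

lemma flinear_0: assumes "flinear T" shows "T 0 = 0"
  using flinear_scl[OF assms, of 0 0] by simp

lemma flinear_diff: assumes "flinear T" shows "T (x - y) = T x - T y"
  using flinear_add[OF assms, of "x - y" y] by (simp add: algebra_simps)

lemma flinear_sum: assumes "flinear T" shows "T (\<Sum>i\<in>A. f i) = (\<Sum>i\<in>A. T (f i))"
  by (induction A rule: infinite_finite_induct) (auto simp: flinear_0[OF assms] flinear_add[OF assms])

lemma ksubspace_eq: "ksubspace V = fv.subspace V"
  by (auto simp: ksubspace_def fv.subspace_def scl_def)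

lemma kspan_eq: "kspan S = fv.span S"
  unfolding kspan_def ksubspace_eq fv.span_def
  by (simp add: hull_def)

lemma subspace_flinear_image:
  fixes T :: "('n \<Rightarrow> 'k::field) \<Rightarrow> ('m \<Rightarrow> 'k)"
  assumes T: "flinear T" and U: "fv.subspace U"
  shows "fv.subspace (T ` U)"
proof -
  interpret vector_space_pair "scl :: 'k \<Rightarrow> ('n \<Rightarrow> 'k) \<Rightarrow> _" "scl :: 'k \<Rightarrow> ('m \<Rightarrow> 'k) \<Rightarrow> _" ..
  show ?thesis by (rule linear_subspace_image[OF T U])
qed

lemma subspace_vimage: "flinear T \<Longrightarrow> fv.subspace U \<Longrightarrow> fv.subspace {f. T f \<in> U}"
  by (auto simp: fv.subspace_def flinear_0 flinear_add flinear_scl)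

text \<open>A left inverse of \<open>T\<close> on \<open>U\<close> carries a basis of the image to a
  spanning set of \<open>U\<close>, so the image has at least the dimension of
  \<open>U\<close>.\<close>

lemma flinear_inj_on_surj:
  fixes T :: "('n::finite \<Rightarrow> 'k::field) \<Rightarrow> ('n \<Rightarrow> 'k)"
  assumes T: "flinear T" and U: "fv.subspace U" and sub: "T ` U \<subseteq> U"
    and inj: "\<And>x. x \<in> U \<Longrightarrow> T x = 0 \<Longrightarrow> x = 0"
  shows "T ` U = U"
proof (rule fv.subspace_dim_equal[OF subspace_flinear_image[OF T U] U sub])
  interpret vector_space_pair "scl :: 'k \<Rightarrow> ('n \<Rightarrow> 'k) \<Rightarrow> _" "scl :: 'k \<Rightarrow> ('n \<Rightarrow> 'k) \<Rightarrow> _" ..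
  have "inj_on T U"
  proof (rule inj_onI)
    fix x y assume "x \<in> U" "y \<in> U" "T x = T y"
    then have "x - y = 0" using inj[of "x - y"] fv.subspace_diff[OF U] by (simp add: flinear_diff[OF T])
    then show "x = y" by simp
  qed
  from linear_exists_left_inverse_on[OF T U this]
  obtain g where "range g \<subseteq> U \<and> flinear g \<and> (\<forall>v\<in>U. g (T v) = v)"
    by (rule exE)
  then have g: "flinear g" "\<And>v. v \<in> U \<Longrightarrow> g (T v) = v"
    by simp_all
  obtain B where B: "B \<subseteq> T ` U" "fv.independent B" "T ` U \<subseteq> fv.span B" "card B = fv.dim (T ` U)"
    by (rule fv.basis_exists)
  have finB: "finite B" using B(2) by (rule fv.finiteI_independent)
  have "U \<subseteq> fv.span (g ` B)"
  proof
    fix v assume "v \<in> U"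
    then have "g (T v) \<in> g ` fv.span B" and gv: "g (T v) = v" using g(2) B(3) by blast+
    then have "g (T v) \<in> fv.span (g ` B)" by (simp only: linear_span_image[OF g(1)])
    then show "v \<in> fv.span (g ` B)" by (simp only: gv)
  qed
  then have "fv.dim U \<le> card (g ` B)" using finB by (intro fv.dim_le_card) auto
  also have "\<dots> \<le> card B" by (rule card_image_le[OF finB])
  finally show "fv.dim U \<le> fv.dim (T ` U)" using B(4) by simp
qed

text \<open>A right inverse of \<open>T\<close> on \<open>U\<close> is injective, hence onto by the
  previous lemma; so \<open>x = g v\<close> with \<open>v = T x = 0\<close>.\<close>

lemma flinear_surj_on_inj:
  fixes T :: "('n::finite \<Rightarrow> 'k::field) \<Rightarrow> ('n \<Rightarrow> 'k)"
  assumes T: "flinear T" and U: "fv.subspace U" and surj: "T ` U = U" and x: "x \<in> U" "T x = 0"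
  shows "x = 0"
proof -
  interpret vector_space_pair "scl :: 'k \<Rightarrow> ('n \<Rightarrow> 'k) \<Rightarrow> _" "scl :: 'k \<Rightarrow> ('n \<Rightarrow> 'k) \<Rightarrow> _" ..
  from linear_exists_right_inverse_on[OF T U]
  obtain g where "range g \<subseteq> U \<and> flinear g \<and> (\<forall>v\<in>T ` U. T (g v) = v)" by (rule exE)
  then have g: "\<And>v. g v \<in> U" "flinear g" "\<And>v. v \<in> U \<Longrightarrow> T (g v) = v" using surj by auto
  have "g ` U = U"
  proof (rule flinear_inj_on_surj[OF g(2) U])
    show "g ` U \<subseteq> U" using g(1) by auto
    show "v = 0" if "v \<in> U" "g v = 0" for v
      using g(3)[OF that(1)] that(2) flinear_0[OF T] by simp
  qed
  then obtain v where v: "v \<in> U" "x = g v" using x(1) by auto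
  then have "v = 0" using g(3)[OF v(1)] x(2) by simp
  then show ?thesis using v(2) flinear_0[OF g(2)] by simp
qed

text \<open>Take \<open>U\<close> of least dimension. The subspace conditions are premises of the
  minimality clause, so that \<open>P\<close> can be any predicate on sets.\<close>

lemma finite_dim_min:
  fixes P :: "('n::finite \<Rightarrow> 'k::field) set \<Rightarrow> bool"
  assumes "P V"
  obtains U where "P U" "\<And>U'. P U' \<Longrightarrow> fv.subspace U \<Longrightarrow> fv.subspace U' \<Longrightarrow> U' \<subseteq> U \<Longrightarrow> U' = U"
proof -
  obtain U where U: "P U" "\<forall>U'. P U' \<longrightarrow> fv.dim U \<le> fv.dim U'"
    using ex_has_least_nat[of P V fv.dim] assms by auto
  show thesis
    by (rule that[OF U(1)]) (use U(2) fv.subspace_dim_equal in blast)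
qed

section \<open>The evaluation pairing and dual bases\<close>

definition pair :: "('n::finite \<Rightarrow> 'k::field) \<Rightarrow> ('n \<Rightarrow> 'k) \<Rightarrow> 'k" where
  "pair x f = (\<Sum>i\<in>UNIV. x i * f i)"

lemma pair_add_left: "pair (x + y) f = pair x f + pair y f"
  and pair_add_right: "pair x (f + g) = pair x f + pair x g"
  and pair_scl_left: "pair (scl a x) f = a * pair x f"
  and pair_scl_right: "pair x (scl a f) = a * pair x f"
  and pair_diff_left: "pair (x - y) f = pair x f - pair y f"
  and pair_diff_right: "pair x (f - g) = pair x f - pair x g"
  and pair_0_left: "pair 0 f = 0"
  and pair_0_right: "pair x 0 = 0"
  and pair_minus_right: "pair x (- f) = - pair x f"
  by (simp_all add: pair_def fapply algebra_simps sum.distrib sum_subtractf sum_distrib_left sum_negf)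

lemma pair_sum_left: "pair (\<Sum>i\<in>A. x i) f = (\<Sum>i\<in>A. pair (x i) f)"
  by (induction A rule: infinite_finite_induct) (auto simp: pair_0_left pair_add_left)

lemma pair_sum_right: "pair x (\<Sum>i\<in>A. f i) = (\<Sum>i\<in>A. pair x (f i))"
  by (induction A rule: infinite_finite_induct) (auto simp: pair_0_right pair_add_right)

lemmas pair_linear = pair_add_left pair_add_right pair_scl_left pair_scl_right pair_diff_left
  pair_diff_right pair_0_left pair_0_right pair_sum_left pair_sum_right pair_minus_right

lemma pair_commute: "pair x f = pair f x"
  by (simp add: pair_def mult.commute)

lemma pair_bvec_left [simp]: "pair (bvec i) f = f i"
  by (simp add: pair_def bvec_apply if_distrib[of "\<lambda>z. z * _"] cong: if_cong)

lemma pair_bvec_right [simp]: "pair x (bvec i) = x i"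
  by (simp add: pair_def bvec_apply if_distrib[of "\<lambda>z. _ * z"] cong: if_cong)

lemma pair_eqI: "(\<And>x. pair x f = pair x g) \<Longrightarrow> f = g"
  by (metis ext pair_bvec_left)

text \<open>A basis \<open>J0\<close> of \<open>K\<close> is extended to a basis of \<open>Q\<close>
  and then to one of the whole space; \<open>y b\<close> is the coordinate function at
  \<open>b\<close>, turned into a vector by means of \<open>pair\<close>. The \<open>y b\<close>
  with \<open>b\<close> in \<open>J\<close> are functionals that vanish on \<open>K\<close>.\<close>

lemma adapted_dual_basis:
  fixes K Q :: "('n::finite \<Rightarrow> 'k::field) set"
  assumes K: "fv.subspace K" and Q: "fv.subspace Q" and KQ: "K \<subseteq> Q"
  obtains J0 J y where "finite J0" "finite J" "J0 \<inter> J = {}" "J0 \<subseteq> K" "J \<subseteq> Q"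
    "\<forall>g\<in>Q. g = (\<Sum>b\<in>J0 \<union> J. scl (pair (y b) g) b)"
    "\<forall>b\<in>J. \<forall>g\<in>K. pair (y b) g = 0"
    "\<forall>b\<in>J0 \<union> J. \<forall>b'\<in>J0 \<union> J. pair (y b) b' = (if b = b' then 1 else 0)"
proof -
  obtain J0 where J0: "J0 \<subseteq> K" "fv.independent J0" "K \<subseteq> fv.span J0"
    using fv.maximal_independent_subset[of K] by blast
  obtain B1 where B1: "J0 \<subseteq> B1" "B1 \<subseteq> Q" "fv.independent B1" "Q \<subseteq> fv.span B1"
    using fv.maximal_independent_subset_extend[of J0 Q] J0 KQ by blast
  define B where "B = fv.extend_basis B1"
  have B: "B1 \<subseteq> B" "fv.independent B" "fv.span B = UNIV"
    using B1 by (auto simp: B_def fv.extend_basis_superset fv.independent_extend_basis)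
  define y where "y b = (\<lambda>i. fv.representation B (bvec i) b)" for b
  have y: "pair (y b) g = fv.representation B g b" for b g
  proof -
    have lin: "Vector_Spaces.linear scl (*) (\<lambda>v. fv.representation B v b)"
      using fv.linear_representation[OF B(2,3)] .
    interpret l: Vector_Spaces.linear scl "(*)" "\<lambda>v. fv.representation B v b" by (rule lin)
    have "fv.representation B g b = fv.representation B (\<Sum>i\<in>UNIV. scl (g i) (bvec i)) b"
      using bvec_expand[of g] by simp
    also have "\<dots> = (\<Sum>i\<in>UNIV. g i * fv.representation B (bvec i) b)"
      by (simp add: l.sum l.scale)
    finally show ?thesis by (simp add: pair_def y_def mult.commute)
  qed
  have rep: "fv.representation B g b = fv.representation B' g b"
    if "B' \<subseteq> B" "g \<in> fv.span B'" for g b B'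
    using fv.representation_extend[OF B(2) that(2) that(1)] by simp
  have zero: "fv.representation B g b = 0" if "B' \<subseteq> B" "g \<in> fv.span B'" "b \<notin> B'" for g b B'
    using rep[OF that(1,2)] that(3) fv.representation_ne_zero by metis
  have finB1: "finite B1" using B1(3) by (rule fv.finiteI_independent)
  show thesis
  proof (rule that[of J0 "B1 - J0" y])
    show "finite J0" "finite (B1 - J0)" using finB1 B1(1) by (auto intro: finite_subset)
    show "J0 \<inter> (B1 - J0) = {}" "J0 \<subseteq> K" "B1 - J0 \<subseteq> Q" using J0 B1 by auto
    have un: "J0 \<union> (B1 - J0) = B1" using B1 by auto
    show "\<forall>g\<in>Q. g = (\<Sum>b\<in>J0 \<union> (B1 - J0). scl (pair (y b) g) b)"
    proof
      fix g assume "g \<in> Q"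
      then have g: "g \<in> fv.span B1" using B1 by auto
      show "g = (\<Sum>b\<in>J0 \<union> (B1 - J0). scl (pair (y b) g) b)"
        unfolding un y
        using fv.sum_representation_eq[OF B1(3) g finB1 subset_refl] rep[OF B(1) g] by simp
    qed
    show "\<forall>b\<in>B1 - J0. \<forall>g\<in>K. pair (y b) g = 0"
      unfolding y by (intro ballI zero[of J0]) (use B(1) B1(1) J0(3) in auto)
    show "\<forall>b\<in>J0 \<union> (B1 - J0). \<forall>b'\<in>J0 \<union> (B1 - J0). pair (y b) b' = (if b = b' then 1 else 0)"
      unfolding un y using B fv.representation_basis[OF B(2)] by auto
  qed
qed

lemma dual_basis:
  fixes V :: "('n::finite \<Rightarrow> 'k::field) set"
  assumes V: "fv.subspace V"
  obtains J y where "finite J" "J \<subseteq> V" "\<forall>g\<in>V. g = (\<Sum>b\<in>J. scl (pair (y b) g) b)"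
    "\<forall>b\<in>J. \<forall>b'\<in>J. pair (y b) b' = (if b = b' then 1 else 0)"
proof (rule adapted_dual_basis[OF V V subset_refl])
  fix J0 J and y :: "('n \<Rightarrow> 'k) \<Rightarrow> ('n \<Rightarrow> 'k)"
  assume "finite J0" "finite J" "J0 \<subseteq> V" "J \<subseteq> V"
    "\<forall>g\<in>V. g = (\<Sum>b\<in>J0 \<union> J. scl (pair (y b) g) b)"
    "\<forall>b\<in>J0 \<union> J. \<forall>b'\<in>J0 \<union> J. pair (y b) b' = (if b = b' then 1 else 0)"
  then show thesis using that[of "J0 \<union> J" y] by simp
qed

lemma separating_functional:
  fixes U :: "('n::finite \<Rightarrow> 'k::field) set"
  assumes U: "fv.subspace U" and x: "x \<notin> U"
  obtains f where "\<And>z. z \<in> U \<Longrightarrow> pair z f = 0" "pair x f \<noteq> 0"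
proof -
  obtain J0 J y where J: "finite J0" "finite J" "J0 \<inter> J = {}" "J0 \<subseteq> U"
    "\<forall>x\<in>UNIV. x = (\<Sum>b\<in>J0 \<union> J. scl (pair (y b) x) b)"
    "\<forall>b\<in>J. \<forall>g\<in>U. pair (y b) g = 0"
    by (rule adapted_dual_basis[OF U fv.subspace_UNIV subset_UNIV])
  have "\<exists>b\<in>J. pair (y b) x \<noteq> 0"
  proof (rule ccontr)
    assume "\<not> ?thesis"
    then have "x = (\<Sum>b\<in>J0. scl (pair (y b) x) b)"
      using J(1-3) bspec[OF J(5) UNIV_I, of x] by (simp add: sum.union_disjoint)
    also have "\<dots> \<in> U" using J(4) U by (intro fv.subspace_sum fv.subspace_scale) auto
    finally show False using x by simp
  qed
  then show thesis using that J(6) by (metis pair_commute)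
qed

lemma projection_onto:
  fixes U :: "('n::finite \<Rightarrow> 'k::field) set"
  assumes U: "fv.subspace U"
  obtains \<pi> where "flinear \<pi>" "\<And>x. \<pi> x \<in> U" "\<And>x. x \<in> U \<Longrightarrow> \<pi> x = x"
proof -
  interpret vector_space_pair "scl :: 'k \<Rightarrow> ('n \<Rightarrow> 'k) \<Rightarrow> _" "scl :: 'k \<Rightarrow> ('n \<Rightarrow> 'k) \<Rightarrow> _" ..
  have "flinear (\<lambda>x::'n \<Rightarrow> 'k. x)" by (rule flinearI) auto
  from linear_exists_left_inverse_on[OF this U] show thesis using that by auto
qed

text \<open>Expand the columns in a basis of \<open>V\<close>: the coefficients are linear
  combinations of rows, hence lie in \<open>W\<close>. Together with the next lemma this reduces
  membership in \<open>tens_sub V W\<close> to the slices of \<open>t\<close>.\<close>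

lemma tens_sub_if_slices:
  fixes V W :: "('n::finite \<Rightarrow> 'k::field) set"
  assumes V: "fv.subspace V" and W: "fv.subspace W"
    and col: "\<And>j. (\<lambda>i. t (i,j)) \<in> V" and row: "\<And>i. (\<lambda>j. t (i,j)) \<in> W"
  shows "t \<in> tens_sub V W"
proof -
  obtain J y where J: "finite J" "J \<subseteq> V" "\<forall>g\<in>V. g = (\<Sum>b\<in>J. scl (pair (y b) g) b)"
    by (rule dual_basis[OF V])
  define w where "w b = (\<Sum>i\<in>UNIV. scl (y b i) (\<lambda>j. t (i,j)))" for b
  have w: "w b \<in> W" for b
    unfolding w_def by (intro fv.subspace_sum[OF W] fv.subspace_scale[OF W] row)
  have "t = (\<Sum>b\<in>J. tensor b (w b))"
  proof
    fix ij :: "'n \<times> 'n"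
    obtain i j where ij: "ij = (i,j)" by (cases ij)
    have "t (i,j) = (\<Sum>b\<in>J. scl (pair (y b) (\<lambda>i. t (i,j))) b) i"
      using bspec[OF J(3) col[of j]] by (rule fun_cong)
    then show "t ij = (\<Sum>b\<in>J. tensor b (w b)) ij"
      by (simp add: ij tensor_def w_def pair_def fapply mult.commute)
  qed
  moreover have "b \<in> V" if "b \<in> J" for b using that J(2) by auto
  ultimately show ?thesis
    unfolding tens_sub_def kspan_eq using w
    by (auto intro!: fv.span_sum fv.span_base[of "tensor _ _"])
qed

lemma tens_sub_slices:
  assumes V: "fv.subspace V" and W: "fv.subspace W" and t: "t \<in> tens_sub V W"
  shows "(\<lambda>i. t (i,j)) \<in> V" "(\<lambda>j. t (i,j)) \<in> W"
proof -
  have "(\<lambda>i. t (i,j)) \<in> V \<and> (\<lambda>j. t (i,j)) \<in> W"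
    using t unfolding tens_sub_def kspan_eq
  proof (induction rule: fv.span_induct_alt)
    case base
    then show ?case using fv.subspace_0[OF V] fv.subspace_0[OF W] by (simp add: zero_fun_def)
  next
    case (step a x z)
    then obtain v w where vw: "x = tensor v w" "v \<in> V" "w \<in> W" by blast
    have "(\<lambda>i. (scl a x + z) (i,j)) = scl (a * w j) v + (\<lambda>i. z (i,j))"
      "(\<lambda>j. (scl a x + z) (i,j)) = scl (a * v i) w + (\<lambda>j. z (i,j))"
      by (auto simp: vw tensor_def fun_eq_iff fapply)
    then show ?case using step vw
      by (auto intro!: fv.subspace_add[OF V] fv.subspace_add[OF W]
          fv.subspace_scale[OF V] fv.subspace_scale[OF W])
  qed
  then show "(\<lambda>i. t (i,j)) \<in> V" "(\<lambda>j. t (i,j)) \<in> W" by auto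
qed

subsection \<open>An Engel-type lemma\<close>

text \<open>When \<open>\<Phi>\<close> preserves \<open>T\<close>, stage \<open>d\<close> consists
  of the vectors of \<open>T\<close> killed by all products of \<open>d\<close> operators from
  \<open>\<Phi>\<close>. Reaching \<open>T\<close> thus expresses that \<open>\<Phi>\<close> acts
  nilpotently.\<close>

primrec socle_chain ::
  "(('n \<Rightarrow> 'k::field) \<Rightarrow> ('n \<Rightarrow> 'k)) set \<Rightarrow> ('n \<Rightarrow> 'k) set \<Rightarrow> nat \<Rightarrow> ('n \<Rightarrow> 'k) set" where
  "socle_chain \<Phi> T 0 = {0}"
| "socle_chain \<Phi> T (Suc i) = {t \<in> T. \<forall>\<phi>\<in>\<Phi>. \<phi> t \<in> socle_chain \<Phi> T i}"

text \<open>Let \<open>S\<close> be a stage different from \<open>T\<close>, let \<open>V\<close> be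
  a minimal stable subspace strictly above \<open>S\<close>, and let \<open>v\<close> be in
  \<open>V\<close> but not in \<open>S\<close>. The stable subspace \<open>S + \<Phi> v\<close> is
  either \<open>S\<close>, and then \<open>v\<close> belongs to the next stage, or all of
  \<open>V\<close>. In the second case \<open>v = s + \<phi> v\<close>; because
  \<open>\<phi>\<close> has no fixed vector, \<open>1 - \<phi>\<close> is invertible on
  \<open>S\<close>, and correcting \<open>v\<close> by an element of \<open>S\<close> yields a
  nonzero fixed vector of \<open>\<phi>\<close>, which is impossible.\<close>

lemma socle_chain_exhausts:
  fixes T :: "('n::finite \<Rightarrow> 'k::field) set"
  assumes T: "fv.subspace T"
    and lin: "\<And>\<phi>. \<phi> \<in> \<Phi> \<Longrightarrow> flinear \<phi>"
    and stab: "\<And>\<phi> t. \<phi> \<in> \<Phi> \<Longrightarrow> t \<in> T \<Longrightarrow> \<phi> t \<in> T"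
    and nonempty: "\<Phi> \<noteq> {}"
    and add: "\<And>\<phi> \<psi>. \<phi> \<in> \<Phi> \<Longrightarrow> \<psi> \<in> \<Phi> \<Longrightarrow> (\<lambda>t. \<phi> t + \<psi> t) \<in> \<Phi>"
    and scal: "\<And>a \<phi>. \<phi> \<in> \<Phi> \<Longrightarrow> (\<lambda>t. scl a (\<phi> t)) \<in> \<Phi>"
    and comp: "\<And>\<phi> \<psi>. \<phi> \<in> \<Phi> \<Longrightarrow> \<psi> \<in> \<Phi> \<Longrightarrow> (\<lambda>t. \<phi> (\<psi> t)) \<in> \<Phi>"
    and nofix: "\<And>\<phi> t. \<phi> \<in> \<Phi> \<Longrightarrow> t \<in> T \<Longrightarrow> \<phi> t = t \<Longrightarrow> t = 0"
  shows "\<exists>d. socle_chain \<Phi> T d = T"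
proof -
  let ?S = "socle_chain \<Phi> T"
  have sub: "fv.subspace (?S i)" for i
  proof (induction i)
    case (Suc i)
    show ?case
    proof (rule fv.subspaceI)
      show "0 \<in> ?S (Suc i)"
        using fv.subspace_0[OF T] fv.subspace_0[OF Suc] by (simp add: flinear_0[OF lin])
      show "x + y \<in> ?S (Suc i)" if "x \<in> ?S (Suc i)" "y \<in> ?S (Suc i)" for x y
        using that fv.subspace_add[OF T] fv.subspace_add[OF Suc] by (simp add: flinear_add[OF lin])
      show "scl a x \<in> ?S (Suc i)" if "x \<in> ?S (Suc i)" for a x
        using that fv.subspace_scale[OF T] fv.subspace_scale[OF Suc] by (simp add: flinear_scl[OF lin])
    qed
  qed (simp add: fv.subspace_single_0)
  have mono: "?S i \<subseteq> ?S (Suc i) \<and> ?S i \<subseteq> T" for i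
    by (induction i) (auto simp: fv.subspace_0[OF T] flinear_0[OF lin])
  have grow: "?S (Suc i) \<noteq> ?S i" if ne: "?S i \<noteq> T" for i
  proof -
    let ?S = "?S i"
    have S: "fv.subspace ?S" "?S \<subseteq> T" "\<And>\<phi> t. \<phi> \<in> \<Phi> \<Longrightarrow> t \<in> ?S \<Longrightarrow> \<phi> t \<in> ?S"
      using sub mono by auto
    define P where "P V \<longleftrightarrow> fv.subspace V \<and> ?S \<subset> V \<and> V \<subseteq> T \<and> (\<forall>\<phi>\<in>\<Phi>. \<forall>t\<in>V. \<phi> t \<in> V)" for V
    have "P T" using T S ne stab by (auto simp: P_def)
    then obtain V where V: "P V" and "\<And>V'. P V' \<Longrightarrow> fv.subspace V \<Longrightarrow> fv.subspace V' \<Longrightarrow> V' \<subseteq> V \<Longrightarrow> V' = V"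
      using finite_dim_min[of P] by metis
    then have Vmin: "\<And>V'. P V' \<Longrightarrow> V' \<subseteq> V \<Longrightarrow> V' = V" by (auto simp: P_def)
    obtain v where v: "v \<in> V" "v \<notin> ?S" using V by (auto simp: P_def)
    define Y where "Y = {s + \<phi> v | s \<phi>. s \<in> ?S \<and> \<phi> \<in> \<Phi>}"
    obtain \<phi>0 where "\<phi>0 \<in> \<Phi>" using nonempty by auto
    from scal[OF this, of 0] have z: "(\<lambda>t. 0) \<in> \<Phi>" by simp
    have YI: "s + \<phi> v \<in> Y" if "s \<in> ?S" "\<phi> \<in> \<Phi>" for s \<phi>
      using that unfolding Y_def by blast
    have YV: "Y \<subseteq> V" using V v by (auto simp: Y_def P_def intro!: fv.subspace_add)
    have SY: "?S \<subseteq> Y"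
    proof
      fix s assume "s \<in> ?S"
      then show "s \<in> Y" using YI[OF _ z, of s] by simp
    qed
    have Ysub: "fv.subspace Y"
      unfolding fv.subspace_def
    proof (intro conjI ballI allI)
      show "0 \<in> Y" using SY fv.subspace_0[OF S(1)] by auto
      fix x assume "x \<in> Y"
      then obtain s \<phi> where x: "x = s + \<phi> v" "s \<in> ?S" "\<phi> \<in> \<Phi>" by (auto simp: Y_def)
      show "scl a x \<in> Y" for a
      proof -
        have "scl a x = scl a s + scl a (\<phi> v)" by (simp add: x fv.scale_right_distrib)
        then show ?thesis using YI[OF fv.subspace_scale[OF S(1) x(2)] scal[OF x(3)]] by simp
      qed
      fix x' assume "x' \<in> Y"
      then obtain s' \<phi>' where x': "x' = s' + \<phi>' v" "s' \<in> ?S" "\<phi>' \<in> \<Phi>" by (auto simp: Y_def)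
      have "x + x' = (s + s') + (\<phi> v + \<phi>' v)" by (simp add: x x' algebra_simps)
      then show "x + x' \<in> Y"
        using YI[OF fv.subspace_add[OF S(1) x(2) x'(2)] add[OF x(3) x'(3)]] by simp
    qed
    have Ystab: "\<phi> x \<in> Y" if \<phi>: "\<phi> \<in> \<Phi>" and "x \<in> Y" for \<phi> x
    proof -
      obtain s \<psi> where x: "x = s + \<psi> v" "s \<in> ?S" "\<psi> \<in> \<Phi>" using \<open>x \<in> Y\<close> by (auto simp: Y_def)
      have "\<phi> x = \<phi> s + \<phi> (\<psi> v)" by (simp add: x flinear_add[OF lin[OF \<phi>]])
      then show ?thesis using YI[OF S(3)[OF \<phi> x(2)] comp[OF \<phi> x(3)]] by simp
    qed
    have "Y = ?S"
    proof (rule ccontr)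
      assume "Y \<noteq> ?S"
      then have "P Y" using SY Ysub Ystab YV V by (auto simp: P_def)
      then have "v \<in> Y" using Vmin YV v by auto
      then obtain s \<phi> where s: "v = s + \<phi> v" "s \<in> ?S" and \<phi>: "\<phi> \<in> \<Phi>" by (auto simp: Y_def)
      let ?g = "\<lambda>t. t - \<phi> t"
      have g: "flinear ?g"
        by (rule flinearI)
          (auto simp: flinear_add[OF lin[OF \<phi>]] flinear_scl[OF lin[OF \<phi>]] fv.scale_right_diff_distrib)
      have "?g ` ?S = ?S"
      proof (rule flinear_inj_on_surj[OF g S(1)])
        show "?g ` ?S \<subseteq> ?S" using S(3)[OF \<phi>] fv.subspace_diff[OF S(1)] by auto
        show "x = 0" if "x \<in> ?S" "x - \<phi> x = 0" for x
          using nofix[OF \<phi>, of x] that S(2) by auto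
      qed
      then obtain s' where s': "s' \<in> ?S" "s = s' - \<phi> s'" using s(2) by blast
      have "\<phi> (v - s') = v - s'"
        using s(1) s'(2) by (simp add: flinear_diff[OF lin[OF \<phi>]] algebra_simps)
      moreover have "v - s' \<in> T" using v V s'(1) S(2) T by (auto simp: P_def intro!: fv.subspace_diff)
      ultimately have "v - s' = 0" using nofix[OF \<phi>] by blast
      then show False using v(2) s'(1) by simp
    qed
    have "v \<in> socle_chain \<Phi> T (Suc i)"
    proof -
      have "\<phi> v \<in> ?S" if "\<phi> \<in> \<Phi>" for \<phi>
      proof -
        have "0 + \<phi> v \<in> Y" by (rule YI[OF fv.subspace_0[OF S(1)] that])
        then show ?thesis using \<open>Y = ?S\<close> by simp
      qed
      then show ?thesis using v V by (auto simp: P_def)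
    qed
    then show ?thesis using v(2) by blast
  qed
  \<comment> \<open>Each stage gains at least one dimension as long as \<open>T\<close> is not
    reached.\<close>
  have "i \<le> fv.dim (?S i) \<or> ?S i = T" for i
  proof (induction i)
    case (Suc i)
    show ?case
    proof (cases "?S i = T")
      case True
      then show ?thesis using mono[of i] mono[of "Suc i"] by blast
    next
      case False
      have "\<not> fv.dim (?S (Suc i)) \<le> fv.dim (?S i)"
        using fv.subspace_dim_equal[OF sub sub, of i "Suc i"] grow[OF False] mono[of i] by auto
      then show ?thesis using Suc False by auto
    qed
  qed simp
  then have "?S (Suc (fv.dim T)) = T"
    using fv.dim_subset[of "?S (Suc (fv.dim T))" T] mono[of "Suc (fv.dim T)"]
    by (metis Suc_n_not_le_n order.trans)
  then show ?thesis by blast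
qed

text \<open>The first stage that meets \<open>V\<close> nontrivially has a positive index. An
  operator that preserves \<open>V\<close> and lowers the stage by one must then kill
  \<open>f\<close>.\<close>

lemma chain_first_meet:
  fixes T :: "nat \<Rightarrow> ('n \<Rightarrow> 'k::field) set"
  assumes V: "fv.subspace V" "V \<noteq> {0}" and T: "T 0 \<subseteq> {0}" "V \<subseteq> T d"
  obtains f k where "f \<in> V" "f \<noteq> 0" "f \<in> T (Suc k)" "\<forall>g\<in>V. g \<in> T k \<longrightarrow> g = 0"
proof -
  define P where "P i \<longleftrightarrow> (\<exists>f\<in>V. f \<noteq> 0 \<and> f \<in> T i)" for i
  obtain f0 where "f0 \<in> V" "f0 \<noteq> 0" using V(2) fv.subspace_0[OF V(1)] by blast
  then have "P d" using T(2) by (auto simp: P_def)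
  then have P: "P (LEAST i. P i)" by (rule LeastI)
  then obtain k where k: "(LEAST i. P i) = Suc k"
    using T(1) by (cases "LEAST i. P i") (auto simp: P_def)
  obtain f where f: "f \<in> V" "f \<noteq> 0" "f \<in> T (Suc k)" using P k by (auto simp: P_def)
  have "\<not> P k" using not_less_Least[of k P] k by simp
  then show thesis using that[OF f] by (auto simp: P_def)
qed

subsection \<open>Commutative algebras given by structure constants\<close>

text \<open>The transpose of the comultiplication with structure constants \<open>c\<close>, that
  is, the convolution product of functionals.\<close>

definition star :: "('n::finite \<Rightarrow> 'n \<Rightarrow> 'n \<Rightarrow> 'k::field) \<Rightarrow> ('n \<Rightarrow> 'k) \<Rightarrow> ('n \<Rightarrow> 'k) \<Rightarrow> ('n \<Rightarrow> 'k)" where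
  "star c f g = (\<lambda>l. \<Sum>i\<in>UNIV. \<Sum>j\<in>UNIV. c l i j * f i * g j)"

lemma star_add_left: "star c (f + f') g = star c f g + star c f' g"
  and star_add_right: "star c f (g + g') = star c f g + star c f g'"
  and star_diff_left: "star c (f - f') g = star c f g - star c f' g"
  and star_diff_right: "star c f (g - g') = star c f g - star c f g'"
  and star_scl_left: "star c (scl a f) g = scl a (star c f g)"
  and star_scl_right: "star c f (scl a g) = scl a (star c f g)"
  and star_0_left [simp]: "star c 0 g = 0"
  and star_0_right [simp]: "star c f 0 = 0"
  by (simp_all add: star_def fapply fun_eq_iff algebra_simps sum.distrib sum_subtractf sum_distrib_left)

lemma star_sum_left: "star c (\<Sum>i\<in>A. f i) g = (\<Sum>i\<in>A. star c (f i) g)"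
  by (induction A rule: infinite_finite_induct) (auto simp: star_add_left)

lemma star_sum_right: "star c f (\<Sum>i\<in>A. g i) = (\<Sum>i\<in>A. star c f (g i))"
  by (induction A rule: infinite_finite_induct) (auto simp: star_add_right)

lemmas star_linear = star_add_left star_add_right star_diff_left star_diff_right
  star_scl_left star_scl_right star_sum_left star_sum_right

lemma flinear_star_left: "flinear (star c f)" and flinear_star_right: "flinear (\<lambda>g. star c g f)"
  by (auto intro!: flinearI simp: star_linear)

primrec spow :: "('n::finite \<Rightarrow> 'n \<Rightarrow> 'n \<Rightarrow> 'k::field) \<Rightarrow> ('n \<Rightarrow> 'k) \<Rightarrow> ('n \<Rightarrow> 'k) \<Rightarrow> nat \<Rightarrow> ('n \<Rightarrow> 'k)" where
  "spow c e f 0 = e"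
| "spow c e f (Suc n) = star c f (spow c e f n)"

locale calg =
  fixes c :: "'n::finite \<Rightarrow> 'n \<Rightarrow> 'n \<Rightarrow> 'k::field" and e :: "'n \<Rightarrow> 'k"
  assumes star_assoc: "star c (star c f g) h = star c f (star c g h)"
    and star_commute: "star c f g = star c g f"
    and star_one_left: "star c e f = f"
begin

abbreviation calg_mult (infixl "\<star>" 70) where "f \<star> g \<equiv> star c f g"
abbreviation "pw \<equiv> spow c e"

lemma star_one_right: "f \<star> e = f"
  using star_one_left star_commute by metis

lemma star_left_commute: "f \<star> (g \<star> h) = g \<star> (f \<star> h)"
  by (metis star_assoc star_commute)

lemmas star_ac = star_assoc star_commute star_left_commute

lemma pw_one: "pw e n = e" 
  by (induction n) (auto simp: star_one_left)

lemma pw_0: "n > 0 \<Longrightarrow> pw 0 n = 0"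
  by (cases n) auto

lemma pw_add: "pw f (m + n) = pw f m \<star> pw f n"
  by (induction m) (auto simp: star_one_left star_assoc)

lemma pw_star: "pw (f \<star> g) n = pw f n \<star> pw g n"
  by (induction n) (auto simp: star_one_left star_ac)

lemma pw_pw: "pw (pw f m) n = pw f (m * n)"
  by (induction n) (auto simp: pw_add)

lemma pw_scl: "pw (scl a f) n = scl (a ^ n) (pw f n)"
  by (induction n) (auto simp: star_linear mult.commute)

lemma pw_binomial:
  "pw (f + g) n = (\<Sum>k\<le>n. scl (of_nat (n choose k)) (pw f k \<star> pw g (n - k)))"
proof (induction n)
  case 0
  then show ?case by (simp add: star_one_left)
next
  case (Suc n)
  let ?F = "\<lambda>i j. pw f i \<star> pw g j"
  have "pw (f + g) (Suc n) = (\<Sum>k\<le>n. scl (of_nat (n choose k)) (?F (Suc k) (n - k)))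
      + (\<Sum>k\<le>n. scl (of_nat (n choose k)) (?F k (Suc n - k)))"
    by (simp add: Suc.IH star_linear star_assoc star_left_commute[of g] Suc_diff_le
        sum.distrib fv.scale_right_distrib)
  also have "(\<Sum>k\<le>n. scl (of_nat (n choose k)) (?F k (Suc n - k)))
      = (\<Sum>k\<le>Suc n. scl (of_nat (n choose k)) (?F k (Suc n - k)))"
    by (simp add: binomial_eq_0)
  also have "\<dots> = ?F 0 (Suc n) + (\<Sum>k\<le>n. scl (of_nat (n choose Suc k)) (?F (Suc k) (n - k)))"
    by (subst sum.atMost_Suc_shift) simp
  also have "(\<Sum>k\<le>n. scl (of_nat (n choose k)) (?F (Suc k) (n - k))) + \<dots>
      = ?F 0 (Suc n) + (\<Sum>k\<le>n. scl (of_nat (Suc n choose Suc k)) (?F (Suc k) (n - k)))"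
    by (simp add: sum.distrib[symmetric] fv.scale_left_distrib algebra_simps)
  also have "\<dots> = (\<Sum>k\<le>Suc n. scl (of_nat (Suc n choose k)) (?F k (Suc n - k)))"
    by (subst sum.atMost_Suc_shift) simp
  finally show ?case .
qed

lemma pw_frobenius_add:
  assumes p: "prime p" and char: "of_nat p = (0::'k)"
  shows "pw (f + g) p = pw f p + pw g p"
proof -
  have p0: "p > 0" using p by (simp add: prime_gt_0_nat)
  have z: "of_nat (p choose k) = (0::'k)" if "0 < k" "k < p" for k
  proof -
    have "p dvd (p choose k)" using p that by (intro dvd_choose_prime) auto
    then show ?thesis using char by (metis dvdE mult_zero_left of_nat_mult)
  qed
  have "pw (f + g) p = (\<Sum>k\<le>p. scl (of_nat (p choose k)) (pw f k \<star> pw g (p - k)))"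
    by (rule pw_binomial)
  also have "\<dots> = (\<Sum>k\<in>{0,p}. scl (of_nat (p choose k)) (pw f k \<star> pw g (p - k)))"
    by (rule sum.mono_neutral_right) (auto simp: z)
  also have "\<dots> = pw f p + pw g p" using p0 by (simp add: star_one_left star_one_right)
  finally show ?thesis .
qed

lemma pw_frobenius_sum:
  assumes p: "prime p" and char: "of_nat p = (0::'k)"
  shows "pw (\<Sum>i\<in>A. f i) p = (\<Sum>i\<in>A. pw (f i) p)"
  using p by (induction A rule: infinite_finite_induct)
    (auto simp: pw_frobenius_add[OF p char] pw_0 prime_gt_0_nat)

end

subsection \<open>The tensor square of a commutative algebra\<close>

definition tsc :: "('n \<Rightarrow> 'n \<Rightarrow> 'n \<Rightarrow> 'k::field) \<Rightarrow> 'n \<times> 'n \<Rightarrow> 'n \<times> 'n \<Rightarrow> 'n \<times> 'n \<Rightarrow> 'k" where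
  "tsc c l i j = c (fst l) (fst i) (fst j) * c (snd l) (snd i) (snd j)"

lemma tensor_induct [case_names tensor add]:
  fixes t :: "'n::finite \<times> 'n \<Rightarrow> 'k::field"
  assumes tens: "\<And>v w. P (tensor v w)" and add: "\<And>x y. P x \<Longrightarrow> P y \<Longrightarrow> P (x + y)"
  shows "P t"
proof -
  have "t = (\<Sum>i\<in>UNIV. tensor (bvec i) (\<lambda>j. t (i,j)))"
    by (auto simp: fun_eq_iff fapply tensor_def bvec_apply if_distrib[of "\<lambda>z. z * _"] cong: if_cong)
  moreover have "P (\<Sum>i\<in>A. tensor (bvec i) (\<lambda>j. t (i,j)))" for A
  proof (induction A rule: infinite_finite_induct)
    case (insert x F)
    then show ?case by (auto intro: add tens)
  qed (use tens[of 0 0] in \<open>simp_all add: tensor_def zero_fun_def case_prod_unfold\<close>)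
  ultimately show ?thesis by metis
qed

lemma sum_UNIV_prod:
  fixes f :: "'a::finite \<times> 'b::finite \<Rightarrow> 'c::comm_monoid_add"
  shows "(\<Sum>p\<in>UNIV. f p) = (\<Sum>i\<in>UNIV. \<Sum>j\<in>UNIV. f (i,j))"
  by (simp add: sum.cartesian_product)

lemma star_tensor: "star (tsc c) (tensor a b) (tensor a' b') = tensor (star c a a') (star c b b')"
proof
  fix l :: "'a \<times> 'a"
  have "star (tsc c) (tensor a b) (tensor a' b') l
    = (\<Sum>i\<in>UNIV. \<Sum>i'\<in>UNIV. \<Sum>j\<in>UNIV. \<Sum>j'\<in>UNIV.
        (c (fst l) i j * a i * a' j) * (c (snd l) i' j' * b i' * b' j'))"
    by (simp add: star_def tsc_def tensor_def sum_UNIV_prod mult_ac)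
  also have "\<dots> = (\<Sum>i\<in>UNIV. \<Sum>j\<in>UNIV. c (fst l) i j * a i * a' j) *
      (\<Sum>i'\<in>UNIV. \<Sum>j'\<in>UNIV. c (snd l) i' j' * b i' * b' j')"
    by (simp only: sum_product)
  finally show "star (tsc c) (tensor a b) (tensor a' b') l = tensor (star c a a') (star c b b') l"
    by (simp add: tensor_def star_def case_prod_beta)
qed

text \<open>The tensor square is again an instance of \<open>calg\<close>, now over pairs of
  indices, which makes the Frobenius identities available in it.\<close>

lemma (in calg) tensor_calg: "calg (tsc c) (tensor e e)"
proof
  show "star (tsc c) (tensor e e) t = t" for t
    by (induction t rule: tensor_induct) (auto simp: star_tensor star_one_left star_linear)
  show "star (tsc c) t t' = star (tsc c) t' t" for t t'
  proof (induction t rule: tensor_induct)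
    case (tensor v w)
    show ?case
      by (induction t' rule: tensor_induct)
        (auto simp: star_tensor star_linear star_commute[of v] star_commute[of w])
  qed (auto simp: star_linear)
  show "star (tsc c) (star (tsc c) t t') t'' = star (tsc c) t (star (tsc c) t' t'')" for t t' t''
  proof (induction t rule: tensor_induct)
    case (tensor v w)
    show ?case
    proof (induction t' rule: tensor_induct)
      case (tensor v' w')
      show ?case
        by (induction t'' rule: tensor_induct) (auto simp: star_tensor star_assoc star_linear)
    qed (auto simp: star_linear)
  qed (auto simp: star_linear)
qed

lemma spow_tensor: "spow (tsc c) (tensor e e) (tensor a b) n = tensor (spow c e a n) (spow c e b n)"
  by (induction n) (auto simp: star_tensor)

subsection \<open>Hopf algebras and the actions on the dual algebra\<close>

lemma vec_induct [case_names basis scl add]: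
  fixes x :: "'n::finite \<Rightarrow> 'k::field"
  assumes b: "\<And>i. P (bvec i)" and s: "\<And>a x. P x \<Longrightarrow> P (scl a x)" and a: "\<And>x y. P x \<Longrightarrow> P y \<Longrightarrow> P (x + y)"
  shows "P x"
proof -
  have "P (\<Sum>i\<in>A. scl (x i) (bvec i))" for A
  proof (induction A rule: infinite_finite_induct)
    case (insert x F)
    then show ?case by (auto intro: a s b)
  qed (use s[OF b, of 0] in simp_all)
  then show ?thesis using bvec_expand[of x] by metis
qed

lemma star_bvec: "star c (bvec i) (bvec j) = (\<lambda>l. c l i j)"
  by (simp add: star_def bvec_apply fun_eq_iff if_distrib[of "\<lambda>z. _ * z"] cong: if_cong)

lemma hmul_bvec: "hmul m (bvec i) (bvec j) = m i j"
  by (simp add: hmul_def bvec_apply fun_eq_iff if_distrib[of "\<lambda>z. z * _"] if_distrib[of "\<lambda>z. _ * z"] cong: if_cong)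

lemma hmul_add_left: "hmul m (x + x') y = hmul m x y + hmul m x' y"
  and hmul_add_right: "hmul m x (y + y') = hmul m x y + hmul m x y'"
  and hmul_diff_left: "hmul m (x - x') y = hmul m x y - hmul m x' y"
  and hmul_diff_right: "hmul m x (y - y') = hmul m x y - hmul m x y'"
  and hmul_scl_left: "hmul m (scl a x) y = scl a (hmul m x y)"
  and hmul_scl_right: "hmul m x (scl a y) = scl a (hmul m x y)"
  and hmul_0_left [simp]: "hmul m 0 y = 0"
  and hmul_0_right [simp]: "hmul m x 0 = 0"
  by (simp_all add: hmul_def fapply fun_eq_iff algebra_simps sum.distrib sum_subtractf sum_distrib_left)

lemma hmul_sum_left: "hmul m (\<Sum>i\<in>A. x i) y = (\<Sum>i\<in>A. hmul m (x i) y)"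
  by (induction A rule: infinite_finite_induct) (auto simp: hmul_add_left)

lemma hmul_sum_right: "hmul m x (\<Sum>i\<in>A. y i) = (\<Sum>i\<in>A. hmul m x (y i))"
  by (induction A rule: infinite_finite_induct) (auto simp: hmul_add_right)

lemmas hmul_linear = hmul_add_left hmul_add_right hmul_diff_left hmul_diff_right
  hmul_scl_left hmul_scl_right hmul_sum_left hmul_sum_right

lemma hcomul_add: "hcomul c (x + y) = hcomul c x + hcomul c y"
  and hcomul_scl: "hcomul c (scl a x) = scl a (hcomul c x)"
  by (simp_all add: hcomul_def fapply fun_eq_iff algebra_simps sum.distrib sum_distrib_left split: prod.splits)

lemma hcomul_bvec: "hcomul c (bvec l) p = c l (fst p) (snd p)"
  by (simp add: hcomul_def bvec_apply case_prod_unfold if_distrib[of "\<lambda>z. z * _"] cong: if_cong)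

lemma pair_star: "pair x (star c f g) = (\<Sum>p\<in>UNIV. hcomul c x p * (f (fst p) * g (snd p)))"
proof -
  have "pair x (star c f g) = (\<Sum>l\<in>UNIV. \<Sum>p\<in>UNIV. x l * (c l (fst p) (snd p) * f (fst p) * g (snd p)))"
    by (simp add: pair_def star_def sum_distrib_left sum_UNIV_prod)
  also have "\<dots> = (\<Sum>p\<in>UNIV. \<Sum>l\<in>UNIV. x l * (c l (fst p) (snd p) * f (fst p) * g (snd p)))"
    by (rule sum.swap)
  finally show ?thesis
    by (simp add: hcomul_def case_prod_unfold sum_distrib_left mult_ac)
qed

locale hopf =
  fixes m :: "'n::finite \<Rightarrow> 'n \<Rightarrow> 'n \<Rightarrow> 'k::field"
    and u :: "'n \<Rightarrow> 'k" and c :: "'n \<Rightarrow> 'n \<Rightarrow> 'n \<Rightarrow> 'k"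
    and e :: "'n \<Rightarrow> 'k" and s :: "'n \<Rightarrow> 'n \<Rightarrow> 'k"
  assumes hopf: "hopf_algebra m u c e s" and cocomm: "cocommutative c"
begin

abbreviation hopf_mult (infixl "\<odot>" 75) where "x \<odot> y \<equiv> hmul m x y"
abbreviation "\<Delta> \<equiv> hcomul c"
abbreviation "S \<equiv> hantipode s"

lemma mult_assoc: "x \<odot> y \<odot> z = x \<odot> (y \<odot> z)"
  and mult_one_left: "u \<odot> x = x"
  and mult_one_right: "x \<odot> u = x"
  and comul_mult: "\<Delta> (x \<odot> y) = tmul m (\<Delta> x) (\<Delta> y)"
  and comul_one: "\<Delta> u = tensor u u"
  and counit_mult: "pair (x \<odot> y) e = pair x e * pair y e"
  and counit_one: "pair u e = 1"
  and counit_right: "(\<Sum>l\<in>UNIV. \<Delta> x (i,l) * e l) = x i"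
  using hopf by (auto simp: hopf_algebra_def hcounit_def pair_def)

lemma comul_commute: "\<Delta> x (i,j) = \<Delta> x (j,i)"
  using cocomm by (simp add: cocommutative_def)

lemma coassoc: "(\<Sum>l\<in>UNIV. \<Delta> x (l,d) * c l a b) = (\<Sum>l\<in>UNIV. \<Delta> x (a,l) * c l b d)"
proof -
  have "comul_left c (\<Delta> x) (a,b,d) = comul_right c (\<Delta> x) (a,b,d)"
    using hopf by (simp add: hopf_algebra_def)
  then show ?thesis by (simp add: comul_left_def comul_right_def)
qed

lemma antipode_right: "(\<Sum>p\<in>UNIV. scl (\<Delta> x p) (bvec (fst p) \<odot> S (bvec (snd p)))) = scl (pair x e) u"
proof -
  have "(\<lambda>l. \<Sum>i\<in>UNIV. \<Sum>j\<in>UNIV. \<Delta> x (i,j) * hmul m (bvec i) (S (bvec j)) l) = (\<lambda>l. hcounit e x * u l)"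
    using hopf by (simp add: hopf_algebra_def)
  then show ?thesis
    by (simp add: fun_eq_iff fapply sum_UNIV_prod hcounit_def pair_def)
qed

text \<open>Cocommutativity, the counit law and coassociativity turn into commutativity, the unit
  law and associativity of the dual algebra. The counit \<open>e\<close> of \<open>H\<close> is the
  unit there.\<close>

sublocale calg c e
proof
  show comm: "star c f g = star c g f" for f g
  proof (induction f rule: vec_induct)
    case (basis i)
    show ?case
    proof (induction g rule: vec_induct)
      case (basis j)
      show ?case
        using comul_commute[of "bvec _" i j] by (simp add: star_bvec hcomul_bvec)
    qed (auto simp: star_linear)
  qed (auto simp: star_linear)
  show "star c e f = f" for f
  proof (rule pair_eqI)
    fix x
    have "pair x (star c f e) = (\<Sum>i\<in>UNIV. f i * (\<Sum>j\<in>UNIV. \<Delta> x (i,j) * e j))"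
      by (simp add: pair_star sum_UNIV_prod sum_distrib_left mult_ac)
    also have "\<dots> = pair x f" by (simp only: counit_right) (simp add: pair_def mult.commute)
    finally show "pair x (star c e f) = pair x f" by (simp only: comm[of e])
  qed
  show "star c (star c f g) h = star c f (star c g h)" for f g h
  proof (induction f rule: vec_induct)
    case (basis i)
    show ?case
    proof (induction g rule: vec_induct)
      case (basis j)
      show ?case
      proof (induction h rule: vec_induct)
        case (basis k)
        have 1: "star c (\<lambda>l. f l) (bvec k) = (\<lambda>l. \<Sum>p\<in>UNIV. c l p k * f p)" for f k
          by (simp add: star_def bvec_apply fun_eq_iff if_distrib[of "\<lambda>z. _ * z"] cong: if_cong)
        have 2: "star c (bvec i) (\<lambda>l. f l) = (\<lambda>l. \<Sum>p\<in>UNIV. c l i p * f p)" for f i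
          by (subst comm) (use comul_commute[of "bvec _" i] in \<open>simp add: 1 hcomul_bvec\<close>)
        show ?case
          unfolding star_bvec 1 2 using coassoc[of "bvec _" k i j] by (simp add: hcomul_bvec)
      qed (auto simp: star_linear)
    qed (auto simp: star_linear)
  qed (auto simp: star_linear)
qed

text \<open>\<open>L h\<close> is transposed right multiplication and \<open>R h\<close> is
  transposed left multiplication. Hence \<open>L\<close> is a left action, \<open>R\<close> is a
  right action, and the two commute. They are the translations of functions on a group.\<close>

definition L :: "('n \<Rightarrow> 'k) \<Rightarrow> ('n \<Rightarrow> 'k) \<Rightarrow> ('n \<Rightarrow> 'k)" where
  "L h f = (\<lambda>i. pair (bvec i \<odot> h) f)"

definition R :: "('n \<Rightarrow> 'k) \<Rightarrow> ('n \<Rightarrow> 'k) \<Rightarrow> ('n \<Rightarrow> 'k)" where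
  "R h f = (\<lambda>i. pair (h \<odot> bvec i) f)"

lemma pair_L: "pair x (L h f) = pair (x \<odot> h) f"
proof -
  have "pair x (L h f) = pair ((\<Sum>i\<in>UNIV. scl (x i) (bvec i)) \<odot> h) f"
    by (simp only: hmul_linear pair_linear) (simp add: pair_def[of x] L_def)
  then show ?thesis by (simp only: bvec_expand[symmetric])
qed

lemma pair_R: "pair x (R h f) = pair (h \<odot> x) f"
proof -
  have "pair x (R h f) = pair (h \<odot> (\<Sum>i\<in>UNIV. scl (x i) (bvec i))) f"
    by (simp only: hmul_linear pair_linear) (simp add: pair_def[of x] R_def)
  then show ?thesis by (simp only: bvec_expand[symmetric])
qed

lemma L_linear:
  "L h (f + g) = L h f + L h g" "L h (f - g) = L h f - L h g" "L h (scl a f) = scl a (L h f)"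
  "L h 0 = 0" "L h (\<Sum>i\<in>A. F i) = (\<Sum>i\<in>A. L h (F i))"
  "L (h + h') f = L h f + L h' f" "L (h - h') f = L h f - L h' f" "L (scl a h) f = scl a (L h f)"
  "L 0 f = 0" "L (\<Sum>i\<in>A. H i) f = (\<Sum>i\<in>A. L (H i) f)"
  by (rule pair_eqI, simp only: pair_L pair_linear hmul_linear hmul_0_right)+

lemma R_linear:
  "R h (f + g) = R h f + R h g" "R h (f - g) = R h f - R h g" "R h (scl a f) = scl a (R h f)"
  "R h 0 = 0" "R h (\<Sum>i\<in>A. F i) = (\<Sum>i\<in>A. R h (F i))"
  "R (h + h') f = R h f + R h' f" "R (h - h') f = R h f - R h' f" "R (scl a h) f = scl a (R h f)"
  "R 0 f = 0" "R (\<Sum>i\<in>A. H i) f = (\<Sum>i\<in>A. R (H i) f)"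
  by (rule pair_eqI, simp only: pair_R pair_linear hmul_linear hmul_0_left)+

lemma flinear_L: "flinear (L h)" and flinear_R: "flinear (R h)"
  by (auto intro!: flinearI simp: L_linear R_linear)

lemma L_L: "L h (L h' f) = L (h \<odot> h') f" and R_R: "R h (R h' f) = R (h' \<odot> h) f"
  and L_R: "L h (R h' f) = R h' (L h f)" and L_one: "L u f = f" and R_one: "R u f = f"
  by (rule pair_eqI, simp only: pair_L pair_R mult_assoc mult_one_left mult_one_right)+

lemma counit_L: "pair u (L h f) = pair h f" and counit_R: "pair u (R h f) = pair h f"
  by (simp_all add: pair_L pair_R mult_one_left mult_one_right)

lemma counit_star: "pair u (f \<star> g) = pair u f * pair u g"
  by (subst pair_star) (simp add: comul_one tensor_def case_prod_unfold sum_UNIV_prod pair_def sum_product mult_ac)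

lemma pair_mult_star:
  "pair (x \<odot> y) (f \<star> g) = (\<Sum>p\<in>UNIV. \<Sum>q\<in>UNIV. \<Delta> x p * \<Delta> y q *
    (pair (bvec (fst p) \<odot> bvec (fst q)) f * pair (bvec (snd p) \<odot> bvec (snd q)) g))"
proof -
  let ?M = "\<lambda>p q a b. m (fst p) (fst q) a * m (snd p) (snd q) b"
  have M: "(\<Sum>r\<in>UNIV. ?M p q (fst r) (snd r) * (f (fst r) * g (snd r)))
      = pair (bvec (fst p) \<odot> bvec (fst q)) f * pair (bvec (snd p) \<odot> bvec (snd q)) g" for p q
  proof -
    have "(\<Sum>r\<in>UNIV. ?M p q (fst r) (snd r) * (f (fst r) * g (snd r)))
      = (\<Sum>i\<in>UNIV. \<Sum>j\<in>UNIV. (m (fst p) (fst q) i * f i) * (m (snd p) (snd q) j * g j))"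
      by (simp add: sum_UNIV_prod mult_ac)
    then show ?thesis by (simp only: sum_product[symmetric] hmul_bvec pair_def)
  qed
  have t: "tmul m (\<Delta> x) (\<Delta> y) r = (\<Sum>p\<in>UNIV. \<Sum>q\<in>UNIV. \<Delta> x p * \<Delta> y q * ?M p q (fst r) (snd r))" for r
    by (simp add: tmul_def case_prod_unfold sum_UNIV_prod mult_ac)
  have "pair (x \<odot> y) (f \<star> g) = (\<Sum>r\<in>UNIV. \<Sum>p\<in>UNIV. \<Sum>q\<in>UNIV.
      \<Delta> x p * \<Delta> y q * ?M p q (fst r) (snd r) * (f (fst r) * g (snd r)))"
    unfolding pair_star comul_mult t by (simp add: sum_distrib_right)
  also have "\<dots> = (\<Sum>p\<in>UNIV. \<Sum>r\<in>UNIV. \<Sum>q\<in>UNIV.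
      \<Delta> x p * \<Delta> y q * ?M p q (fst r) (snd r) * (f (fst r) * g (snd r)))"
    by (rule sum.swap)
  also have "\<dots> = (\<Sum>p\<in>UNIV. \<Sum>q\<in>UNIV. \<Sum>r\<in>UNIV.
      \<Delta> x p * \<Delta> y q * ?M p q (fst r) (snd r) * (f (fst r) * g (snd r)))"
    by (rule sum.cong[OF refl], rule sum.swap)
  also have "\<dots> = (\<Sum>p\<in>UNIV. \<Sum>q\<in>UNIV. \<Delta> x p * \<Delta> y q *
    (pair (bvec (fst p) \<odot> bvec (fst q)) f * pair (bvec (snd p) \<odot> bvec (snd q)) g))"
    by (simp only: M[symmetric] sum_distrib_left mult.assoc)
  finally show ?thesis .
qed

text \<open>The dual algebra is a module algebra under \<open>L\<close>, since the comultiplication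
  of \<open>H\<close> is multiplicative.\<close>

lemma L_star: "L h (f \<star> g) = (\<Sum>p\<in>UNIV. scl (\<Delta> h p) (L (bvec (fst p)) f \<star> L (bvec (snd p)) g))"
proof (rule pair_eqI)
  fix x
  show "pair x (L h (f \<star> g)) = pair x (\<Sum>p\<in>UNIV. scl (\<Delta> h p) (L (bvec (fst p)) f \<star> L (bvec (snd p)) g))"
    unfolding pair_L pair_mult_star pair_linear pair_star[of x] sum_distrib_left
    by (subst sum.swap) (simp add: L_def mult_ac)
qed

text \<open>Coassociativity in the form used in Sweedler calculations: the two iterated
  comultiplications agree when summed against any vector-valued expression \<open>F\<close>. Apart
  from one use of \<open>coassoc\<close> the sums are only reordered.\<close>

lemma coassoc_sum:
  fixes F :: "'n \<Rightarrow> 'n \<Rightarrow> 'n \<Rightarrow> 'n \<Rightarrow> 'k"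
  shows "(\<Sum>p\<in>UNIV. \<Sum>q\<in>UNIV. scl (\<Delta> h p * c (fst p) (fst q) (snd q)) (F (fst q) (snd q) (snd p)))
    = (\<Sum>p\<in>UNIV. \<Sum>q\<in>UNIV. scl (\<Delta> h p * c (snd p) (fst q) (snd q)) (F (fst p) (fst q) (snd q)))"
    (is "?l = ?r")
proof -
  have "?l = (\<Sum>l\<in>UNIV. \<Sum>d\<in>UNIV. \<Sum>a\<in>UNIV. \<Sum>b\<in>UNIV. scl (\<Delta> h (l,d) * c l a b) (F a b d))"
    by (simp add: sum_UNIV_prod)
  also have "\<dots> = (\<Sum>d\<in>UNIV. \<Sum>l\<in>UNIV. \<Sum>a\<in>UNIV. \<Sum>b\<in>UNIV. scl (\<Delta> h (l,d) * c l a b) (F a b d))"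
    by (rule sum.swap)
  also have "\<dots> = (\<Sum>d\<in>UNIV. \<Sum>a\<in>UNIV. \<Sum>l\<in>UNIV. \<Sum>b\<in>UNIV. scl (\<Delta> h (l,d) * c l a b) (F a b d))"
    by (rule sum.cong[OF refl], rule sum.swap)
  also have "\<dots> = (\<Sum>d\<in>UNIV. \<Sum>a\<in>UNIV. \<Sum>b\<in>UNIV. \<Sum>l\<in>UNIV. scl (\<Delta> h (l,d) * c l a b) (F a b d))"
    by (rule sum.cong[OF refl], rule sum.cong[OF refl], rule sum.swap)
  also have "\<dots> = (\<Sum>d\<in>UNIV. \<Sum>a\<in>UNIV. \<Sum>b\<in>UNIV. \<Sum>l\<in>UNIV. scl (\<Delta> h (a,l) * c l b d) (F a b d))"
    by (simp only: fv.scale_sum_left[symmetric] coassoc)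
  also have "\<dots> = (\<Sum>a\<in>UNIV. \<Sum>d\<in>UNIV. \<Sum>b\<in>UNIV. \<Sum>l\<in>UNIV. scl (\<Delta> h (a,l) * c l b d) (F a b d))"
    by (rule sum.swap)
  also have "\<dots> = (\<Sum>a\<in>UNIV. \<Sum>b\<in>UNIV. \<Sum>d\<in>UNIV. \<Sum>l\<in>UNIV. scl (\<Delta> h (a,l) * c l b d) (F a b d))"
    by (rule sum.cong[OF refl], rule sum.swap)
  also have "\<dots> = (\<Sum>a\<in>UNIV. \<Sum>b\<in>UNIV. \<Sum>l\<in>UNIV. \<Sum>d\<in>UNIV. scl (\<Delta> h (a,l) * c l b d) (F a b d))"
    by (rule sum.cong[OF refl], rule sum.cong[OF refl], rule sum.swap)
  also have "\<dots> = (\<Sum>a\<in>UNIV. \<Sum>l\<in>UNIV. \<Sum>b\<in>UNIV. \<Sum>d\<in>UNIV. scl (\<Delta> h (a,l) * c l b d) (F a b d))"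
    by (rule sum.cong[OF refl], rule sum.swap)
  also have "\<dots> = ?r" by (simp add: sum_UNIV_prod)
  finally show ?thesis .
qed

text \<open>In Sweedler notation: \<open>(h f) g = h\<^sub>1 (f (S(h\<^sub>2) g))\<close>.\<close>

lemma L_star_antipode:
  "L h f \<star> g = (\<Sum>p\<in>UNIV. scl (\<Delta> h p) (L (bvec (fst p)) (f \<star> L (S (bvec (snd p))) g)))"
proof -
  have "(\<Sum>p\<in>UNIV. scl (\<Delta> h p) (L (bvec (fst p)) (f \<star> L (S (bvec (snd p))) g)))
    = (\<Sum>p\<in>UNIV. \<Sum>q\<in>UNIV. scl (\<Delta> h p * c (fst p) (fst q) (snd q))
        (L (bvec (fst q)) f \<star> L (bvec (snd q) \<odot> S (bvec (snd p))) g))"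
    by (simp add: L_star L_L fv.scale_sum_right hcomul_bvec)
  also have "\<dots> = (\<Sum>p\<in>UNIV. \<Sum>q\<in>UNIV. scl (\<Delta> h p * c (snd p) (fst q) (snd q))
        (L (bvec (fst p)) f \<star> L (bvec (fst q) \<odot> S (bvec (snd q))) g))"
    by (rule coassoc_sum)
  also have "\<dots> = (\<Sum>p\<in>UNIV. scl (\<Delta> h p) (L (bvec (fst p)) f \<star>
      L (\<Sum>q\<in>UNIV. scl (\<Delta> (bvec (snd p)) q) (bvec (fst q) \<odot> S (bvec (snd q)))) g))"
    by (simp add: L_linear star_linear fv.scale_sum_right hcomul_bvec)
  also have "\<dots> = (\<Sum>p\<in>UNIV. scl (\<Delta> h p * e (snd p)) (L (bvec (fst p)) f \<star> g))"
    by (simp add: antipode_right L_linear L_one star_linear)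
  also have "\<dots> = (\<Sum>i\<in>UNIV. scl (\<Sum>l\<in>UNIV. \<Delta> h (i,l) * e l) (L (bvec i) f)) \<star> g"
    by (simp add: sum_UNIV_prod star_linear fv.scale_sum_left)
  also have "\<dots> = L (\<Sum>i\<in>UNIV. scl (h i) (bvec i)) f \<star> g"
    by (simp add: counit_right L_linear)
  finally show ?thesis by (simp only: bvec_expand[symmetric])
qed

subsection \<open>Sub-bialgebras of the dual, and derivations\<close>

text \<open>Stability under both translations says that the transposed multiplication, the
  comultiplication of the dual, maps \<open>Q\<close> into the tensor square of
  \<open>Q\<close>.\<close>

definition subbialg :: "('n \<Rightarrow> 'k) set \<Rightarrow> bool" where
  "subbialg Q \<longleftrightarrow> fv.subspace Q \<and> e \<in> Q \<and> (\<forall>f\<in>Q. \<forall>g\<in>Q. f \<star> g \<in> Q) \<and> (\<forall>h. \<forall>f\<in>Q. L h f \<in> Q \<and> R h f \<in> Q)"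

lemma
  assumes "subbialg Q"
  shows subbialg_subspace: "fv.subspace Q" and subbialg_e: "e \<in> Q"
    and subbialg_star: "f \<in> Q \<Longrightarrow> g \<in> Q \<Longrightarrow> f \<star> g \<in> Q"
    and subbialg_L: "f \<in> Q \<Longrightarrow> L h f \<in> Q" and subbialg_R: "f \<in> Q \<Longrightarrow> R h f \<in> Q"
  using assms by (auto simp: subbialg_def)

lemma subbialg_UNIV: "subbialg UNIV"
  by (auto simp: subbialg_def)

lemma subbialg_pw: "subbialg Q \<Longrightarrow> f \<in> Q \<Longrightarrow> pw f n \<in> Q"
  by (induction n) (auto intro: subbialg_e subbialg_star)

definition aug :: "('n \<Rightarrow> 'k) set \<Rightarrow> ('n \<Rightarrow> 'k) set" where
  "aug Q = {f \<in> Q. pair u f = 0}"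

text \<open>The tangent vectors of \<open>Q\<close> at the identity \<open>u\<close>, represented by
  elements of \<open>H\<close> that are not identified when they agree on \<open>Q\<close>. For
  \<open>Q = UNIV\<close> these are the primitive elements of \<open>H\<close>.\<close>

definition prim :: "('n \<Rightarrow> 'k) set \<Rightarrow> ('n \<Rightarrow> 'k) set" where
  "prim Q = {h. pair h e = 0 \<and> (\<forall>f\<in>aug Q. \<forall>g\<in>aug Q. pair h (f \<star> g) = 0)}"

lemma subspace_aug: "subbialg Q \<Longrightarrow> fv.subspace (aug Q)"
  by (auto simp: aug_def fv.subspace_def subbialg_def pair_linear)

lemma aug_part: "subbialg Q \<Longrightarrow> f \<in> Q \<Longrightarrow> f - scl (pair u f) e \<in> aug Q"
  by (auto simp: aug_def pair_linear counit_one subbialg_def intro!: fv.subspace_diff fv.subspace_scale)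

lemma prim_pair_star:
  assumes Q: "subbialg Q" and h: "h \<in> prim Q" and f: "f \<in> Q" and g: "g \<in> Q"
  shows "pair h (f \<star> g) = pair u f * pair h g + pair h f * pair u g"
proof -
  have "pair h ((f - scl (pair u f) e) \<star> (g - scl (pair u g) e)) = 0"
    using h aug_part[OF Q f] aug_part[OF Q g] by (auto simp: prim_def)
  moreover have "pair h e = 0" using h by (simp add: prim_def)
  ultimately show ?thesis
    by (simp add: star_linear pair_linear star_one_left star_one_right algebra_simps)
qed

definition deriv_on :: "('n \<Rightarrow> 'k) set \<Rightarrow> (('n \<Rightarrow> 'k) \<Rightarrow> ('n \<Rightarrow> 'k)) \<Rightarrow> bool" where
  "deriv_on Q D \<longleftrightarrow> flinear D \<and> (\<forall>f\<in>Q. D f \<in> Q) \<and> (\<forall>f\<in>Q. \<forall>g\<in>Q. D (f \<star> g) = D f \<star> g + f \<star> D g)"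

text \<open>The value of \<open>R h (f \<star> g)\<close> at \<open>x\<close> is that of
  \<open>h\<close> on the translate \<open>L x (f \<star> g)\<close>. Expanding this translate by
  \<open>L_star\<close> and applying the Leibniz rule of \<open>h\<close> at the identity gives the
  Leibniz rule everywhere: \<open>R h\<close> is the invariant derivation attached to the tangent
  vector \<open>h\<close>.\<close>

lemma deriv_on_R:
  assumes Q: "subbialg Q" and h: "h \<in> prim Q"
  shows "deriv_on Q (R h)"
  unfolding deriv_on_def
proof (intro conjI ballI)
  show "flinear (R h)" by (rule flinear_R)
  show "R h f \<in> Q" if "f \<in> Q" for f by (rule subbialg_R[OF Q that])
  show "R h (f \<star> g) = R h f \<star> g + f \<star> R h g" if f: "f \<in> Q" and g: "g \<in> Q" for f g
  proof (rule pair_eqI)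
    fix x
    have a: "pair h (L (bvec i) f \<star> L (bvec j) g) = f i * R h g j + R h f i * g j" for i j
      by (simp add: prim_pair_star[OF Q h subbialg_L[OF Q f] subbialg_L[OF Q g]] counit_L
          pair_L[of h] R_def)
    have "pair x (R h (f \<star> g)) = pair h (L x (f \<star> g))" by (simp add: pair_L pair_R)
    also have "\<dots> = pair x (R h f \<star> g + f \<star> R h g)"
      by (simp add: L_star pair_linear a pair_star[of x] sum.distrib[symmetric] algebra_simps)
    finally show "pair x (R h (f \<star> g)) = pair x (R h f \<star> g + f \<star> R h g)" .
  qed
qed

lemma
  assumes "deriv_on Q D"
  shows deriv_on_linear: "flinear D" and deriv_on_in: "f \<in> Q \<Longrightarrow> D f \<in> Q"
    and deriv_on_star: "f \<in> Q \<Longrightarrow> g \<in> Q \<Longrightarrow> D (f \<star> g) = D f \<star> g + f \<star> D g"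
  using assms by (auto simp: deriv_on_def)

lemma deriv_on_e:
  assumes Q: "subbialg Q" and D: "deriv_on Q D"
  shows "D e = 0"
  using deriv_on_star[OF D subbialg_e[OF Q] subbialg_e[OF Q]] by (simp add: star_one_left star_one_right)

lemma deriv_on_pw:
  assumes Q: "subbialg Q" and D: "deriv_on Q D" and f: "f \<in> Q"
  shows "D (pw f n) = scl (of_nat n) (pw f (n - 1) \<star> D f)"
proof (induction n)
  case 0
  then show ?case by (simp add: deriv_on_e[OF Q D])
next
  case (Suc n)
  have "D (pw f (Suc n)) = D f \<star> pw f n + f \<star> D (pw f n)"
    by (simp add: deriv_on_star[OF D f subbialg_pw[OF Q f]])
  also have "f \<star> D (pw f n) = scl (of_nat n) (pw f n \<star> D f)"
    by (subst Suc.IH, cases n) (simp_all add: star_linear star_assoc)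
  finally show ?case by (simp add: star_commute fv.scale_left_distrib)
qed

primrec ipow :: "('n \<Rightarrow> 'k) set \<Rightarrow> nat \<Rightarrow> ('n \<Rightarrow> 'k) set" where
  "ipow Q 0 = Q"
| "ipow Q (Suc n) = fv.span {a \<star> b | a b. a \<in> aug Q \<and> b \<in> ipow Q n}"

lemma subspace_ipow: "subbialg Q \<Longrightarrow> fv.subspace (ipow Q n)"
  by (cases n) (auto intro: subbialg_subspace)

lemma aug_sub: "aug Q \<subseteq> Q" by (auto simp: aug_def)

lemma ipow_star_Q:
  assumes Q: "subbialg Q" and q: "q \<in> Q"
  shows "b \<in> ipow Q n \<Longrightarrow> q \<star> b \<in> ipow Q n"
proof (cases n)
  case 0
  then show "b \<in> ipow Q n \<Longrightarrow> ?thesis" using subbialg_star[OF Q q] by simp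
next
  case (Suc k)
  have "q \<star> b \<in> ipow Q (Suc k)" if "b \<in> ipow Q (Suc k)" for b
  proof -
    from that have "b \<in> fv.span {a \<star> b | a b. a \<in> aug Q \<and> b \<in> ipow Q k}" by simp
    then show ?thesis
    proof (induction rule: fv.span_induct_alt)
      case base
      then show ?case by (simp add: fv.span_zero)
    next
      case (step t x y)
      then obtain a b where ab: "x = a \<star> b" "a \<in> aug Q" "b \<in> ipow Q k" by blast
      have "q \<star> a \<in> aug Q"
        using ab(2) q subbialg_star[OF Q] by (auto simp: aug_def counit_star)
      then have "(q \<star> a) \<star> b \<in> ipow Q (Suc k)" using ab(3) by (auto intro!: fv.span_base)
      then have "scl t ((q \<star> a) \<star> b) + q \<star> y \<in> ipow Q (Suc k)"
        using step(2) subspace_ipow[OF Q, of "Suc k"] by (intro fv.subspace_add fv.subspace_scale)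
      then show ?case by (simp add: ab star_linear star_assoc)
    qed
  qed
  then show "b \<in> ipow Q n \<Longrightarrow> ?thesis" using Suc by simp
qed

lemma ipow_Suc_sub: assumes Q: "subbialg Q" shows "ipow Q (Suc n) \<subseteq> ipow Q n"
  unfolding ipow.simps
  using ipow_star_Q[OF Q subsetD[OF aug_sub]] by (intro fv.span_minimal[OF _ subspace_ipow[OF Q]]) auto

lemma ipow_antimono: assumes Q: "subbialg Q" and "k \<le> n" shows "ipow Q n \<subseteq> ipow Q k"
  using assms(2) by (induction n rule: dec_induct) (use ipow_Suc_sub[OF Q] in blast)+

lemma ipow_sub: "subbialg Q \<Longrightarrow> ipow Q n \<subseteq> Q"
  using ipow_antimono[of Q 0 n] by simp

lemma aug_ipow: "a \<in> aug Q \<Longrightarrow> e \<in> Q \<Longrightarrow> a \<in> ipow Q (Suc 0)"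
  using fv.span_base[of "a \<star> e" "{a \<star> b | a b. a \<in> aug Q \<and> b \<in> Q}"] by (simp add: star_one_right) (metis star_one_right)

lemma ipow_1_aug: assumes Q: "subbialg Q" shows "ipow Q (Suc 0) \<subseteq> aug Q"
  unfolding ipow.simps
  using aug_sub subbialg_star[OF Q]
  by (intro fv.span_minimal subspace_aug[OF Q]) (auto simp: aug_def counit_star)

lemma ipow_star:
  assumes Q: "subbialg Q"
  shows "a \<in> ipow Q k \<Longrightarrow> b \<in> ipow Q l \<Longrightarrow> a \<star> b \<in> ipow Q (k + l)"
proof (induction k arbitrary: a)
  case 0
  then show ?case using ipow_star_Q[OF Q] by simp
next
  case (Suc k)
  from Suc.prems(1) have "a \<in> fv.span {a \<star> b | a b. a \<in> aug Q \<and> b \<in> ipow Q k}" by simp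
  then show ?case
  proof (induction rule: fv.span_induct_alt)
    case base
    then show ?case by (simp add: fv.span_zero)
  next
    case (step t x y)
    then obtain a' b' where ab: "x = a' \<star> b'" "a' \<in> aug Q" "b' \<in> ipow Q k" by blast
    have "a' \<star> (b' \<star> b) \<in> ipow Q (Suc k + l)"
      using ab(2) Suc.IH[OF ab(3) Suc.prems(2)] by (auto intro!: fv.span_base)
    then have "scl t (a' \<star> (b' \<star> b)) + y \<star> b \<in> ipow Q (Suc k + l)"
      using step(2) subspace_ipow[OF Q, of "Suc k + l"] by (intro fv.subspace_add fv.subspace_scale)
    then show ?case by (simp add: ab star_linear star_assoc)
  qed
qed

text \<open>Choose \<open>e0\<close> of counit 1 such that the ideal \<open>T\<close> generated by
  \<open>e0\<close> in \<open>Q\<close> has least dimension. For \<open>z\<close> in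
  \<open>aug Q\<close> the element \<open>(e - z) \<star> e0\<close> also has counit 1, so by
  minimality \<open>e - z\<close> maps \<open>T\<close> onto itself and is injective there; thus
  \<open>z\<close> fixes no nonzero vector of \<open>T\<close>. By the Engel-type lemma
  \<open>aug Q\<close> acts nilpotently on \<open>T\<close>, and some power of it kills
  \<open>e0\<close>. This \<open>e0\<close> serves to localise at the identity.\<close>

lemma local_unit_exists:
  assumes Q: "subbialg Q"
  obtains e0 N where "e0 \<in> Q" "pair u e0 = 1" "\<And>b. b \<in> ipow Q N \<Longrightarrow> b \<star> e0 = 0"
proof -
  note sub = subbialg_subspace[OF Q]
  define P where "P V \<longleftrightarrow> (\<exists>e0\<in>Q. pair u e0 = 1 \<and> V = star c e0 ` Q)" for V
  have "P (star c e ` Q)" using subbialg_e[OF Q] counit_one by (auto simp: P_def)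
  then obtain T where T: "P T"
    and Tmin: "\<And>U'. P U' \<Longrightarrow> fv.subspace T \<Longrightarrow> fv.subspace U' \<Longrightarrow> U' \<subseteq> T \<Longrightarrow> U' = T"
    using finite_dim_min[of P] by metis
  from T obtain e0 where e0: "e0 \<in> Q" "pair u e0 = 1" "T = star c e0 ` Q" by (auto simp: P_def)
  have Tsub: "fv.subspace T" unfolding e0(3) by (rule subspace_flinear_image[OF flinear_star_left sub])
  have stabQ: "z \<star> t \<in> T" if z: "z \<in> Q" and t: "t \<in> T" for z t
  proof -
    obtain q where q: "q \<in> Q" "t = e0 \<star> q" using t e0(3) by auto
    have "z \<star> t = e0 \<star> (z \<star> q)" by (simp add: q star_left_commute)
    then show ?thesis using subbialg_star[OF Q z q(1)] e0(3) by auto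
  qed
  have nofix: "t = 0" if z: "z \<in> aug Q" and t: "t \<in> T" and fp: "z \<star> t = t" for z t
  proof -
    have ez: "e - z \<in> Q" using z aug_sub subbialg_e[OF Q] fv.subspace_diff[OF sub] by blast
    have img: "star c ((e - z) \<star> e0) ` Q = star c (e - z) ` T"
      by (auto simp: e0(3) star_assoc)
    have "P (star c ((e - z) \<star> e0) ` Q)"
      unfolding P_def using z e0 subbialg_star[OF Q ez e0(1)]
      by (intro bexI[of _ "(e - z) \<star> e0"]) (auto simp: counit_star pair_linear counit_one aug_def)
    then have "star c (e - z) ` T = T"
      unfolding img using stabQ[OF ez] by (intro Tmin Tsub subspace_flinear_image[OF flinear_star_left]) auto
    moreover have "(e - z) \<star> t = 0" by (simp add: star_linear star_one_left fp)
    ultimately show ?thesis by (intro flinear_surj_on_inj[OF flinear_star_left Tsub _ t])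
  qed
  let ?\<Phi> = "star c ` aug Q"
  have "\<exists>d. socle_chain ?\<Phi> T d = T"
  proof (rule socle_chain_exhausts[OF Tsub])
    show "?\<Phi> \<noteq> {}" using fv.subspace_0[OF subspace_aug[OF Q]] by auto
    show "flinear \<phi>" if "\<phi> \<in> ?\<Phi>" for \<phi> using that flinear_star_left by auto
    show "\<phi> t \<in> T" if "\<phi> \<in> ?\<Phi>" "t \<in> T" for \<phi> t using that stabQ aug_sub by auto
    show "t = 0" if "\<phi> \<in> ?\<Phi>" "t \<in> T" "\<phi> t = t" for \<phi> t using that nofix by auto
    fix \<phi> \<psi> assume "\<phi> \<in> ?\<Phi>" "\<psi> \<in> ?\<Phi>"
    then obtain y z where yz: "\<phi> = star c y" "\<psi> = star c z" "y \<in> aug Q" "z \<in> aug Q" by auto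
    have "(\<lambda>t. \<phi> t + \<psi> t) = star c (y + z)" by (auto simp: yz star_linear)
    then show "(\<lambda>t. \<phi> t + \<psi> t) \<in> ?\<Phi>" using yz fv.subspace_add[OF subspace_aug[OF Q]] by auto
    have "(\<lambda>t. \<phi> (\<psi> t)) = star c (y \<star> z)" by (auto simp: yz star_assoc)
    moreover have "y \<star> z \<in> aug Q" using yz subbialg_star[OF Q] by (auto simp: aug_def counit_star)
    ultimately show "(\<lambda>t. \<phi> (\<psi> t)) \<in> ?\<Phi>" by auto
  next
    fix \<phi> a assume "\<phi> \<in> ?\<Phi>"
    then obtain y where y: "\<phi> = star c y" "y \<in> aug Q" by auto
    have "(\<lambda>t. scl a (\<phi> t)) = star c (scl a y)" by (auto simp: y star_linear)
    then show "(\<lambda>t. scl a (\<phi> t)) \<in> ?\<Phi>" using y fv.subspace_scale[OF subspace_aug[OF Q]] by auto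
  qed
  then obtain d where d: "socle_chain ?\<Phi> T d = T" ..
  have "b \<star> t = 0" if "b \<in> ipow Q i" "t \<in> socle_chain ?\<Phi> T i" for b t i
    using that
  proof (induction i arbitrary: b t)
    case (Suc i)
    from Suc.prems(1) have "b \<in> fv.span {a \<star> b | a b. a \<in> aug Q \<and> b \<in> ipow Q i}" by simp
    then show ?case
    proof (induction rule: fv.span_induct_alt)
      case (step s x y)
      then obtain a b where ab: "x = a \<star> b" "a \<in> aug Q" "b \<in> ipow Q i" by blast
      have "b \<star> (a \<star> t) = 0" using Suc.IH[OF ab(3)] Suc.prems(2) ab(2) by simp
      then show ?case using step(2) by (simp add: ab star_linear star_ac)
    qed simp
  qed simp
  moreover have "e0 \<in> T" using e0 subbialg_e[OF Q] star_one_right by (metis image_eqI)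
  ultimately show thesis using that[OF e0(1,2), of d] d by metis
qed

section \<open>Tangent vectors at the identity and dual systems of derivations\<close>

definition invs :: "('n \<Rightarrow> 'k) set \<Rightarrow> ('n \<Rightarrow> 'k) set" where
  "invs Q = {f \<in> Q. \<forall>h\<in>prim Q. R h f = 0}"

text \<open>\<open>J\<close> lifts a basis of the cotangent space \<open>aug Q\<close> modulo
  \<open>ipow Q 2\<close>. The dual coordinates kill products of two elements of
  \<open>aug Q\<close>, which makes them tangent vectors.\<close>

lemma tangent_basis:
  assumes Q: "subbialg Q"
  obtains J y where "finite J" "J \<subseteq> aug Q" "\<forall>b\<in>J. y b \<in> prim Q"
    "\<forall>b\<in>J. \<forall>b'\<in>J. pair (y b) b' = (if b = b' then 1 else 0)"
    "\<forall>g\<in>aug Q. g - (\<Sum>b\<in>J. scl (pair (y b) g) b) \<in> ipow Q 2"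
proof -
  have K: "ipow Q 2 \<subseteq> aug Q"
    using ipow_antimono[OF Q, of "Suc 0" 2] ipow_1_aug[OF Q] by simp
  note subK = subspace_ipow[OF Q, of 2]
  obtain J0 J z where J: "finite J0" "finite J" "J0 \<inter> J = {}" "J0 \<subseteq> ipow Q 2" "J \<subseteq> aug Q"
    "\<forall>g\<in>aug Q. g = (\<Sum>b\<in>J0 \<union> J. scl (pair (z b) g) b)"
    "\<forall>b\<in>J. \<forall>g\<in>ipow Q 2. pair (z b) g = 0"
    "\<forall>b\<in>J0 \<union> J. \<forall>b'\<in>J0 \<union> J. pair (z b) b' = (if b = b' then 1 else 0)"
    by (rule adapted_dual_basis[OF subK subspace_aug[OF Q] K])
  \<comment> \<open>The multiple of \<open>u\<close> is chosen so that \<open>y b\<close> kills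
    \<open>e\<close>; on \<open>aug Q\<close> nothing changes, because \<open>u\<close> vanishes
    there.\<close>
  define y where "y b = z b - scl (pair (z b) e) u" for b
  have ya: "pair (y b) g = pair (z b) g" if "g \<in> aug Q" for b g
    using that by (simp add: y_def pair_linear aug_def)
  have sq: "f \<star> g \<in> ipow Q 2" if "f \<in> aug Q" "g \<in> aug Q" for f g
    using ipow_star[OF Q aug_ipow[OF that(1) subbialg_e[OF Q]] aug_ipow[OF that(2) subbialg_e[OF Q]]]
    by (simp only: numeral_2_eq_2) simp
  show thesis
  proof (rule that[of J y])
    show "finite J" "J \<subseteq> aug Q" by (fact J)+
    show "\<forall>b\<in>J. y b \<in> prim Q"
    proof
      fix b assume b: "b \<in> J"
      have "pair (y b) (f \<star> g) = 0" if "f \<in> aug Q" "g \<in> aug Q" for f g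
        using ya[of "f \<star> g" b] J(7) b K sq[OF that] by auto
      moreover have "pair (y b) e = 0" by (simp add: y_def pair_linear counit_one)
      ultimately show "y b \<in> prim Q" by (simp add: prim_def)
    qed
    show "\<forall>b\<in>J. \<forall>b'\<in>J. pair (y b) b' = (if b = b' then 1 else 0)"
      using J(5,8) ya by (metis UnCI subsetD)
    show "\<forall>g\<in>aug Q. g - (\<Sum>b\<in>J. scl (pair (y b) g) b) \<in> ipow Q 2"
    proof
      fix g assume g: "g \<in> aug Q"
      have "g = (\<Sum>b\<in>J0. scl (pair (z b) g) b) + (\<Sum>b\<in>J. scl (pair (z b) g) b)"
        using bspec[OF J(6) g] by (simp add: sum.union_disjoint[OF J(1-3)])
      then have "g - (\<Sum>b\<in>J. scl (pair (y b) g) b) = (\<Sum>b\<in>J0. scl (pair (z b) g) b)"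
        unfolding ya[OF g] diff_eq_eq .
      also have "\<dots> \<in> ipow Q 2" using J(4) by (intro fv.subspace_sum[OF subK] fv.subspace_scale[OF subK]) auto
      finally show "g - (\<Sum>b\<in>J. scl (pair (y b) g) b) \<in> ipow Q 2" .
    qed
  qed
qed

text \<open>Newton iteration: if \<open>E\<close> is the matrix of errors, then \<open>D - E D\<close> has error \<open>- E\<^sup>2\<close>.\<close>

lemma dual_derivations:
  assumes Q: "subbialg Q" and fin: "finite J" and J: "J \<subseteq> aug Q" and y: "\<forall>b\<in>J. y b \<in> prim Q"
    and dual: "\<forall>b\<in>J. \<forall>b'\<in>J. pair (y b) b' = (if b = b' then 1 else 0)"
  shows "\<exists>D. \<forall>b\<in>J. deriv_on Q (D b) \<and> (\<forall>f\<in>invs Q. D b f = 0) \<and>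
    (\<forall>b'\<in>J. D b b' - (if b = b' then e else 0) \<in> ipow Q (Suc k))"
proof (induction k)
  case 0
  show ?case
  proof (intro exI[of _ "\<lambda>b. R (y b)"] ballI conjI)
    fix b assume b: "b \<in> J"
    then have yb: "y b \<in> prim Q" using y by auto
    show "deriv_on Q (R (y b))" by (rule deriv_on_R[OF Q yb])
    show "R (y b) f = 0" if "f \<in> invs Q" for f using that yb by (simp add: invs_def)
    fix b' assume b': "b' \<in> J"
    let ?d = "if b = b' then e else 0"
    have "?d \<in> Q" using subbialg_e[OF Q] fv.subspace_0[OF subbialg_subspace[OF Q]] by simp
    then have "R (y b) b' - ?d \<in> Q"
      using b' J aug_sub by (intro fv.subspace_diff[OF subbialg_subspace[OF Q]] subbialg_R[OF Q]) auto
    \<comment> \<open>At the identity an invariant derivation takes the value of its tangent vector,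
      so the error has counit 0.\<close>
    moreover have "pair u (R (y b) b' - ?d) = 0"
      using dual b b' by (auto simp: pair_linear counit_R counit_one)
    ultimately have "R (y b) b' - ?d \<in> aug Q" by (simp add: aug_def)
    then show "R (y b) b' - ?d \<in> ipow Q (Suc 0)" by (rule aug_ipow[OF _ subbialg_e[OF Q]])
  qed
next
  case (Suc k)
  then obtain D where D: "\<forall>b\<in>J. deriv_on Q (D b)" "\<forall>b\<in>J. \<forall>f\<in>invs Q. D b f = 0"
    "\<forall>b\<in>J. \<forall>b'\<in>J. D b b' - (if b = b' then e else 0) \<in> ipow Q (Suc k)"
    by blast
  define E where "E b b' = D b b' - (if b = b' then e else 0)" for b b'
  have E: "E b b' \<in> ipow Q (Suc k)" if "b \<in> J" "b' \<in> J" for b b'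
    using D(3) that by (simp add: E_def)
  define D' where "D' b f = D b f - (\<Sum>l\<in>J. E b l \<star> D l f)" for b f
  have lin: "D l (x + x') = D l x + D l x'" "D l (scl a x) = scl a (D l x)" if "l \<in> J" for l x x' a
    using D(1) that flinear_add[OF deriv_on_linear] flinear_scl[OF deriv_on_linear] by auto
  show ?case
  proof (intro exI[of _ D'] ballI conjI)
    fix b assume b: "b \<in> J"
    show "D' b f = 0" if "f \<in> invs Q" for f
      using D(2) that b by (simp add: D'_def)
    show "deriv_on Q (D' b)"
      unfolding deriv_on_def
    proof (intro conjI ballI)
      show "flinear (D' b)"
        by (rule flinearI)
          (auto simp: D'_def lin b star_linear sum.distrib fv.scale_right_diff_distrib fv.scale_sum_right cong: sum.cong)
      have EQ: "E b l \<in> Q" if "l \<in> J" for l using E[OF b that] ipow_sub[OF Q] by blast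
      show "D' b f \<in> Q" if f: "f \<in> Q" for f
        unfolding D'_def using D(1) b f EQ
        by (intro fv.subspace_diff fv.subspace_sum subbialg_subspace[OF Q] subbialg_star[OF Q])
          (auto intro: deriv_on_in)
      fix f g assume f: "f \<in> Q" and g: "g \<in> Q"
      have "D l (f \<star> g) = D l f \<star> g + f \<star> D l g" if "l \<in> J" for l
        using D(1) that deriv_on_star f g by auto
      then show "D' b (f \<star> g) = D' b f \<star> g + f \<star> D' b g"
        using b by (simp add: D'_def star_linear sum.distrib star_assoc star_left_commute[of f] cong: sum.cong)
    qed
    fix b' assume b': "b' \<in> J"
    have Dl: "D l b' = E l b' + (if l = b' then e else 0)" for l by (simp add: E_def)
    have "(\<Sum>l\<in>J. E b l \<star> D l b') = (\<Sum>l\<in>J. E b l \<star> E l b') + (\<Sum>l\<in>J. if l = b' then E b b' else 0)"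
      unfolding sum.distrib[symmetric] by (rule sum.cong) (auto simp: Dl star_linear star_one_right)
    also have "(\<Sum>l\<in>J. if l = b' then E b b' else 0) = E b b'" using fin b' by simp
    finally have "D' b b' - (if b = b' then e else 0) = - (\<Sum>l\<in>J. E b l \<star> E l b')"
      unfolding D'_def by (simp add: Dl[of b])
    also have "\<dots> \<in> ipow Q (Suc k + Suc k)"
      using b b' E by (intro fv.subspace_neg fv.subspace_sum subspace_ipow[OF Q] ipow_star[OF Q])
    \<comment> \<open>The error is squared, and \<open>2 * (k + 1)\<close> is at least
      \<open>k + 2\<close>.\<close>
    also have "\<dots> \<subseteq> ipow Q (Suc (Suc k))" by (rule ipow_antimono[OF Q]) simp
    finally show "D' b b' - (if b = b' then e else 0) \<in> ipow Q (Suc (Suc k))" .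
  qed
qed

section \<open>Adjoining local coordinates to a base ring\<close>

inductive_set adj :: "('n \<Rightarrow> 'k) set \<Rightarrow> ('n \<Rightarrow> 'k) set \<Rightarrow> ('n \<Rightarrow> 'k) set" for B J where
  base: "q \<in> B \<Longrightarrow> q \<in> adj B J"
| add: "a \<in> adj B J \<Longrightarrow> b \<in> adj B J \<Longrightarrow> a + b \<in> adj B J"
| mult: "x \<in> J \<Longrightarrow> a \<in> adj B J \<Longrightarrow> x \<star> a \<in> adj B J"

lemma adj_star_base:
  assumes "\<And>f g. f \<in> B \<Longrightarrow> g \<in> B \<Longrightarrow> f \<star> g \<in> B" and q: "q \<in> B"
  shows "a \<in> adj B J \<Longrightarrow> q \<star> a \<in> adj B J"
  by (induction rule: adj.induct) (auto intro: adj.intros assms simp: star_linear star_left_commute[of q])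

lemma adj_scl:
  assumes "\<And>f a. f \<in> B \<Longrightarrow> scl a f \<in> B"
  shows "a \<in> adj B J \<Longrightarrow> scl t a \<in> adj B J"
  by (induction rule: adj.induct)
    (auto intro: adj.intros assms simp: fv.scale_right_distrib star_scl_right[symmetric])

lemma adj_sum: "0 \<in> B \<Longrightarrow> (\<And>i. i \<in> A \<Longrightarrow> f i \<in> adj B J) \<Longrightarrow> (\<Sum>i\<in>A. f i) \<in> adj B J"
  by (induction A rule: infinite_finite_induct) (auto intro: adj.intros)

lemma adj_sub:
  assumes Q: "subbialg Q" and "B \<subseteq> Q" "J \<subseteq> Q"
  shows "a \<in> adj B J \<Longrightarrow> a \<in> Q"
  by (induction rule: adj.induct)
    (use assms in \<open>auto intro: subbialg_star[OF Q] fv.subspace_add[OF subbialg_subspace[OF Q]]\<close>)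

text \<open>Since \<open>x\<^sup>p\<close> is already in the base ring, adjoining \<open>x\<close> needs powers below \<open>p\<close> only.\<close>

lemma adj_insert:
  assumes B0: "0 \<in> B" and Bm: "\<And>f g. f \<in> B \<Longrightarrow> g \<in> B \<Longrightarrow> f \<star> g \<in> B"
    and xp: "pw x p \<in> B" and p: "p > 0"
  shows "a \<in> adj B (insert x J) \<Longrightarrow> \<exists>k. (\<forall>l<p. k l \<in> adj B J) \<and> a = (\<Sum>l<p. k l \<star> pw x l)"
proof (induction rule: adj.induct)
  case (base q)
  have "(\<Sum>l<p. (if l = 0 then q else 0) \<star> pw x l) = (\<Sum>l<p. if l = 0 then q else 0)"
    by (rule sum.cong) (auto simp: star_one_right)
  also have "\<dots> = q" using p by simp
  finally have "q = (\<Sum>l<p. (if l = 0 then q else 0) \<star> pw x l)" by simp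
  then show ?case using base B0 by (intro exI[of _ "\<lambda>l. if l = 0 then q else 0"]) (auto intro: adj.base)
next
  case (add a b)
  then obtain k k' where "\<forall>l<p. k l \<in> adj B J" "a = (\<Sum>l<p. k l \<star> pw x l)"
    "\<forall>l<p. k' l \<in> adj B J" "b = (\<Sum>l<p. k' l \<star> pw x l)" by blast
  then show ?case
    by (intro exI[of _ "\<lambda>l. k l + k' l"]) (auto intro: adj.add simp: star_linear sum.distrib)
next
  case (mult z a)
  then obtain k where k: "\<forall>l<p. k l \<in> adj B J" "a = (\<Sum>l<p. k l \<star> pw x l)" by blast
  show ?case
  proof (cases "z \<in> J")
    case True
    then show ?thesis using k
      by (intro exI[of _ "\<lambda>l. z \<star> k l"]) (auto intro: adj.mult simp: star_linear star_assoc)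
  next
    case False
    then have z: "z = x" using mult by auto
    obtain r where r: "p = Suc r" using p by (cases p) auto
    \<comment> \<open>Multiplication by \<open>x\<close> shifts the coefficients up by one; the top
      one meets \<open>pw x p\<close>, which lies in \<open>B\<close>, and returns as the new
      constant coefficient.\<close>
    define k' where "k' l = (case l of 0 \<Rightarrow> pw x p \<star> k r | Suc i \<Rightarrow> k i)" for l
    have "k' l \<in> adj B J" if "l < p" for l
      using that k(1) r adj_star_base[OF Bm xp] by (auto simp: k'_def split: nat.splits)
    moreover have "z \<star> a = (\<Sum>l<p. k' l \<star> pw x l)"
    proof -
      have "z \<star> a = (\<Sum>l<p. k l \<star> pw x (Suc l))"
        by (simp add: z k(2) star_linear star_left_commute[of x])
      also have "\<dots> = (\<Sum>l<r. k l \<star> pw x (Suc l)) + k r \<star> pw x p"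
        by (simp add: r)
      also have "\<dots> = k' 0 \<star> pw x 0 + (\<Sum>l<r. k' (Suc l) \<star> pw x (Suc l))"
        by (simp add: k'_def star_one_left star_one_right star_commute add.commute)
      also have "\<dots> = (\<Sum>l<p. k' l \<star> pw x l)"
        unfolding r by (subst sum.lessThan_Suc_shift) simp
      finally show ?thesis .
    qed
    ultimately show ?thesis by blast
  qed
qed

text \<open>Successive approximation as in Nakayama's lemma: if \<open>J\<close> spans
  \<open>aug Q\<close> modulo its square, the ring generated by \<open>J\<close> over
  \<open>B\<close> fills \<open>Q\<close> modulo every power. A product \<open>a \<star> b\<close>
  with \<open>a\<close> approximated by \<open>a'\<close> modulo the square and \<open>b\<close> by
  \<open>b'\<close> modulo one power more is treated through \<open>a \<star> b - a' \<star> b' = (a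
  - a') \<star> b + a' \<star> (b - b')\<close>.\<close>

lemma adj_generates:
  assumes Q: "subbialg Q" and J: "J \<subseteq> aug Q" and B: "fv.subspace B" "e \<in> B" "B \<subseteq> Q"
    and Bm: "\<And>f g. f \<in> B \<Longrightarrow> g \<in> B \<Longrightarrow> f \<star> g \<in> B"
    and gen: "\<forall>g\<in>aug Q. g - (\<Sum>b\<in>J. scl (k b g) b) \<in> ipow Q 2"
  shows "q \<in> Q \<Longrightarrow> \<exists>a\<in>adj B J. q - a \<in> ipow Q n"
proof -
  note sc = fv.subspace_scale[OF B(1)]
  have step: "i \<in> ipow Q n \<Longrightarrow> \<exists>a\<in>adj B J. i - a \<in> ipow Q (Suc n)" for i n
  proof (induction n arbitrary: i)
    case 0
    then have "i - scl (pair u i) e \<in> aug Q" by (intro aug_part[OF Q]) simp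
    then have "i - scl (pair u i) e \<in> ipow Q (Suc 0)" by (rule aug_ipow[OF _ subbialg_e[OF Q]])
    then show ?case using sc[OF B(2)] adj.base by blast
  next
    case (Suc n)
    from Suc.prems have "i \<in> fv.span {a \<star> b | a b. a \<in> aug Q \<and> b \<in> ipow Q n}" by simp
    then show ?case
    proof (induction rule: fv.span_induct_alt)
      case base
      show ?case using adj.base[OF fv.subspace_0[OF B(1)]] fv.subspace_0[OF subspace_ipow[OF Q]]
        by (metis diff_zero)
    next
      case (step t x y)
      then obtain a b where ab: "x = a \<star> b" "a \<in> aug Q" "b \<in> ipow Q n" by blast
      obtain y' where y': "y' \<in> adj B J" "y - y' \<in> ipow Q (Suc (Suc n))" using step(2) by blast
      obtain b' where b': "b' \<in> adj B J" "b - b' \<in> ipow Q (Suc n)" using Suc.IH[OF ab(3)] by blast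
      define a' where "a' = (\<Sum>b\<in>J. scl (k b a) b)"
      have "a' \<star> b' = (\<Sum>b\<in>J. scl (k b a) (b \<star> b'))" by (simp add: a'_def star_linear)
      also have "\<dots> \<in> adj B J"
        by (intro adj_sum fv.subspace_0[OF B(1)] adj_scl[OF sc] adj.mult b')
      finally have m: "scl t (a' \<star> b') + y' \<in> adj B J"
        using y' by (intro adj.add adj_scl[OF sc])
      have a'aug: "a' \<in> aug Q"
        unfolding a'_def using J by (intro fv.subspace_sum fv.subspace_scale subspace_aug[OF Q]) auto
      have "(a - a') \<star> b \<in> ipow Q (2 + n)" using gen ab by (intro ipow_star[OF Q]) (auto simp: a'_def)
      moreover have "a' \<star> (b - b') \<in> ipow Q (Suc 0 + Suc n)"
        by (intro ipow_star[OF Q] aug_ipow[OF a'aug subbialg_e[OF Q]] b')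
      ultimately have "(a - a') \<star> b + a' \<star> (b - b') \<in> ipow Q (Suc (Suc n))"
        by (intro fv.subspace_add[OF subspace_ipow[OF Q]]) simp_all
      then have "scl t ((a - a') \<star> b + a' \<star> (b - b')) + (y - y') \<in> ipow Q (Suc (Suc n))"
        by (intro fv.subspace_add[OF subspace_ipow[OF Q] fv.subspace_scale[OF subspace_ipow[OF Q]] y'(2)])
      also have "scl t ((a - a') \<star> b + a' \<star> (b - b')) + (y - y') = (scl t x + y) - (scl t (a' \<star> b') + y')"
        by (simp add: ab star_linear algebra_simps fv.scale_right_diff_distrib)
      finally show ?case using m by blast
    qed
  qed
  show "q \<in> Q \<Longrightarrow> \<exists>a\<in>adj B J. q - a \<in> ipow Q n"
  proof (induction n)
    case 0
    then show ?case using adj.base[OF fv.subspace_0[OF B(1)]] by (metis diff_zero ipow.simps(1))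
  next
    case (Suc n)
    then obtain a where a: "a \<in> adj B J" "q - a \<in> ipow Q n" by blast
    from step[OF a(2)] obtain a' where a': "a' \<in> adj B J" "q - a - a' \<in> ipow Q (Suc n)" by blast
    then show ?case using adj.add[OF a(1) a'(1)] by (metis diff_diff_eq)
  qed
qed

section \<open>The comultiplication of the dual algebra\<close>

definition cotensor :: "('n \<Rightarrow> 'k) \<Rightarrow> 'n \<times> 'n \<Rightarrow> 'k" where
  "cotensor f = (\<lambda>(i,j). pair (bvec i \<odot> bvec j) f)"

text \<open>The bialgebra axiom of \<open>H\<close> in transposed form: the comultiplication of the
  dual is an algebra map into the tensor square.\<close>

lemma cotensor_star: "cotensor (f \<star> g) = star (tsc c) (cotensor f) (cotensor g)"
proof
  fix z :: "'n \<times> 'n"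
  have "cotensor (f \<star> g) z = (\<Sum>p\<in>UNIV. \<Sum>p'\<in>UNIV. \<Sum>q\<in>UNIV. \<Sum>q'\<in>UNIV. c (fst z) p p' * c (snd z) q q' *
      (pair (bvec p \<odot> bvec q) f * pair (bvec p' \<odot> bvec q') g))"
    by (simp add: cotensor_def case_prod_unfold pair_mult_star hcomul_bvec sum_UNIV_prod)
  also have "\<dots> = (\<Sum>p\<in>UNIV. \<Sum>q\<in>UNIV. \<Sum>p'\<in>UNIV. \<Sum>q'\<in>UNIV. c (fst z) p p' * c (snd z) q q' *
      (pair (bvec p \<odot> bvec q) f * pair (bvec p' \<odot> bvec q') g))"
    by (rule sum.cong[OF refl], rule sum.swap)
  also have "\<dots> = star (tsc c) (cotensor f) (cotensor g) z"
    by (simp add: star_def tsc_def cotensor_def sum_UNIV_prod mult.assoc)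
  finally show "cotensor (f \<star> g) z = star (tsc c) (cotensor f) (cotensor g) z" .
qed

lemma cotensor_e: "cotensor e = tensor e e"
  by (simp add: cotensor_def tensor_def counit_mult fun_eq_iff)

lemma cotensor_pw: "cotensor (pw g n) = spow (tsc c) (tensor e e) (cotensor g) n"
  by (induction n) (simp_all add: cotensor_e cotensor_star)

lemma pair_cotensor: "pair (x \<odot> y) f = (\<Sum>i\<in>UNIV. \<Sum>j\<in>UNIV. x i * y j * cotensor f (i,j))"
proof -
  have "pair (x \<odot> y) f = pair ((\<Sum>i\<in>UNIV. scl (x i) (bvec i)) \<odot> (\<Sum>j\<in>UNIV. scl (y j) (bvec j))) f"
    by (simp only: bvec_expand[symmetric])
  also have "\<dots> = (\<Sum>i\<in>UNIV. \<Sum>j\<in>UNIV. x i * y j * cotensor f (i,j))"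
    by (simp only: hmul_sum_left hmul_scl_left pair_linear)
      (simp add: hmul_linear pair_linear cotensor_def sum_distrib_left mult.assoc)
  finally show ?thesis .
qed

end

subsection \<open>Characteristic \<open>p\<close>\<close>

locale hopf_char = hopf m u c e s
  for m :: "'n::finite \<Rightarrow> 'n \<Rightarrow> 'n \<Rightarrow> 'k::field" and u c e s +
  fixes p :: nat
  assumes prime_p: "prime p" and of_nat_p: "of_nat p = (0::'k)"
begin

lemma p_pos: "p > 0"
  using prime_p by (rule prime_gt_0_nat)

lemmas frobenius_add = pw_frobenius_add[OF prime_p of_nat_p]
lemmas frobenius_sum = pw_frobenius_sum[OF prime_p of_nat_p]

lemma frobenius_sum_pow: "pw (\<Sum>i\<in>A. f i) (p ^ j) = (\<Sum>i\<in>A. pw (f i) (p ^ j))"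
proof (induction j)
  case (Suc j)
  have "pw f (p ^ Suc j) = pw (pw f (p ^ j)) p" for f by (simp add: pw_pw mult.commute)
  then show ?case by (simp only: Suc frobenius_sum)
qed (simp add: star_one_right)

lemma of_nat_nonzero: "0 < l \<Longrightarrow> l < p \<Longrightarrow> of_nat l \<noteq> (0::'k)"
proof
  assume l: "0 < l" "l < p" and "of_nat l = (0::'k)"
  then have "CHAR('k) dvd l" "CHAR('k) dvd p" using of_nat_p by (auto simp: of_nat_eq_0_iff_char_dvd)
  moreover have "CHAR('k) \<noteq> 1" using of_nat_CHAR[where 'a='k] by (metis of_nat_1 zero_neq_one)
  ultimately show False using prime_p l by (metis dvd_imp_le not_le prime_nat_iff)
qed

text \<open>If the comultiplication of \<open>g\<close> is the sum of the tensors of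
  \<open>\<alpha> b\<close> and \<open>\<beta> b\<close>, then that of its \<open>p\<close>-th power
  is the sum of the tensors of their \<open>p\<close>-th powers: the comultiplication is an algebra
  map, and the Frobenius map of the tensor square is additive.\<close>

lemma comul_frobenius:
  assumes "\<And>x y. pair (x \<odot> y) g = (\<Sum>b\<in>A. pair x (\<alpha> b) * pair y (\<beta> b))"
  shows "pair (x \<odot> y) (pw g p) = (\<Sum>b\<in>A. pair x (pw (\<alpha> b) p) * pair y (pw (\<beta> b) p))"
proof -
  interpret T: calg "tsc c" "tensor e e" by (rule tensor_calg)
  have "cotensor g = (\<Sum>b\<in>A. tensor (\<alpha> b) (\<beta> b))"
    by (auto simp: cotensor_def assms tensor_def fapply fun_eq_iff)
  then have "cotensor (pw g p) = (\<Sum>b\<in>A. tensor (pw (\<alpha> b) p) (pw (\<beta> b) p))"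
    by (simp add: cotensor_pw T.pw_frobenius_sum[OF prime_p of_nat_p] spow_tensor)
  then have "pair (x \<odot> y) (pw g p) = (\<Sum>i\<in>UNIV. \<Sum>j\<in>UNIV. \<Sum>b\<in>A. (x i * pw (\<alpha> b) p i) * (y j * pw (\<beta> b) p j))"
    by (simp add: pair_cotensor tensor_def fapply sum_distrib_left mult_ac)
  also have "\<dots> = (\<Sum>i\<in>UNIV. \<Sum>b\<in>A. \<Sum>j\<in>UNIV. (x i * pw (\<alpha> b) p i) * (y j * pw (\<beta> b) p j))"
    by (rule sum.cong[OF refl], rule sum.swap)
  also have "\<dots> = (\<Sum>b\<in>A. \<Sum>i\<in>UNIV. \<Sum>j\<in>UNIV. (x i * pw (\<alpha> b) p i) * (y j * pw (\<beta> b) p j))"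
    by (rule sum.swap)
  finally show ?thesis by (simp only: sum_product[symmetric] pair_def)
qed

lemma L_frobenius: "L y (pw g p) = (\<Sum>i\<in>UNIV. scl (pair y (pw (bvec i) p)) (pw (L (bvec i) g) p))"
proof (rule pair_eqI)
  fix x
  have "pair (x \<odot> y) g = (\<Sum>i\<in>UNIV. pair x (L (bvec i) g) * pair y (bvec i))" for x y
  proof -
    have "pair (x \<odot> y) g = pair (x \<odot> (\<Sum>i\<in>UNIV. scl (y i) (bvec i))) g" by (simp only: bvec_expand[symmetric])
    then show ?thesis by (simp only: hmul_linear pair_linear) (simp add: pair_L mult.commute)
  qed
  from comul_frobenius[OF this]
  show "pair x (L y (pw g p)) = pair x (\<Sum>i\<in>UNIV. scl (pair y (pw (bvec i) p)) (pw (L (bvec i) g) p))"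
    by (simp add: pair_L pair_linear mult.commute)
qed

lemma R_frobenius: "R x (pw g p) = (\<Sum>i\<in>UNIV. scl (pair x (pw (bvec i) p)) (pw (R (bvec i) g) p))"
proof (rule pair_eqI)
  fix y
  have "pair (x \<odot> y) g = (\<Sum>i\<in>UNIV. pair x (bvec i) * pair y (R (bvec i) g))" for x y
  proof -
    have "pair (x \<odot> y) g = pair ((\<Sum>i\<in>UNIV. scl (x i) (bvec i)) \<odot> y) g" by (simp only: bvec_expand[symmetric])
    then show ?thesis by (simp only: hmul_linear pair_linear) (simp add: pair_R)
  qed
  from comul_frobenius[OF this]
  show "pair y (R x (pw g p)) = pair y (\<Sum>i\<in>UNIV. scl (pair x (pw (bvec i) p)) (pw (R (bvec i) g) p))"
    by (simp add: pair_R pair_linear)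
qed

text \<open>This is the space \<open>k X\<^sup>p\<close>. The span is taken because a scalar comes
  out of a \<open>p\<close>-th power as its own \<open>p\<close>-th power, so over an imperfect
  field the \<open>p\<close>-th powers of a subspace need not form a subspace.\<close>

definition frob :: "('n \<Rightarrow> 'k) set \<Rightarrow> ('n \<Rightarrow> 'k) set" where
  "frob X = fv.span {pw g p | g. g \<in> X}"

lemma frobI: "g \<in> X \<Longrightarrow> pw g p \<in> frob X"
  unfolding frob_def by (rule fv.span_base) blast

lemma subspace_frob: "fv.subspace (frob X)"
  by (simp add: frob_def)

lemma frob_minimal:
  "(\<And>g. g \<in> X \<Longrightarrow> pw g p \<in> U) \<Longrightarrow> fv.subspace U \<Longrightarrow> frob X \<subseteq> U"
  unfolding frob_def by (intro fv.span_minimal) auto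

lemma frob_sub: "subbialg Q \<Longrightarrow> frob Q \<subseteq> Q"
  by (intro frob_minimal subbialg_pw subbialg_subspace)

text \<open>A product of \<open>p\<close>-th powers is a \<open>p\<close>-th power, and by
  \<open>L_frobenius\<close> and \<open>R_frobenius\<close> a translate of a \<open>p\<close>-th
  power is a combination of \<open>p\<close>-th powers of translates.\<close>

lemma subbialg_frob:
  assumes Q: "subbialg Q"
  shows "subbialg (frob Q)"
  unfolding subbialg_def
proof (intro conjI ballI allI)
  show "fv.subspace (frob Q)" by (rule subspace_frob)
  show "e \<in> frob Q" using frobI[OF subbialg_e[OF Q]] by (simp add: pw_one)
  have 1: "pw g p \<star> f \<in> frob Q" if g: "g \<in> Q" and f: "f \<in> frob Q" for f g
  proof -
    have "frob Q \<subseteq> {f. pw g p \<star> f \<in> frob Q}"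
      by (intro frob_minimal subspace_vimage flinear_star_left subspace_frob)
        (simp add: pw_star[symmetric] frobI subbialg_star[OF Q g])
    then show ?thesis using f by auto
  qed
  show "f \<star> g \<in> frob Q" if "f \<in> frob Q" "g \<in> frob Q" for f g
  proof -
    have "frob Q \<subseteq> {f. f \<star> g \<in> frob Q}"
      by (intro frob_minimal subspace_vimage flinear_star_right subspace_frob) (simp add: 1 that)
    then show ?thesis using that by auto
  qed
  show "L h f \<in> frob Q" if "f \<in> frob Q" for h f
  proof -
    have "frob Q \<subseteq> {f. L h f \<in> frob Q}"
      by (intro frob_minimal subspace_vimage flinear_L subspace_frob)
        (auto simp: L_frobenius intro!: fv.subspace_sum fv.subspace_scale subspace_frob frobI subbialg_L[OF Q])
    then show ?thesis using that by auto
  qed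
  show "R h f \<in> frob Q" if "f \<in> frob Q" for h f
  proof -
    have "frob Q \<subseteq> {f. R h f \<in> frob Q}"
      by (intro frob_minimal subspace_vimage flinear_R subspace_frob)
        (auto simp: R_frobenius intro!: fv.subspace_sum fv.subspace_scale subspace_frob frobI subbialg_R[OF Q])
    then show ?thesis using that by auto
  qed
qed

lemma deriv_on_frob:
  assumes Q: "subbialg Q" and D: "deriv_on Q D" and f: "f \<in> frob Q"
  shows "D f = 0"
proof -
  have "frob Q \<subseteq> {f. D f \<in> {0}}"
    by (intro frob_minimal subspace_vimage deriv_on_linear[OF D] fv.subspace_single_0)
      (simp add: deriv_on_pw[OF Q D] of_nat_p)
  then show ?thesis using f by auto
qed

text \<open>On polynomials in \<open>x\<close> with coefficients in \<open>Z\<close> the map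
  \<open>D\<close> is differentiation by \<open>x\<close>. The derivative of a vanishing polynomial
  vanishes and has smaller degree, and the factors \<open>l\<close> below \<open>p\<close> are
  invertible; induction gives all coefficients but the constant one, which then vanishes as
  well.\<close>

lemma polynomial_vanishes:
  assumes D: "flinear D"
    and Dx: "\<And>a l. a \<in> Z \<Longrightarrow> D (a \<star> pw x l) = scl (of_nat l) (a \<star> pw x (l - 1))"
    and Z: "\<And>a t. a \<in> Z \<Longrightarrow> scl t a \<in> Z"
  shows "n < p \<Longrightarrow> (\<And>l. l \<le> n \<Longrightarrow> a l \<in> Z) \<Longrightarrow> (\<Sum>l\<le>n. a l \<star> pw x l) = 0 \<Longrightarrow> l \<le> n \<Longrightarrow> a l = 0"
proof (induction n arbitrary: a l)
  case 0
  then show ?case by (simp add: star_one_right)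
next
  case (Suc n)
  let ?b = "\<lambda>l. scl (of_nat (Suc l)) (a (Suc l))"
  have "0 = D (\<Sum>l\<le>Suc n. a l \<star> pw x l)" using Suc.prems(3) flinear_0[OF D] by simp
  also have "\<dots> = (\<Sum>l\<le>Suc n. scl (of_nat l) (a l \<star> pw x (l - 1)))"
    unfolding flinear_sum[OF D] by (intro sum.cong refl Dx Suc.prems(2)) simp
  also have "\<dots> = (\<Sum>l\<le>n. ?b l \<star> pw x l)"
    by (subst sum.atMost_Suc_shift) (simp add: star_linear)
  finally have "(\<Sum>l\<le>n. ?b l \<star> pw x l) = 0" by simp
  moreover have "?b l \<in> Z" if "l \<le> n" for l using that Suc.prems(2) Z by simp
  ultimately have "?b l = 0" if "l \<le> n" for l using that Suc.IH[of ?b l] Suc.prems(1) by simp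
  then have *: "a (Suc l) = 0" if "l \<le> n" for l
    using that of_nat_nonzero[of "Suc l"] Suc.prems(1) by auto
  then have "(\<Sum>l\<le>Suc n. a l \<star> pw x l) = a 0"
    by (subst sum.atMost_Suc_shift) (simp add: star_one_right)
  then show ?case using * Suc.prems(3,4) by (cases l) auto
qed

text \<open>After multiplication by \<open>e1\<close> the derivations \<open>D b\<close> become
  partial derivatives with respect to the coordinates in \<open>J\<close>. Write \<open>a\<close> as
  a polynomial of degree below \<open>p\<close> in one coordinate \<open>x\<close>, with
  coefficients in the other coordinates. Since its derivative by \<open>x\<close> vanishes, only the
  constant coefficient survives, and induction on the number of coordinates removes them
  all.\<close>

lemma adj_invariant:
  assumes Q: "subbialg Q" and fin: "finite J1" and J1: "J1 \<subseteq> J" and J: "J \<subseteq> Q"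
    and D: "\<forall>b\<in>J. deriv_on Q (D b)" and e1: "e1 \<in> frob Q"
    and dual: "\<forall>b\<in>J. \<forall>b'\<in>J. D b b' \<star> e1 = (if b = b' then e1 else 0)"
  shows "a \<in> adj (frob Q) J1 \<Longrightarrow> \<forall>b\<in>J1. D b (a \<star> e1) = 0 \<Longrightarrow> a \<star> e1 \<in> frob Q"
  using fin J1
proof (induction J1 arbitrary: a rule: finite_induct)
  case empty
  from empty.prems(1) have "a \<in> frob Q"
    by (induction rule: adj.induct) (auto intro: fv.subspace_add[OF subspace_frob])
  then show ?case using e1 subbialg_star[OF subbialg_frob[OF Q]] by blast
next
  case (insert x J1)
  note Bsub = frob_sub[OF Q] and B = subbialg_frob[OF Q]
  have x: "x \<in> J" "x \<in> Q" using insert.prems J by auto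
  have Dx: "deriv_on Q (D x)" using D x by auto
  have e1Q: "e1 \<in> Q" using e1 Bsub by auto
  have inQ: "g \<in> Q" if "g \<in> adj (frob Q) J1" for g
    using adj_sub[OF Q Bsub _ that] insert.prems J by auto
  have De1: "D x (g \<star> e1) = D x g \<star> e1" if "g \<in> Q" for g
    using deriv_on_star[OF Dx that e1Q] deriv_on_frob[OF Q Dx e1] by simp
  \<comment> \<open>Up to multiplication by \<open>e1\<close>, the map \<open>D x\<close> kills the
    other coordinates by duality, and it kills \<open>frob Q\<close> outright.\<close>
  have Dadj: "D x g \<star> e1 = 0" if "g \<in> adj (frob Q) J1" for g
    using that
  proof (induction rule: adj.induct)
    case (base q)
    then show ?case using deriv_on_frob[OF Q Dx] by simp
  next
    case (add a b)
    then show ?case by (simp add: flinear_add[OF deriv_on_linear[OF Dx]] star_linear)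
  next
    case (mult z a)
    have "z \<in> J" "z \<noteq> x" using mult(1) insert by auto
    then have "D x z \<star> e1 = 0" using dual x by auto
    moreover have "D x (z \<star> a) = D x z \<star> a + z \<star> D x a"
      using \<open>z \<in> J\<close> J inQ[OF mult(2)] by (intro deriv_on_star[OF Dx]) auto
    ultimately show ?case using mult(3)
      by (simp add: star_linear star_assoc star_left_commute[of "D x z"] star_commute[of a])
        (metis star_assoc star_commute star_0_right)
  qed
  have B0: "0 \<in> frob Q" by (rule fv.subspace_0[OF subspace_frob])
  obtain k where k: "\<forall>l<p. k l \<in> adj (frob Q) J1" "a = (\<Sum>l<p. k l \<star> pw x l)"
    using adj_insert[OF B0 subbialg_star[OF B] frobI[OF x(2)] p_pos insert.prems(1)] by blast
  \<comment> \<open>On these coefficients \<open>D x\<close> differentiates polynomials in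
    \<open>x\<close> because \<open>D x x \<star> e1 = e1\<close>.\<close>
  define Z where "Z = {g \<star> e1 | g. g \<in> adj (frob Q) J1}"
  have Z1: "D x (z \<star> pw x l) = scl (of_nat l) (z \<star> pw x (l - 1))" if "z \<in> Z" for z l
  proof -
    obtain g where g: "z = g \<star> e1" "g \<in> adj (frob Q) J1" using \<open>z \<in> Z\<close> by (auto simp: Z_def)
    have "D x (z \<star> pw x l) = D x z \<star> pw x l + z \<star> D x (pw x l)"
      using inQ[OF g(2)] e1Q subbialg_star[OF Q] unfolding g(1)
      by (intro deriv_on_star[OF Dx] subbialg_pw[OF Q x(2)]) auto
    also have "D x z = 0" using De1[OF inQ[OF g(2)]] Dadj[OF g(2)] g(1) by simp
    also have "z \<star> D x (pw x l) = scl (of_nat l) (g \<star> (pw x (l - 1) \<star> (D x x \<star> e1)))"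
      by (simp add: deriv_on_pw[OF Q Dx x(2)] g(1) star_linear star_ac)
    also have "D x x \<star> e1 = e1" using dual x by auto
    finally show ?thesis by (simp add: g(1) star_ac)
  qed
  have Z2: "scl t z \<in> Z" if "z \<in> Z" for z t
  proof -
    obtain g where g: "z = g \<star> e1" "g \<in> adj (frob Q) J1" using \<open>z \<in> Z\<close> by (auto simp: Z_def)
    then have "scl t g \<in> adj (frob Q) J1" by (intro adj_scl fv.subspace_scale subspace_frob)
    then show ?thesis unfolding Z_def g(1) star_scl_left[symmetric] by blast
  qed
  have kZ: "k l \<star> e1 \<in> Z" if "l < p" for l using k(1) that by (auto simp: Z_def)
  obtain r where r: "p = Suc r" using p_pos by (cases p) auto
  have ae1: "a \<star> e1 = (\<Sum>l\<le>r. (k l \<star> e1) \<star> pw x l)"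
    unfolding k(2) r lessThan_Suc_atMost by (simp add: star_linear star_ac)
  have "a \<star> e1 = k 0 \<star> e1"
  proof (cases r)
    case 0
    then show ?thesis using ae1 by (simp add: star_one_right)
  next
    case (Suc n)
    have "0 = D x (a \<star> e1)" using insert.prems(2) by simp
    also have "\<dots> = (\<Sum>l\<le>r. scl (of_nat l) ((k l \<star> e1) \<star> pw x (l - 1)))"
      unfolding ae1 flinear_sum[OF deriv_on_linear[OF Dx]]
      by (intro sum.cong refl Z1 kZ) (simp add: r)
    also have "\<dots> = (\<Sum>l\<le>n. scl (of_nat (Suc l)) (k (Suc l) \<star> e1) \<star> pw x l)"
      unfolding Suc by (subst sum.atMost_Suc_shift) (simp add: star_linear)
    finally have z: "(\<Sum>l\<le>n. scl (of_nat (Suc l)) (k (Suc l) \<star> e1) \<star> pw x l) = 0" by simp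
    have "scl (of_nat (Suc l)) (k (Suc l) \<star> e1) = 0" if "l \<le> n" for l
      by (rule polynomial_vanishes[OF deriv_on_linear[OF Dx] Z1 Z2 _ _ z that])
        (auto intro!: Z2 kZ simp: r Suc)
    then have *: "k (Suc l) \<star> e1 = 0" if "l \<le> n" for l
      using that of_nat_nonzero[of "Suc l"] r Suc by auto
    show ?thesis unfolding ae1 Suc by (subst sum.atMost_Suc_shift) (simp add: * star_one_right)
  qed
  moreover have "k 0 \<star> e1 \<in> frob Q"
  proof (rule insert.IH)
    show "k 0 \<in> adj (frob Q) J1" using k(1) p_pos by simp
    show "\<forall>b\<in>J1. D b (k 0 \<star> e1) = 0" using insert.prems(2) calculation by auto
    show "J1 \<subseteq> J" using insert.prems by auto
  qed
  ultimately show ?case by simp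
qed

end

section \<open>Invariants and the nilpotent action of tangent vectors\<close>

context hopf
begin

lemma invs_L: "subbialg Q \<Longrightarrow> f \<in> invs Q \<Longrightarrow> L h f \<in> invs Q"
  by (auto simp: invs_def subbialg_L L_R[symmetric] L_linear)

text \<open>Here \<open>\<lambda>k. S (bvec k) i\<close> is the transposed antipode applied to \<open>bvec i\<close>.\<close>

lemma antipode_dual:
  "(\<Sum>i\<in>UNIV. L (bvec i) f \<star> (\<lambda>k. S (bvec k) i)) = scl (pair u f) e"
proof (rule pair_eqI)
  fix x
  have a: "(\<Sum>i\<in>UNIV. L (bvec i) f j * S (bvec k) i) = pair (bvec j \<odot> S (bvec k)) f" for j k
  proof -
    have "pair (bvec j \<odot> S (bvec k)) f = pair (bvec j \<odot> (\<Sum>i\<in>UNIV. scl (S (bvec k) i) (bvec i))) f"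
      by (simp only: bvec_expand[symmetric])
    then show ?thesis by (simp only: hmul_linear pair_linear) (simp add: L_def mult.commute)
  qed
  have "pair x (\<Sum>i\<in>UNIV. L (bvec i) f \<star> (\<lambda>k. S (bvec k) i))
    = (\<Sum>p\<in>UNIV. \<Sum>i\<in>UNIV. \<Delta> x p * (L (bvec i) f (fst p) * S (bvec (snd p)) i))"
    unfolding pair_linear pair_star by (rule sum.swap)
  also have "\<dots> = pair (\<Sum>p\<in>UNIV. scl (\<Delta> x p) (bvec (fst p) \<odot> S (bvec (snd p)))) f"
    by (simp only: sum_distrib_left[symmetric] a pair_linear)
  also have "\<dots> = pair x (scl (pair u f) e)"
    by (simp add: antipode_right pair_linear mult.commute)
  finally show "pair x (\<Sum>i\<in>UNIV. L (bvec i) f \<star> (\<lambda>k. S (bvec k) i)) = pair x (scl (pair u f) e)" .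
qed

text \<open>The tangent vectors of \<open>Q\<close> act nilpotently. The property is stated through
  a chain of sets, since applying \<open>frob\<close> to every term gives such a chain for
  \<open>frob Q\<close>.\<close>

definition nilp :: "('n \<Rightarrow> 'k) set \<Rightarrow> bool" where
  "nilp Q \<longleftrightarrow> (\<exists>T d. T 0 \<subseteq> {0} \<and> Q \<subseteq> T d \<and> (\<forall>i. T i \<subseteq> Q) \<and>
     (\<forall>i::nat. \<forall>h\<in>prim Q. \<forall>f\<in>T (Suc i). R h f \<in> T i))"

text \<open>A nonzero \<open>f\<close> in \<open>V\<close> at the lowest possible level of the chain
  is sent by each tangent vector to a lower level inside \<open>V\<close>, hence to 0.\<close>

lemma nilp_meets_invs:
  assumes Q: "nilp Q" and V: "V \<subseteq> Q" "V \<noteq> {0}" "fv.subspace V" and stab: "\<And>h f. f \<in> V \<Longrightarrow> R h f \<in> V"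
  obtains f where "f \<in> V" "f \<noteq> 0" "f \<in> invs Q"
proof -
  obtain T d where T: "T 0 \<subseteq> {0}" "Q \<subseteq> T d" "\<forall>i. T i \<subseteq> Q"
    "\<forall>i::nat. \<forall>h\<in>prim Q. \<forall>f\<in>T (Suc i). R h f \<in> T i"
    using Q by (auto simp: nilp_def)
  obtain f k where f: "f \<in> V" "f \<noteq> 0" "f \<in> T (Suc k)" "\<forall>g\<in>V. g \<in> T k \<longrightarrow> g = 0"
    by (rule chain_first_meet[OF V(3,2) T(1) subset_trans[OF V(1) T(2)]])
  have "R h f = 0" if h: "h \<in> prim Q" for h
  proof -
    have "R h f \<in> T k" using T(4) h f(3) by simp
    then show ?thesis using f(4) stab[OF f(1)] by simp
  qed
  then have "f \<in> invs Q" using f(1) V(1) by (auto simp: invs_def)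
  then show thesis using that f(1,2) by simp
qed

end

section \<open>Descent along the Frobenius chain\<close>

context hopf_char
begin

text \<open>Near the identity (after multiplication by \<open>e1\<close>) this is a computation with coordinates, and
  translation by \<open>L\<close> spreads it over the whole spectrum.\<close>

lemma invs_sub_frob:
  assumes Q: "subbialg Q" and pj: "\<And>r. pw r (p ^ j) \<in> frob Q" and f: "f \<in> invs Q"
  shows "f \<in> frob Q"
proof -
  note B = subbialg_frob[OF Q]
  obtain e0 N where e0: "e0 \<in> Q" "pair u e0 = 1" "\<And>b. b \<in> ipow Q N \<Longrightarrow> b \<star> e0 = 0"
    by (rule local_unit_exists[OF Q]) blast
  \<comment> \<open>The \<open>p\<close>-th power lies in \<open>frob Q\<close>, so that derivations
    of \<open>Q\<close> kill it, while it keeps counit 1 and is still killed by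
    \<open>ipow Q N\<close>.\<close>
  define e1 where "e1 = pw e0 p"
  have e1: "e1 \<in> frob Q" "pair u e1 = 1" "\<And>b. b \<in> ipow Q N \<Longrightarrow> b \<star> e1 = 0"
  proof -
    show "e1 \<in> frob Q" unfolding e1_def by (rule frobI[OF e0(1)])
    have "pair u (pw e0 n) = 1" for n by (induction n) (auto simp: counit_one counit_star e0)
    then show "pair u e1 = 1" by (simp add: e1_def)
    obtain r where "p = Suc r" using p_pos by (cases p) auto
    then show "b \<star> e1 = 0" if "b \<in> ipow Q N" for b
      using e0(3)[OF that] by (simp add: e1_def star_assoc[symmetric])
  qed
  obtain J y where J: "finite J" "J \<subseteq> aug Q" "\<forall>b\<in>J. y b \<in> prim Q"
    "\<forall>b\<in>J. \<forall>b'\<in>J. pair (y b) b' = (if b = b' then 1 else 0)"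
    "\<forall>g\<in>aug Q. g - (\<Sum>b\<in>J. scl (pair (y b) g) b) \<in> ipow Q 2"
    by (rule tangent_basis[OF Q])
  from dual_derivations[OF Q J(1-4), of N]
  obtain D where D: "\<forall>b\<in>J. deriv_on Q (D b)" "\<forall>b\<in>J. \<forall>f\<in>invs Q. D b f = 0"
    "\<forall>b\<in>J. \<forall>b'\<in>J. D b b' - (if b = b' then e else 0) \<in> ipow Q (Suc N)" by blast
  \<comment> \<open>The errors lie in a power of \<open>aug Q\<close> that kills \<open>e1\<close>,
    so after multiplication by \<open>e1\<close> the duality is exact.\<close>
  have dual: "\<forall>b\<in>J. \<forall>b'\<in>J. D b b' \<star> e1 = (if b = b' then e1 else 0)"
  proof (intro ballI)
    fix b b' assume b: "b \<in> J" "b' \<in> J"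
    then have "D b b' - (if b = b' then e else 0) \<in> ipow Q (Suc N)" using D(3) by blast
    then have "D b b' - (if b = b' then e else 0) \<in> ipow Q N" using ipow_Suc_sub[OF Q, of N] by blast
    from e1(3)[OF this] show "D b b' \<star> e1 = (if b = b' then e1 else 0)"
      by (auto simp: star_linear star_one_left split: if_splits)
  qed
  have JQ: "J \<subseteq> Q" using J(2) aug_sub by auto
  have inv_e1: "g \<star> e1 \<in> frob Q" if g: "g \<in> invs Q" for g
  proof -
    have gQ: "g \<in> Q" using g by (simp add: invs_def)
    obtain a where a: "a \<in> adj (frob Q) J" "g - a \<in> ipow Q N"
      using adj_generates[OF Q J(2) subspace_frob subbialg_e[OF B] frob_sub[OF Q] subbialg_star[OF B] J(5) gQ, of N]
      by blast
    have ga: "g \<star> e1 = a \<star> e1" using e1(3)[OF a(2)] by (simp add: star_linear)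
    have "D b (a \<star> e1) = 0" if "b \<in> J" for b
    proof -
      have Db: "deriv_on Q (D b)" using D(1) that by auto
      have "D b (g \<star> e1) = D b g \<star> e1 + g \<star> D b e1"
        using e1(1) frob_sub[OF Q] by (intro deriv_on_star[OF Db gQ]) auto
      also have "\<dots> = 0" using D(2) that g deriv_on_frob[OF Q Db e1(1)] by simp
      finally show ?thesis by (simp only: ga)
    qed
    then show ?thesis
      unfolding ga using adj_invariant[OF Q J(1) subset_refl JQ D(1) e1(1) dual a(1)] by blast
  qed
  \<comment> \<open>In Sweedler notation this is \<open>h\<^sub>1 (e1 (S(h\<^sub>2) f))\<close>. The
    translate \<open>S(h\<^sub>2) f\<close> is again invariant, so its product with
    \<open>e1\<close> lies in \<open>frob Q\<close>, which is stable under \<open>L\<close>.\<close>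
  have X: "L h e1 \<star> f \<in> frob Q" for h
    unfolding L_star_antipode
    by (intro fv.subspace_sum fv.subspace_scale subspace_frob subbialg_L[OF B])
      (subst star_commute, intro inv_e1 invs_L[OF Q f])
  let ?q = "p ^ j" and ?s = "\<lambda>i. (\<lambda>k. S (bvec k) i)"
  obtain q where q: "?q = Suc q" using p_pos by (metis gr0_implies_Suc zero_less_power)
  \<comment> \<open>The translates of \<open>e1\<close> generate the unit ideal of the dual algebra,
    with coefficients \<open>?s i\<close> that may lie outside \<open>Q\<close>. Raising the
    relation to the power \<open>p ^ j\<close> brings the coefficients into
    \<open>frob Q\<close>.\<close>
  have "e = (\<Sum>i\<in>UNIV. L (bvec i) e1 \<star> ?s i)" by (simp add: antipode_dual e1)
  then have "pw e ?q = pw (\<Sum>i\<in>UNIV. L (bvec i) e1 \<star> ?s i) ?q" by (rule arg_cong)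
  then have e: "e = (\<Sum>i\<in>UNIV. pw (L (bvec i) e1) ?q \<star> pw (?s i) ?q)"
    by (simp only: frobenius_sum_pow pw_star pw_one)
  have "f = e \<star> f" by (simp add: star_one_left)
  also have "\<dots> = (\<Sum>i\<in>UNIV. pw (L (bvec i) e1) ?q \<star> pw (?s i) ?q) \<star> f"
    by (rule arg_cong[where f = "\<lambda>z. z \<star> f", OF e])
  \<comment> \<open>One factor \<open>L (bvec i) e1\<close> is split off from the power, to be
    absorbed by \<open>f\<close> as in \<open>X\<close>.\<close>
  also have "\<dots> = (\<Sum>i\<in>UNIV. pw (L (bvec i) e1) q \<star> (pw (?s i) ?q \<star> (L (bvec i) e1 \<star> f)))"
    unfolding q by (simp add: star_linear star_ac)
  also have "\<dots> \<in> frob Q"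
    by (intro fv.subspace_sum subspace_frob subbialg_star[OF B] subbialg_pw[OF B] subbialg_L[OF B] e1(1) pj X)
  finally show ?thesis .
qed

text \<open>Evaluating \<open>h\<close> on \<open>p\<close>-th powers gives a Frobenius-semilinear
  functional on \<open>Q\<close> that kills \<open>e\<close> and all products of two elements of
  \<open>aug Q\<close>. In a basis of \<open>Q\<close> adapted to the span of these, it is supported
  on the part whose dual coordinates are tangent vectors of \<open>Q\<close>.\<close>

lemma R_frobenius_prim:
  assumes Q: "subbialg Q" and h: "h \<in> prim (frob Q)" and g: "g \<in> Q"
  shows "R h (pw g p) \<in> fv.span {pw (R y g) p | y. y \<in> prim Q}"
proof -
  note sQ = subbialg_subspace[OF Q] and B = subbialg_frob[OF Q]
  define G where "G = insert e {a \<star> b | a b. a \<in> aug Q \<and> b \<in> aug Q}"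
  have "fv.span G \<subseteq> Q"
    using subsetD[OF aug_sub] subbialg_star[OF Q] subbialg_e[OF Q]
    by (intro fv.span_minimal sQ) (auto simp: G_def)
  then obtain J0 J y where J: "finite J0" "finite J" "J0 \<inter> J = {}" "J0 \<subseteq> fv.span G" "J \<subseteq> Q"
    "\<forall>g\<in>Q. g = (\<Sum>b\<in>J0 \<union> J. scl (pair (y b) g) b)"
    "\<forall>b\<in>J. \<forall>g\<in>fv.span G. pair (y b) g = 0"
    by (rule adapted_dual_basis[OF fv.subspace_span sQ])
  have y: "y b \<in> prim Q" if "b \<in> J" for b
  proof -
    have "pair (y b) g = 0" if "g \<in> G" for g
      using J(7) \<open>b \<in> J\<close> fv.span_base[OF that] by blast
    moreover have "e \<in> G" "\<And>f g. f \<in> aug Q \<Longrightarrow> g \<in> aug Q \<Longrightarrow> f \<star> g \<in> G"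
      unfolding G_def by blast+
    ultimately show ?thesis by (simp add: prim_def)
  qed
  have "pair (v \<odot> w) g = (\<Sum>b\<in>J0 \<union> J. pair v b * pair w (R (y b) g))" for v w
  proof -
    have "pair (v \<odot> w) g = pair v (\<Sum>b\<in>J0 \<union> J. scl (pair (y b) (L w g)) b)"
      using bspec[OF J(6) subbialg_L[OF Q g, of w]] by (simp add: pair_L[symmetric])
    then show ?thesis by (simp add: pair_linear pair_L[of "y _"] pair_R mult.commute)
  qed
  note com = comul_frobenius[OF this]
  have R: "R h (pw g p) = (\<Sum>b\<in>J0 \<union> J. scl (pair h (pw b p)) (pw (R (y b) g) p))"
    by (rule pair_eqI) (simp add: pair_R com pair_linear)
  \<comment> \<open>By additivity of the Frobenius map it suffices to check \<open>G\<close>; there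
    \<open>pw e p = e\<close>, and \<open>p\<close>-th powers of elements of \<open>aug Q\<close>
    lie in \<open>aug (frob Q)\<close>.\<close>
  have z: "pair h (pw b p) = 0" if "b \<in> fv.span G" for b
    using that
  proof (induction rule: fv.span_induct_alt)
    case base
    then show ?case using p_pos by (simp add: pw_0 pair_linear)
  next
    case (step t x z)
    have "pair h (pw x p) = 0"
    proof (cases "x = e")
      case True
      then show ?thesis using h by (simp add: pw_one prim_def)
    next
      case False
      then obtain a b where ab: "x = a \<star> b" "a \<in> aug Q" "b \<in> aug Q" using step(1) by (auto simp: G_def)
      have "pw a p \<in> aug (frob Q)" if "a \<in> aug Q" for a
      proof -
        have "pair u (pw a p) = 0"
          using that p_pos by (cases p) (auto simp: aug_def counit_star)
        then show ?thesis using that aug_sub frobI by (auto simp: aug_def)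
      qed
      then show ?thesis using h ab by (auto simp: prim_def pw_star)
    qed
    then show ?case using step(2) by (simp add: frobenius_add pw_scl pair_linear)
  qed
  show ?thesis unfolding R
  proof (intro fv.span_sum)
    fix b assume b: "b \<in> J0 \<union> J"
    show "scl (pair h (pw b p)) (pw (R (y b) g) p) \<in> fv.span {pw (R y g) p | y. y \<in> prim Q}"
    proof (cases "b \<in> J")
      case True
      then show ?thesis using y by (intro fv.span_scale fv.span_base) blast
    next
      case False
      then have "pair h (pw b p) = 0" using b J(4) z by auto
      then show ?thesis by (simp add: fv.span_zero)
    qed
  qed
qed

text \<open>The sets \<open>frob (T i)\<close> form the new chain: by
  \<open>R_frobenius_prim\<close> a tangent vector of \<open>frob Q\<close> acts on a
  \<open>p\<close>-th power of \<open>g\<close> through \<open>p\<close>-th powers of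
  \<open>R y g\<close> with \<open>y\<close> in \<open>prim Q\<close>, and \<open>R y g\<close> is
  one level lower.\<close>

lemma nilp_frob:
  assumes Q: "subbialg Q" and "nilp Q"
  shows "nilp (frob Q)"
proof -
  obtain T d where T: "T 0 \<subseteq> {0}" "Q \<subseteq> T d" "\<forall>i. T i \<subseteq> Q"
    "\<forall>i::nat. \<forall>h\<in>prim Q. \<forall>f\<in>T (Suc i). R h f \<in> T i"
    using assms(2) by (auto simp: nilp_def)
  have mono: "frob X \<subseteq> frob Y" if "X \<subseteq> Y" for X Y
    unfolding frob_def using that by (intro fv.span_mono) auto
  show ?thesis
    unfolding nilp_def
  proof (intro exI[of _ "\<lambda>i. frob (T i)"] exI[of _ d] conjI allI ballI)
    show "frob (T 0) \<subseteq> {0}" using T(1) p_pos by (intro frob_minimal fv.subspace_single_0) (auto simp: pw_0)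
    show "frob Q \<subseteq> frob (T d)" "\<And>i. frob (T i) \<subseteq> frob Q" using T by (auto intro!: mono)
    show "R h f \<in> frob (T i)" if h: "h \<in> prim (frob Q)" and f: "f \<in> frob (T (Suc i))" for i h f
    proof -
      have "frob (T (Suc i)) \<subseteq> {f. R h f \<in> frob (T i)}"
      proof (intro frob_minimal subspace_vimage flinear_R subspace_frob)
        fix g assume g: "g \<in> T (Suc i)"
        then have "R h (pw g p) \<in> fv.span {pw (R y g) p | y. y \<in> prim Q}"
          using T(3) by (intro R_frobenius_prim[OF Q h]) auto
        also have "\<dots> \<subseteq> frob (T i)"
          using T(4) g by (intro fv.span_minimal subspace_frob) (auto intro: frobI)
        finally show "pw g p \<in> {f. R h f \<in> frob (T i)}" by simp
      qed
      then show ?thesis using f by auto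
    qed
  qed
qed

text \<open>A nonzero nilpotent element of \<open>Q\<close> has a nonzero power \<open>g\<close>
  with \<open>pw g p = 0\<close>. In a basis of \<open>Q\<close> containing \<open>g\<close>, the
  \<open>p\<close>-th powers of the other members already span \<open>frob Q\<close>, whose
  dimension would therefore be less than that of \<open>Q\<close>.\<close>

lemma frob_fixed_reduced:
  assumes Q: "subbialg Q" and fr: "frob Q = Q" and f: "f \<in> Q" "pw f n = 0"
  shows "f = 0"
proof (rule ccontr)
  assume f0: "f \<noteq> 0"
  have "n \<le> p ^ n" using prime_p by (metis less_imp_le_nat less_exp nle_le order.trans power_mono prime_ge_2_nat zero_le)
  then have "pw f (p ^ n) = 0" using f(2) pw_add[of f n "p ^ n - n"] by simp
  then have L: "pw f (p ^ (LEAST i. pw f (p ^ i) = 0)) = 0" by (rule LeastI)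
  then obtain i where i: "(LEAST i. pw f (p ^ i) = 0) = Suc i"
    using f0 by (cases "LEAST i. pw f (p ^ i) = 0") (auto simp: star_one_right)
  define g where "g = pw f (p ^ i)"
  have g: "g \<in> Q" "g \<noteq> 0" "pw g p = 0"
    using subbialg_pw[OF Q f(1)] not_less_Least[of i "\<lambda>i. pw f (p ^ i) = 0"] i L
    by (auto simp: g_def pw_pw mult.commute)
  have "fv.independent {g}" using g(2) by simp
  then obtain B where B: "{g} \<subseteq> B" "B \<subseteq> Q" "fv.independent B" "Q \<subseteq> fv.span B"
    using fv.maximal_independent_subset_extend[of "{g}" Q] g(1) by blast
  have finB: "finite B" using B(3) by (rule fv.finiteI_independent)
  have "frob Q \<subseteq> fv.span ((\<lambda>b. pw b p) ` (B - {g}))"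
  proof (intro frob_minimal fv.subspace_span)
    fix q assume "q \<in> Q"
    then have "q \<in> fv.span B" using B by auto
    then show "pw q p \<in> fv.span ((\<lambda>b. pw b p) ` (B - {g}))"
    proof (induction rule: fv.span_induct_alt)
      case base
      then show ?case using p_pos by (simp add: pw_0 fv.span_zero)
    next
      case (step t x z)
      have "pw x p \<in> fv.span ((\<lambda>b. pw b p) ` (B - {g}))"
        using step(1) g(3) by (cases "x = g") (auto intro: fv.span_base simp: fv.span_zero)
      then show ?case using step(2) by (auto simp: frobenius_add pw_scl intro: fv.span_add fv.span_scale)
    qed
  qed
  then have "fv.dim Q \<le> card ((\<lambda>b. pw b p) ` (B - {g}))"
    using finB fr by (intro fv.dim_le_card) auto
  also have "\<dots> \<le> card (B - {g})" using finB by (intro card_image_le) simp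
  also have "\<dots> < card B" using finB B(1) by (intro psubset_card_mono) auto
  also have "card B = fv.dim Q" using B by (intro fv.basis_card_eq_dim)
  finally show False by simp
qed

text \<open>Among the nilpotent sub-bialgebras that contain \<open>V\<close> and all
  \<open>p ^ j\<close>-th powers for some \<open>j\<close>, take one of least dimension. Its
  \<open>frob\<close> has the same properties, so it equals its \<open>frob\<close> and is
  reduced.\<close>

lemma reduced_envelope_char:
  assumes nil: "nilp UNIV" and V: "fv.subspace V" "V \<noteq> {0}" "\<And>h f. f \<in> V \<Longrightarrow> R h f \<in> V"
    and Vmin: "\<And>V'. fv.subspace V' \<Longrightarrow> V' \<noteq> {0} \<Longrightarrow> (\<And>h f. f \<in> V' \<Longrightarrow> R h f \<in> V') \<Longrightarrow> V' \<subseteq> V \<Longrightarrow> V' = V"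
  obtains Q where "subbialg Q" "V \<subseteq> Q" "\<And>f n. f \<in> Q \<Longrightarrow> pw f n = 0 \<Longrightarrow> f = 0"
proof -
  define P where "P Q \<longleftrightarrow> subbialg Q \<and> nilp Q \<and> (\<exists>j. \<forall>r. pw r (p ^ j) \<in> Q) \<and> V \<subseteq> Q" for Q
  have "P UNIV" using nil subbialg_UNIV by (auto simp: P_def)
  then obtain Q where PQ: "P Q"
    and Qmin: "\<And>U'. P U' \<Longrightarrow> fv.subspace Q \<Longrightarrow> fv.subspace U' \<Longrightarrow> U' \<subseteq> Q \<Longrightarrow> U' = Q"
    using finite_dim_min[of P] by metis
  from PQ obtain j where Q: "subbialg Q" "nilp Q" "V \<subseteq> Q" and j: "\<And>r. pw r (p ^ j) \<in> Q"
    by (auto simp: P_def)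
  have j': "pw r (p ^ Suc j) \<in> frob Q" for r
    using frobI[OF j[of r]] by (simp add: pw_pw mult.commute)
  note B = subbialg_frob[OF Q(1)]
  obtain f where f: "f \<in> V" "f \<noteq> 0" "f \<in> invs Q" by (rule nilp_meets_invs[OF Q(2,3) V(2,1,3)])
  have fB: "f \<in> frob Q" using invs_sub_frob[OF Q(1) j' f(3)] .
  \<comment> \<open>The intersection is a stable subspace containing \<open>f\<close>, which is
    nonzero, so minimality of \<open>V\<close> applies.\<close>
  have "V \<inter> frob Q = V"
    using f fB V subbialg_R[OF B]
    by (intro Vmin fv.subspace_inter subspace_frob) auto
  moreover have "\<exists>j. \<forall>r. pw r (p ^ j) \<in> frob Q" using j' by blast
  ultimately have "P (frob Q)" using B nilp_frob[OF Q(1,2)] by (auto simp: P_def)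
  then have "frob Q = Q"
    by (intro Qmin subspace_frob subbialg_subspace[OF Q(1)] frob_sub[OF Q(1)])
  then show thesis using that[OF Q(1,3)] frob_fixed_reduced[OF Q(1)] by blast
qed

end

subsection \<open>Traces\<close>

definition ftrace :: "(('n::finite \<Rightarrow> 'k::field) \<Rightarrow> ('n \<Rightarrow> 'k)) \<Rightarrow> 'k" where
  "ftrace T = (\<Sum>i\<in>UNIV. T (bvec i) i)"

lemma flinear_expand:
  fixes T :: "('n::finite \<Rightarrow> 'k::field) \<Rightarrow> ('n \<Rightarrow> 'k)"
  assumes T: "flinear T"
  shows "T v i = (\<Sum>j\<in>UNIV. v j * T (bvec j) i)"
proof -
  have "T v = T (\<Sum>j\<in>UNIV. scl (v j) (bvec j))" by (simp only: bvec_expand[symmetric])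
  also have "\<dots> = (\<Sum>j\<in>UNIV. scl (v j) (T (bvec j)))" by (simp only: flinear_sum[OF T] flinear_scl[OF T])
  finally show ?thesis by (simp add: fapply)
qed

lemma ftrace_commute:
  fixes T T' :: "('n::finite \<Rightarrow> 'k::field) \<Rightarrow> ('n \<Rightarrow> 'k)"
  assumes "flinear T" "flinear T'"
  shows "ftrace (\<lambda>v. T (T' v)) = ftrace (\<lambda>v. T' (T v))"
proof -
  have "ftrace (\<lambda>v. T (T' v)) = (\<Sum>i\<in>UNIV. \<Sum>j\<in>UNIV. T' (bvec i) j * T (bvec j) i)"
    by (simp add: ftrace_def flinear_expand[OF assms(1), of "T' _"])
  also have "\<dots> = (\<Sum>j\<in>UNIV. \<Sum>i\<in>UNIV. T' (bvec i) j * T (bvec j) i)" by (rule sum.swap)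
  also have "\<dots> = ftrace (\<lambda>v. T' (T v))"
    by (simp add: ftrace_def flinear_expand[OF assms(2), of "T _"] mult.commute)
  finally show ?thesis .
qed

text \<open>With a projection \<open>\<pi>\<close> onto the range, \<open>T\<close> is
  \<open>\<pi>\<close> after \<open>T\<close>; in the opposite order the composite vanishes because
  \<open>T\<close> kills its own range. The two traces agree.\<close>

lemma ftrace_square_zero:
  fixes T :: "('n::finite \<Rightarrow> 'k::field) \<Rightarrow> ('n \<Rightarrow> 'k)"
  assumes T: "flinear T" and sq: "\<And>v. T (T v) = 0"
  shows "ftrace T = 0"
proof -
  obtain \<pi> where \<pi>: "flinear \<pi>" "\<And>x. \<pi> x \<in> range T" "\<And>x. x \<in> range T \<Longrightarrow> \<pi> x = x"
    using projection_onto[OF subspace_flinear_image[OF T fv.subspace_UNIV]] by metis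
  have z: "T (\<pi> v) = 0" for v using \<pi>(2)[of v] sq by auto
  have "ftrace T = ftrace (\<lambda>v. \<pi> (T v))" by (simp add: \<pi>(3))
  also have "\<dots> = ftrace (\<lambda>v. T (\<pi> v))" by (rule ftrace_commute[OF \<pi>(1) T])
  also have "\<dots> = 0" by (simp add: ftrace_def z fapply)
  finally show ?thesis .
qed

context hopf
begin

subsection \<open>Characteristic zero\<close>

lemma antipode_left: "(\<Sum>p\<in>UNIV. scl (\<Delta> x p) (S (bvec (fst p)) \<odot> bvec (snd p))) = scl (pair x e) u"
proof -
  have "(\<lambda>l. \<Sum>i\<in>UNIV. \<Sum>j\<in>UNIV. \<Delta> x (i,j) * hmul m (S (bvec i)) (bvec j) l) = (\<lambda>l. hcounit e x * u l)"
    using hopf by (simp add: hopf_algebra_def)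
  then show ?thesis
    by (simp add: fun_eq_iff fapply sum_UNIV_prod hcounit_def pair_def)
qed

text \<open>Cocommutativity gives this variant of the antipode identity, in the order of factors
  that cyclicity of the trace produces in \<open>ftrace_L\<close>.\<close>

lemma antipode_left': "(\<Sum>p\<in>UNIV. scl (\<Delta> x p) (S (bvec (snd p)) \<odot> bvec (fst p))) = scl (pair x e) u"
proof -
  have "(\<Sum>p\<in>UNIV. scl (\<Delta> x p) (S (bvec (snd p)) \<odot> bvec (fst p)))
    = (\<Sum>i\<in>UNIV. \<Sum>j\<in>UNIV. scl (\<Delta> x (i,j)) (S (bvec j) \<odot> bvec i))" by (simp add: sum_UNIV_prod)
  also have "\<dots> = (\<Sum>j\<in>UNIV. \<Sum>i\<in>UNIV. scl (\<Delta> x (i,j)) (S (bvec j) \<odot> bvec i))" by (rule sum.swap)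
  also have "\<dots> = (\<Sum>p\<in>UNIV. scl (\<Delta> x p) (S (bvec (fst p)) \<odot> bvec (snd p)))"
    unfolding sum_UNIV_prod by (intro sum.cong refl) (simp add: comul_commute)
  finally show ?thesis by (simp only: antipode_left)
qed

text \<open>Multiplication by \<open>L h f\<close> is, by \<open>L_star_antipode\<close>, the sum of
  the composites of \<open>h\<^sub>1\<close>, multiplication by \<open>f\<close>, and
  \<open>S(h\<^sub>2)\<close>. Under the trace \<open>h\<^sub>1\<close> moves to the other end,
  where it meets \<open>S(h\<^sub>2)\<close> and collapses to the counit of
  \<open>h\<close>.\<close>

lemma ftrace_L: "ftrace (star c (L h f)) = pair h e * ftrace (star c f)"
proof -
  have M: "flinear (\<lambda>v. f \<star> L x v)" for x by (rule flinearI) (simp_all add: L_linear star_linear)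
  have "ftrace (star c (L h f))
    = (\<Sum>i\<in>UNIV. \<Sum>p\<in>UNIV. \<Delta> h p * L (bvec (fst p)) (f \<star> L (S (bvec (snd p))) (bvec i)) i)"
    by (simp add: ftrace_def L_star_antipode fapply)
  also have "\<dots> = (\<Sum>p\<in>UNIV. \<Delta> h p * ftrace (\<lambda>v. L (bvec (fst p)) (f \<star> L (S (bvec (snd p))) v)))"
    unfolding ftrace_def sum_distrib_left by (rule sum.swap)
  also have "\<dots> = (\<Sum>p\<in>UNIV. \<Delta> h p * ftrace (\<lambda>v. f \<star> L (S (bvec (snd p)) \<odot> bvec (fst p)) v))"
    by (simp add: ftrace_commute[OF flinear_L M] L_L)
  also have "\<dots> = (\<Sum>i\<in>UNIV. \<Sum>p\<in>UNIV. \<Delta> h p * (f \<star> L (S (bvec (snd p)) \<odot> bvec (fst p)) (bvec i)) i)"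
    unfolding ftrace_def sum_distrib_left by (rule sum.swap)
  also have "\<dots> = ftrace (\<lambda>v. f \<star> L (\<Sum>p\<in>UNIV. scl (\<Delta> h p) (S (bvec (snd p)) \<odot> bvec (fst p))) v)"
    by (simp add: ftrace_def L_linear star_linear fapply)
  also have "\<dots> = pair h e * ftrace (star c f)"
    by (simp add: antipode_left' L_linear L_one star_linear ftrace_def fapply sum_distrib_left)
  finally show ?thesis .
qed

text \<open>The hypothesis says that \<open>e0\<close> is an integral of the dual algebra normalised
  to counit 1, as in Maschke's theorem. It recovers the values of a functional from traces, and
  traces of multiplication by square-zero elements vanish.\<close>

lemma reduced_if_integral:
  assumes e0: "pair u e0 = 1" "\<And>a. a \<in> aug UNIV \<Longrightarrow> a \<star> e0 = 0" and f: "pw f n = 0"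
  shows "f = 0"
proof -
  have int: "f \<star> e0 = scl (pair u f) e0" for f
    using e0(2)[OF aug_part[OF subbialg_UNIV UNIV_I], of f] by (simp add: star_linear star_one_left)
  have tr0: "ftrace (star c e0) = 1"
  proof -
    \<comment> \<open>Multiplication by \<open>e0\<close> has rank one, and its trace is the counit
      of \<open>e0\<close>.\<close>
    have "e0 \<star> bvec i = scl (u i) e0" for i using int[of "bvec i"] by (simp add: star_commute)
    then show ?thesis using e0(1) by (simp add: ftrace_def fapply pair_def)
  qed
  have sq: "g = 0" if g: "g \<star> g = 0" for g
  proof -
    have "ftrace (star c (g \<star> r)) = 0" for r
    proof (rule ftrace_square_zero[OF flinear_star_left])
      fix v
      have "g \<star> r \<star> (g \<star> r \<star> v) = (g \<star> g) \<star> (r \<star> (r \<star> v))" by (simp only: star_ac)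
      then show "g \<star> r \<star> (g \<star> r \<star> v) = 0" by (simp add: g)
    qed
    note tr = this
    have "pair h g = 0" for h
    proof -
      \<comment> \<open>Multiplication by the left side has trace \<open>pair h g\<close>. On the
        right side, invariance of the trace removes the translations, and what remains are traces of
        multiples of \<open>g\<close>, which are 0 by \<open>tr\<close>.\<close>
      have "scl (pair h g) e0 = L h g \<star> e0" by (simp add: int counit_L)
      also have "\<dots> = (\<Sum>p\<in>UNIV. scl (\<Delta> h p) (L (bvec (fst p)) (g \<star> L (S (bvec (snd p))) e0)))"
        by (rule L_star_antipode)
      finally have *: "star c (scl (pair h g) e0)
        = star c (\<Sum>p\<in>UNIV. scl (\<Delta> h p) (L (bvec (fst p)) (g \<star> L (S (bvec (snd p))) e0)))" by simp
      have "pair h g = ftrace (star c (scl (pair h g) e0))"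
        using tr0 by (simp add: ftrace_def star_linear fapply sum_distrib_left[symmetric])
      also have "\<dots> = (\<Sum>i\<in>UNIV. \<Sum>p\<in>UNIV. \<Delta> h p * (L (bvec (fst p)) (g \<star> L (S (bvec (snd p))) e0) \<star> bvec i) i)"
        unfolding * by (simp add: ftrace_def star_linear fapply)
      also have "\<dots> = (\<Sum>p\<in>UNIV. \<Delta> h p * ftrace (star c (L (bvec (fst p)) (g \<star> L (S (bvec (snd p))) e0))))"
        unfolding ftrace_def sum_distrib_left by (rule sum.swap)
      also have "\<dots> = 0" by (simp add: ftrace_L tr)
      finally show ?thesis .
    qed
    then show ?thesis by (intro pair_eqI) (simp add: pair_linear)
  qed
  show ?thesis
  proof (rule ccontr)
    assume f0: "f \<noteq> 0"
    have L: "pw f (LEAST n. pw f n = 0) = 0" using f by (rule LeastI)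
    have "e \<noteq> 0" using counit_one by (auto simp: pair_linear)
    then obtain k where k: "(LEAST n. pw f n = 0) = Suc k" using L by (cases "LEAST n. pw f n = 0") auto
    have "k \<noteq> 0" using L k f0 by (auto simp: star_one_right)
    then obtain l where l: "k = Suc l" by (cases k) auto
    \<comment> \<open>With \<open>Suc k\<close> the least vanishing exponent and
      \<open>k \<ge> 1\<close>, twice \<open>k\<close> is at least \<open>Suc k\<close>, so the
      square of \<open>pw f k\<close> vanishes.\<close>
    have "pw f k \<star> pw f k = pw f (Suc k + l)" by (simp only: pw_add[symmetric]) (simp add: l)
    also have "\<dots> = 0" using L unfolding k pw_add by simp
    finally have "pw f k = 0" by (rule sq)
    then show False using not_less_Least[of k "\<lambda>n. pw f n = 0"] k by simp
  qed
qed

text \<open>If the nilpotent derivation \<open>D\<close> attached to \<open>y\<close> is nonzero,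
  there is \<open>g\<close> such that \<open>w = D g\<close> is killed by \<open>D\<close> and has
  nonzero counit. Then \<open>D\<close> applied \<open>n\<close> times to the \<open>n\<close>-th
  power of \<open>g\<close> gives \<open>n!\<close> times the \<open>n\<close>-th power of
  \<open>w\<close>, which is never 0 in characteristic 0.\<close>

lemma prim_trivial_char_0:
  assumes char0: "\<And>n. n > 0 \<Longrightarrow> of_nat n \<noteq> (0::'k)" and nil: "nilp UNIV" and y: "y \<in> prim UNIV"
  shows "y = 0"
proof (rule ccontr)
  assume "y \<noteq> 0"
  define D where "D = R y"
  have D: "deriv_on UNIV D" unfolding D_def by (rule deriv_on_R[OF subbialg_UNIV y])
  note lin = deriv_on_linear[OF D]
  have lin_n: "flinear (D ^^ n)" for n
    by (induction n) (auto intro!: flinearI simp: flinear_add[OF lin] flinear_scl[OF lin] flinear_add flinear_scl)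
  obtain T d where T: "T 0 \<subseteq> {0}" "UNIV \<subseteq> T d" "\<forall>i::nat. \<forall>h\<in>prim UNIV. \<forall>f\<in>T (Suc i). R h f \<in> T i"
    using nil by (auto simp: nilp_def)
  have "f \<in> T i \<Longrightarrow> (D ^^ i) f = 0" for f i
    using T(1,3) y by (induction i arbitrary: f) (auto simp: D_def funpow_Suc_right simp del: funpow.simps)
  then have d: "(D ^^ d) f = 0" for f using T(2) by auto
  define P where "P i \<longleftrightarrow> (\<forall>f. (D ^^ i) f = 0)" for i
  have "P d" using d by (simp add: P_def)
  then have LP: "P (LEAST i. P i)" by (rule LeastI)
  have nP: "\<not> P i" if "i < (LEAST i. P i)" for i using that by (rule not_less_Least)
  have "e \<noteq> 0" using counit_one by (auto simp: pair_linear)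
  then have "\<not> P 0" by (auto simp: P_def)
  moreover have "\<not> P (Suc 0)"
  proof
    assume "P (Suc 0)"
    then have "pair y f = 0" for f using counit_R[of y f] by (simp add: P_def D_def pair_linear)
    then have "y = 0" by (metis pair_0_right pair_commute pair_eqI)
    then show False using \<open>y \<noteq> 0\<close> by simp
  qed
  ultimately obtain k where k: "(LEAST i. P i) = Suc (Suc k)"
    using LP by (metis not0_implies_Suc)
  obtain f0 where f0: "(D ^^ Suc k) f0 \<noteq> 0" using nP[of "Suc k"] k by (auto simp: P_def)
  \<comment> \<open>\<open>D\<close> commutes with \<open>L\<close>, so replacing \<open>f0\<close>
    by its translate under \<open>x\<close> moves the nonvanishing to the identity, where the counit
    is taken.\<close>
  obtain x where x: "pair x ((D ^^ Suc k) f0) \<noteq> 0"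
    using f0 by (metis pair_0_right pair_eqI)
  have DL: "(D ^^ i) (L x f) = L x ((D ^^ i) f)" for i f
    by (induction i) (auto simp: D_def L_R)
  define g where "g = (D ^^ k) (L x f0)"
  define w where "w = D g"
  have w: "pair u w \<noteq> 0" using x DL[of "Suc k" f0] by (simp add: w_def g_def counit_L)
  have Dw: "D w = 0" using LP k by (simp add: P_def w_def g_def)
  have Dg: "(D ^^ n) (pw w a \<star> pw g n) = scl (of_nat (fact n)) (pw w (a + n))" for n a
  proof (induction n arbitrary: a)
    case 0
    then show ?case by (simp add: star_one_right)
  next
    case (Suc n)
    have "D (pw w a \<star> pw g (Suc n)) = scl (of_nat (Suc n)) (pw w (Suc a) \<star> pw g n)"
      by (simp add: deriv_on_star[OF D] deriv_on_pw[OF subbialg_UNIV D] Dw w_def[symmetric] star_linear star_ac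
          del: spow.simps of_nat_Suc) (simp add: star_ac)
    then have "(D ^^ Suc n) (pw w a \<star> pw g (Suc n)) = (D ^^ n) (scl (of_nat (Suc n)) (pw w (Suc a) \<star> pw g n))"
      by (simp add: funpow_Suc_right del: funpow.simps)
    also have "\<dots> = scl (of_nat (Suc n)) (scl (of_nat (fact n)) (pw w (Suc a + n)))"
      by (simp only: flinear_scl[OF lin_n] Suc)
    also have "\<dots> = scl (of_nat (fact (Suc n))) (pw w (a + Suc n))"
      by (simp only: fv.scale_scale of_nat_mult[symmetric] fact_Suc add_Suc add_Suc_right of_nat_id)
    finally show ?case .
  qed
  have "scl (of_nat (fact d)) (pw w d) = 0" using Dg[of d 0] d by (simp add: star_one_left)
  then have "pair u (scl (of_nat (fact d)) (pw w d)) = 0" by (simp only: pair_0_right)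
  moreover have "pair u (pw w d) \<noteq> 0"
    by (induction d) (use w counit_one in \<open>auto simp: counit_star\<close>)
  moreover have "of_nat (fact d) \<noteq> (0::'k)" using char0[of "fact d"] by simp
  ultimately show False by (simp add: pair_linear)
qed

text \<open>There are no nonzero tangent vectors, so the augmentation ideal equals its square and
  hence lies in each of its powers. The localising element \<open>e0\<close>, killed by one such
  power, is then an integral of counit 1.\<close>

lemma reduced_char_0:
  assumes char0: "\<And>n. n > 0 \<Longrightarrow> of_nat n \<noteq> (0::'k)" and nil: "nilp UNIV" and f: "pw f n = 0"
  shows "f = 0"
proof -
  note Q = subbialg_UNIV
  obtain J y where J: "J \<subseteq> aug UNIV" "\<forall>b\<in>J. y b \<in> prim UNIV"
    "\<forall>b\<in>J. \<forall>b'\<in>J. pair (y b) b' = (if b = b' then 1 else 0)"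
    "\<forall>g\<in>aug UNIV. g - (\<Sum>b\<in>J. scl (pair (y b) g) b) \<in> ipow UNIV 2"
    by (rule tangent_basis[OF Q])
  have "J = {}"
  proof (rule ccontr)
    assume "J \<noteq> {}"
    then obtain b where b: "b \<in> J" by blast
    then have "y b = 0" using prim_trivial_char_0[OF char0 nil] J(2) by auto
    then have "pair (y b) b = 0" by (simp add: pair_linear)
    moreover have "pair (y b) b = 1" using J(3) b by simp
    ultimately show False by simp
  qed
  then have two: "aug UNIV \<subseteq> ipow UNIV 2" using J(4) by auto
  have "aug UNIV \<subseteq> ipow UNIV (Suc n)" for n
  proof (induction n)
    case 0
    then show ?case using aug_ipow[OF _ UNIV_I] by blast
  next
    case (Suc n)
    have "ipow UNIV 2 \<subseteq> ipow UNIV (Suc (Suc n))"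
      using Suc ipow_1_aug[OF Q] unfolding numeral_2_eq_2 ipow.simps(2)[of UNIV "Suc _"]
      by (intro fv.span_mono) blast
    then show ?case using two by blast
  qed
  moreover obtain e0 N where "pair u e0 = 1" "\<And>b. b \<in> ipow UNIV N \<Longrightarrow> b \<star> e0 = 0"
    by (rule local_unit_exists[OF Q]) blast
  ultimately show ?thesis using reduced_if_integral[OF _ _ f, of e0] ipow_Suc_sub[OF Q, of N] by blast
qed

subsection \<open>The coradical\<close>

text \<open>The coregular action of the dual algebra on \<open>H\<close>: in Sweedler notation
  \<open>C f x\<close> is \<open>x\<^sub>1\<close> scaled by the value of \<open>f\<close> at
  \<open>x\<^sub>2\<close>.\<close>

definition C :: "('n \<Rightarrow> 'k) \<Rightarrow> ('n \<Rightarrow> 'k) \<Rightarrow> ('n \<Rightarrow> 'k)" where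
  "C f x = (\<lambda>i. pair x (bvec i \<star> f))"

lemma pair_C: "pair (C f x) g = pair x (g \<star> f)"
proof -
  have "pair x (g \<star> f) = pair x ((\<Sum>i\<in>UNIV. scl (g i) (bvec i)) \<star> f)" by (simp only: bvec_expand[symmetric])
  also have "\<dots> = (\<Sum>i\<in>UNIV. C f x i * g i)"
    by (simp only: star_linear pair_linear C_def mult.commute)
  finally show ?thesis by (simp only: pair_def[of "C f x"])
qed

lemma C_eqI: "(\<And>g. pair x g = pair y g) \<Longrightarrow> x = y"
  by (rule pair_eqI) (metis pair_commute)

lemma flinear_C: "flinear (C f)"
  by (rule flinearI; rule C_eqI) (simp_all add: pair_C pair_linear)

lemma C_C: "C f (C g x) = C (f \<star> g) x"
  by (rule C_eqI) (simp add: pair_C star_assoc)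

lemma comul_pair: "\<Delta> x (i,j) = pair x (bvec i \<star> bvec j)"
  by (simp add: star_bvec pair_def hcomul_def)

lemma C_bvec: "C (bvec j) x = (\<lambda>i. \<Delta> x (i,j))"
  by (simp add: C_def comul_pair)

text \<open>Subcoalgebras are the submodules for \<open>C\<close>. The columns of the
  comultiplication of \<open>x\<close> are the elements \<open>C (bvec j) x\<close>, and
  cocommutativity makes the rows equal to the columns.\<close>

lemma subcoalgebra_iff:
  "subcoalgebra c D \<longleftrightarrow> fv.subspace D \<and> (\<forall>f. \<forall>x\<in>D. C f x \<in> D)"
proof
  assume D: "subcoalgebra c D"
  then have sub: "fv.subspace D" by (simp add: subcoalgebra_def ksubspace_eq)
  have "C f x \<in> D" if "x \<in> D" for f x
  proof -
    have b: "C (bvec j) x \<in> D" for j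
      unfolding C_bvec using D that by (intro tens_sub_slices(1)[OF sub sub]) (simp add: subcoalgebra_def)
    have "C f x = (\<Sum>j\<in>UNIV. scl (f j) (C (bvec j) x))"
    proof (rule C_eqI)
      fix g
      have "pair x (g \<star> f) = pair x (g \<star> (\<Sum>j\<in>UNIV. scl (f j) (bvec j)))" by (simp only: bvec_expand[symmetric])
      then show "pair (C f x) g = pair (\<Sum>j\<in>UNIV. scl (f j) (C (bvec j) x)) g"
        by (simp only: pair_C star_linear pair_linear)
    qed
    then show ?thesis using b by (simp add: fv.subspace_sum[OF sub] fv.subspace_scale[OF sub])
  qed
  then show "fv.subspace D \<and> (\<forall>f. \<forall>x\<in>D. C f x \<in> D)" using sub by blast
next
  assume D: "fv.subspace D \<and> (\<forall>f. \<forall>x\<in>D. C f x \<in> D)"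
  have "\<Delta> x \<in> tens_sub D D" if "x \<in> D" for x
  proof (rule tens_sub_if_slices)
    show col: "(\<lambda>i. \<Delta> x (i,j)) \<in> D" for j using D that by (simp add: C_bvec[symmetric])
    show "(\<lambda>j. \<Delta> x (i,j)) \<in> D" for i using col[of i] by (simp add: comul_commute[of x i])
  qed (use D in auto)
  then show "subcoalgebra c D" using D by (simp add: subcoalgebra_def ksubspace_eq)
qed

lemma subspace_coradical: "fv.subspace (coradical c)"
  by (simp add: coradical_def kspan_eq)

lemma simple_sub_coradical: "simple_subcoalgebra c D \<Longrightarrow> x \<in> D \<Longrightarrow> x \<in> coradical c"
  unfolding coradical_def kspan_eq by (rule fv.span_base) blast

text \<open>If \<open>f\<close> is not nilpotent, it acts injectively on some nonzero subcomodule of \<open>H\<close>, hence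
  does not vanish on a simple subcoalgebra contained in it.\<close>

lemma nilpotent_if_perp_coradical:
  assumes f: "\<And>x. x \<in> coradical c \<Longrightarrow> pair x f = 0"
  shows "\<exists>n. pw f n = 0"
proof (rule ccontr)
  assume "\<not> ?thesis"
  then have nz: "pw f n \<noteq> 0" for n by auto
  \<comment> \<open>As in Fitting's lemma, the images of the powers of \<open>f\<close> decrease;
    the smallest one is mapped by \<open>C f\<close> onto itself, hence injectively.\<close>
  define P where "P V \<longleftrightarrow> (\<exists>n. V = range (C (pw f n)))" for V
  have "P (range (C (pw f 0)))" unfolding P_def by blast
  then obtain V where PV: "P V"
    and Vmin: "\<And>U'. P U' \<Longrightarrow> fv.subspace V \<Longrightarrow> fv.subspace U' \<Longrightarrow> U' \<subseteq> V \<Longrightarrow> U' = V"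
    using finite_dim_min[of P] by metis
  then obtain n where n: "V = range (C (pw f n))" by (auto simp: P_def)
  have sub: "fv.subspace (range (C g))" for g by (rule subspace_flinear_image[OF flinear_C fv.subspace_UNIV])
  have "C (pw f (Suc n)) x \<in> V" for x
    using C_C[of "pw f n" f x] unfolding n by (simp add: star_commute) (metis rangeI)
  then have "range (C (pw f (Suc n))) \<subseteq> V" by blast
  moreover have "P (range (C (pw f (Suc n))))" unfolding P_def by blast
  ultimately have eq: "range (C (pw f (Suc n))) = V"
    using Vmin sub n by simp
  have "C f ` V = range (C (pw f (Suc n)))"
    unfolding n by (simp add: image_image C_C)
  then have surj: "C f ` V = V" using eq by simp
  obtain x where "pair x (pw f n) \<noteq> 0" using nz[of n] by (metis pair_0_right pair_eqI)
  then have "pair (C (pw f n) x) e \<noteq> 0" by (simp add: pair_C star_one_left)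
  then have "C (pw f n) x \<noteq> 0" by (auto simp: pair_linear)
  moreover have "C (pw f n) x \<in> V" using n by simp
  ultimately have V0: "V \<noteq> {0}" by blast
  have Vstab: "C g x \<in> V" if x: "x \<in> V" for g x
  proof -
    obtain z where "x = C (pw f n) z" using x n by auto
    then have "C g x = C (pw f n) (C g z)" by (simp add: C_C star_commute)
    then show ?thesis using n by simp
  qed
  define P' where "P' D \<longleftrightarrow> subcoalgebra c D \<and> D \<noteq> {0} \<and> D \<subseteq> V" for D
  have "P' V" using sub V0 Vstab n by (auto simp: P'_def subcoalgebra_iff)
  then obtain D where D: "P' D"
    and Dmin: "\<And>U'. P' U' \<Longrightarrow> fv.subspace D \<Longrightarrow> fv.subspace U' \<Longrightarrow> U' \<subseteq> D \<Longrightarrow> U' = D"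
    using finite_dim_min[of P'] by metis
  have D': "subcoalgebra c D" "D \<noteq> {0}" "D \<subseteq> V" using D by (auto simp: P'_def)
  have sub_of: "fv.subspace E" if "subcoalgebra c E" for E using that by (simp add: subcoalgebra_iff)
  have "E = {0} \<or> E = D" if E: "subcoalgebra c E" "E \<subseteq> D" for E
    using Dmin[OF _ sub_of[OF D'(1)] sub_of[OF E(1)] E(2)] E D'(3) by (auto simp: P'_def)
  then have "simple_subcoalgebra c D"
    unfolding simple_subcoalgebra_def using D' by simp
  note cor = simple_sub_coradical[OF this]
  obtain x where x: "x \<in> D" "x \<noteq> 0" using D'(2) fv.subspace_0[OF sub_of[OF D'(1)]] by blast
  \<comment> \<open>Pairing \<open>C f x\<close> with \<open>g\<close> is evaluating
    \<open>f\<close> on \<open>C g x\<close>, an element of \<open>D\<close> and so of the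
    coradical.\<close>
  have "C f x = 0"
  proof (rule C_eqI)
    fix g
    have "C g x \<in> D" using D'(1) x by (simp add: subcoalgebra_iff)
    then show "pair (C f x) g = pair 0 g"
      using f[OF cor, of "C g x"] by (simp add: pair_C star_commute pair_linear)
  qed
  moreover have "fv.subspace V" using n sub by simp
  ultimately have "x = 0" using flinear_surj_on_inj[OF flinear_C _ surj] x D'(3) by blast
  then show False using x by simp
qed

text \<open>The unit is grouplike, so its multiples form a one-dimensional subcoalgebra, which is
  simple.\<close>

lemma unit_in_coradical: "u \<in> coradical c"
proof (rule simple_sub_coradical)
  let ?D = "range (\<lambda>a. scl a u)"
  have lin: "C f (scl a u) = scl (a * pair u f) u" for f a
    by (rule C_eqI) (simp add: pair_C pair_linear counit_star mult_ac)
  have "u \<noteq> 0" using counit_one by (auto simp: pair_linear)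
  show "u \<in> ?D" by (rule image_eqI[of _ _ 1]) simp_all
  have "fv.subspace ?D"
    by (rule fv.subspaceI) (auto simp: fv.scale_left_distrib[symmetric] intro: image_eqI[of _ _ 0])
  then have "subcoalgebra c ?D" by (auto simp: subcoalgebra_iff lin)
  moreover have "D = {0} \<or> D = ?D" if D: "subcoalgebra c D" "D \<subseteq> ?D" for D
  proof (cases "D = {0}")
    case False
    have sD: "fv.subspace D" using D by (simp add: subcoalgebra_iff)
    then obtain x where x: "x \<in> D" "x \<noteq> 0" using False fv.subspace_0 by blast
    then obtain a where a: "x = scl a u" using D by auto
    then have "scl (b / a) x = scl b u" for b using x(2) by auto
    then have "?D \<subseteq> D" using fv.subspace_scale[OF sD x(1)] by (metis image_subset_iff)
    then show ?thesis using D by auto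
  qed simp
  moreover have "?D \<noteq> {0}" using \<open>u \<noteq> 0\<close> \<open>u \<in> ?D\<close> by auto
  ultimately show "simple_subcoalgebra c ?D" by (auto simp: simple_subcoalgebra_def)
qed

lemma tens_sub_mono: "V \<subseteq> V' \<Longrightarrow> W \<subseteq> W' \<Longrightarrow> tens_sub V W \<subseteq> tens_sub V' W'"
  unfolding tens_sub_def kspan_eq by (intro fv.span_mono) blast

text \<open>The comultiplication maps each simple subcoalgebra \<open>D\<close> into the tensor
  square of \<open>D\<close>, and so already into the first of the two summands that define
  \<open>coradical_one c\<close>.\<close>

lemma coradical_sub_one: "coradical c \<subseteq> coradical_one c"
proof -
  let ?A = "tens_sub UNIV (coradical c)" and ?B = "tens_sub (coradical c) UNIV"
  have z: "0 \<in> ?B" by (simp add: tens_sub_def kspan_eq fv.span_zero)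
  have sA: "fv.subspace ?A" by (simp add: tens_sub_def kspan_eq)
  have "x \<in> coradical_one c \<and> \<Delta> x \<in> ?A" if "x \<in> coradical c" for x
  proof -
    have "\<Delta> x \<in> ?A" using that unfolding coradical_def kspan_eq
    proof (induction rule: fv.span_induct_alt)
      case base
      have "\<Delta> 0 = 0" using hcomul_scl[of c 0 0] by simp
      then show ?case using fv.subspace_0[OF sA] by (simp add: coradical_def kspan_eq)
    next
      case (step t x y)
      then obtain D where D: "simple_subcoalgebra c D" "x \<in> D" by blast
      then have "\<Delta> x \<in> tens_sub D D" by (simp add: simple_subcoalgebra_def subcoalgebra_def)
      also have "\<dots> \<subseteq> ?A" using simple_sub_coradical[OF D(1)] by (intro tens_sub_mono) auto
      finally show ?case using step(2) fv.subspace_add[OF sA fv.subspace_scale[OF sA]]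
        by (simp add: hcomul_add hcomul_scl coradical_def kspan_eq)
    qed
    moreover have "\<Delta> x = \<Delta> x + 0" by simp
    ultimately show ?thesis using z unfolding coradical_one_def by blast
  qed
  then show ?thesis by blast
qed

lemma prim_sub_coradical_one: "prim UNIV \<subseteq> coradical_one c"
proof
  fix y assume y: "y \<in> prim UNIV"
  have "\<Delta> y = tensor y u + tensor u y"
    by (auto simp: fun_eq_iff fapply tensor_def comul_pair prim_pair_star[OF subbialg_UNIV y])
  moreover have "tensor y u \<in> tens_sub UNIV (coradical c)" "tensor u y \<in> tens_sub (coradical c) UNIV"
    unfolding tens_sub_def kspan_eq using unit_in_coradical by (auto intro!: fv.span_base)
  ultimately show "y \<in> coradical_one c" unfolding coradical_one_def by blast
qed

subsection \<open>Local subalgebras\<close>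

text \<open>Left multiplication by \<open>b\<close> is injective and therefore onto by finite
  dimension; the right inverse so obtained equals \<open>b'\<close>.\<close>

lemma left_inverse_two_sided: assumes "b' \<odot> b = u" shows "b \<odot> b' = u"
proof -
  have lin: "flinear (\<lambda>x. b \<odot> x)" by (rule flinearI) (simp_all add: hmul_linear)
  have "(\<lambda>x. b \<odot> x) ` UNIV = UNIV"
  proof (rule flinear_inj_on_surj[OF lin fv.subspace_UNIV subset_UNIV])
    show "x = 0" if "b \<odot> x = 0" for x
    proof -
      have "b' \<odot> (b \<odot> x) = x" by (simp add: mult_assoc[symmetric] assms mult_one_left)
      then show ?thesis by (simp add: that)
    qed
  qed
  then obtain y where y: "b \<odot> y = u" by (metis surjD)
  have "b' = b' \<odot> (b \<odot> y)" by (simp add: y mult_one_right)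
  also have "\<dots> = y" by (simp add: mult_assoc[symmetric] assms mult_one_left)
  finally show ?thesis using y by simp
qed

lemma
  assumes "subalgebra m u B"
  shows subalgebra_subspace: "fv.subspace B" and subalgebra_u: "u \<in> B"
    and subalgebra_mult: "x \<in> B \<Longrightarrow> y \<in> B \<Longrightarrow> x \<odot> y \<in> B"
  using assms by (auto simp: subalgebra_def ksubspace_eq)

lemma subspace_left_ideal:
  assumes B: "subalgebra m u B" and I: "left_ideal m B I"
  shows "fv.subspace I"
proof (rule fv.subspaceI)
  show "0 \<in> I" "\<And>x y. x \<in> I \<Longrightarrow> y \<in> I \<Longrightarrow> x + y \<in> I" using I by (auto simp: left_ideal_def)
  fix a x assume "x \<in> I"
  moreover have "scl a u \<in> B" by (intro fv.subspace_scale subalgebra_subspace subalgebra_u B)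
  ultimately have "scl a u \<odot> x \<in> I" using I by (simp add: left_ideal_def)
  then show "scl a x \<in> I" by (simp add: hmul_linear mult_one_left)
qed

lemma left_idealI:
  assumes "fv.subspace I" "I \<subseteq> B" "\<And>a x. a \<in> B \<Longrightarrow> x \<in> I \<Longrightarrow> a \<odot> x \<in> I"
  shows "left_ideal m B I"
  using assms fv.subspace_0 fv.subspace_add fv.subspace_neg by (auto simp: left_ideal_def)

lemma left_ideal_augmentation:
  assumes B: "subalgebra m u B"
  shows "left_ideal m B {b \<in> B. pair b e = 0}"
  using subalgebra_subspace[OF B] subalgebra_mult[OF B]
  by (intro left_idealI) (auto simp: fv.subspace_def pair_linear counit_mult)

text \<open>The kernel \<open>I0\<close> of the counit in \<open>B\<close> is always a maximal left
  ideal. It is the only one exactly when no element outside it generates a proper left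
  ideal.\<close>

lemma local_algebra_iff:
  assumes B: "subalgebra m u B"
  shows "local_algebra m B \<longleftrightarrow> (\<forall>b\<in>B. pair b e \<noteq> 0 \<longrightarrow> (\<exists>b'\<in>B. b' \<odot> b = u))"
proof
  define I0 where "I0 = {b \<in> B. pair b e = 0}"
  have I0: "left_ideal m B I0" unfolding I0_def by (rule left_ideal_augmentation[OF B])
  note sB = subalgebra_subspace[OF B] and uB = subalgebra_u[OF B]
  have "u \<notin> I0" by (simp add: I0_def counit_one)
  then have I0B: "I0 \<noteq> B" using uB by blast
  have whole: "J = B" if J: "left_ideal m B J" and uJ: "u \<in> J" for J
  proof -
    have "b \<odot> u \<in> J" if "b \<in> B" for b using J uJ that by (simp add: left_ideal_def)
    then show ?thesis using J by (auto simp: left_ideal_def mult_one_right)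
  qed
  {
    assume inv: "\<forall>b\<in>B. pair b e \<noteq> 0 \<longrightarrow> (\<exists>b'\<in>B. b' \<odot> b = u)"
    have sub: "J \<subseteq> I0" if J: "left_ideal m B J" and JB: "J \<noteq> B" for J
    proof
      fix b assume b: "b \<in> J"
      then have bB: "b \<in> B" using J by (auto simp: left_ideal_def)
      have "pair b e = 0"
      proof (rule ccontr)
        assume "pair b e \<noteq> 0"
        then obtain b' where "b' \<in> B" "b' \<odot> b = u" using inv bB by blast
        moreover have "a \<odot> x \<in> J" if "a \<in> B" "x \<in> J" for a x
          using J that by (simp add: left_ideal_def)
        ultimately have "u \<in> J" using b by metis
        then show False using whole[OF J] JB by simp
      qed
      then show "b \<in> I0" using bB by (simp add: I0_def)
    qed
    have "maximal_left_ideal m B I0"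
      unfolding maximal_left_ideal_def using I0 I0B sub by (metis subset_antisym)
    moreover have "I = I0" if "maximal_left_ideal m B I" for I
      using that sub[of I] I0 I0B unfolding maximal_left_ideal_def by metis
    ultimately show "local_algebra m B" unfolding local_algebra_def by (rule ex1I)
  next
    assume loc: "local_algebra m B"
    have "maximal_left_ideal m B I0"
      unfolding maximal_left_ideal_def
    proof (intro conjI allI impI)
      show "left_ideal m B I0" "I0 \<noteq> B" by (fact I0 I0B)+
      fix J assume "left_ideal m B J \<and> I0 \<subseteq> J \<and> J \<noteq> B"
      then have J: "left_ideal m B J" "I0 \<subseteq> J" "J \<noteq> B" by auto
      have "b \<in> I0" if b: "b \<in> J" for b
      proof (rule ccontr)
        have bB: "b \<in> B" using b J(1) by (auto simp: left_ideal_def)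
        assume "b \<notin> I0"
        then have nz: "pair b e \<noteq> 0" using bB by (simp add: I0_def)
        \<comment> \<open>\<open>I0\<close> has codimension one: this combination of
          \<open>u\<close> and \<open>b\<close> has counit 0, so a left ideal containing both
          \<open>I0\<close> and \<open>b\<close> contains \<open>u\<close>.\<close>
        define z where "z = u - scl (1 / pair b e) b"
        have "z \<in> B" unfolding z_def by (intro fv.subspace_diff[OF sB uB] fv.subspace_scale[OF sB bB])
        moreover have "pair z e = 0" using nz by (simp add: z_def pair_linear counit_one)
        ultimately have "z \<in> J" using J(2) by (auto simp: I0_def)
        moreover note sJ = subspace_left_ideal[OF B J(1)]
        ultimately have "z + scl (1 / pair b e) b \<in> J"
          using fv.subspace_add[OF sJ _ fv.subspace_scale[OF sJ b]] by blast
        then show False using whole[OF J(1)] J(3) by (simp add: z_def)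
      qed
      then show "J = I0" using J(2) by blast
    qed
    then have uniq: "I = I0" if "maximal_left_ideal m B I" for I
      using loc that unfolding local_algebra_def by (metis (no_types))
    show "\<forall>b\<in>B. pair b e \<noteq> 0 \<longrightarrow> (\<exists>b'\<in>B. b' \<odot> b = u)"
    proof (intro ballI impI, rule ccontr)
      fix b assume b: "b \<in> B" "pair b e \<noteq> 0" "\<not> (\<exists>b'\<in>B. b' \<odot> b = u)"
      \<comment> \<open>The left ideal generated by \<open>b\<close> is proper, as \<open>b\<close>
        has no left inverse in \<open>B\<close>. A proper left ideal of greatest dimension
        containing \<open>b\<close> is maximal, so it is \<open>I0\<close>, although
        \<open>b\<close> has nonzero counit.\<close>
      define P where "P J \<longleftrightarrow> left_ideal m B J \<and> J \<noteq> B \<and> b \<in> J" for J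
      have P0: "P ((\<lambda>x. x \<odot> b) ` B)"
        unfolding P_def
      proof (intro conjI left_idealI)
        have lin: "flinear (\<lambda>x. x \<odot> b)" by (rule flinearI) (simp_all add: hmul_linear)
        show "fv.subspace ((\<lambda>x. x \<odot> b) ` B)" by (rule subspace_flinear_image[OF lin sB])
        show "(\<lambda>x. x \<odot> b) ` B \<subseteq> B" using subalgebra_mult[OF B] b by auto
        show "(\<lambda>x. x \<odot> b) ` B \<noteq> B" using b(3) uB by (metis imageE)
        show "b \<in> (\<lambda>x. x \<odot> b) ` B" using uB mult_one_left by (metis image_eqI)
        show "a \<odot> x \<in> (\<lambda>x. x \<odot> b) ` B" if "a \<in> B" "x \<in> (\<lambda>x. x \<odot> b) ` B" for a x
          using that subalgebra_mult[OF B] by (auto simp: mult_assoc[symmetric])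
      qed
      have "\<forall>J. P J \<longrightarrow> fv.dim J < Suc (fv.dim B)"
        unfolding P_def left_ideal_def by (auto intro: fv.dim_subset simp: less_Suc_eq_le)
      from ex_has_greatest_nat[OF P0 this]
      obtain M where M: "P M" "\<forall>J. P J \<longrightarrow> fv.dim J \<le> fv.dim M" by blast
      have "maximal_left_ideal m B M"
        unfolding maximal_left_ideal_def
      proof (intro conjI allI impI)
        show "left_ideal m B M" "M \<noteq> B" using M by (auto simp: P_def)
        fix J assume J: "left_ideal m B J \<and> M \<subseteq> J \<and> J \<noteq> B"
        then have "P J" using M(1) by (auto simp: P_def)
        then show "J = M"
          using J M fv.subspace_dim_equal[OF subspace_left_ideal[OF B] subspace_left_ideal[OF B], of M J]
          by (auto simp: P_def)
      qed
      then show False using uniq[of M] M(1) b(2) by (auto simp: P_def I0_def)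
    qed
  }
qed

text \<open>An element of \<open>B\<close> that is invertible in the whole algebra acts injectively
  on \<open>B\<close> by right multiplication, hence surjectively, so it has a left inverse in
  \<open>B\<close> itself.\<close>

lemma local_subalgebra:
  assumes B: "subalgebra m u B" and loc: "local_algebra m UNIV"
  shows "local_algebra m B"
  unfolding local_algebra_iff[OF B]
proof (intro ballI impI)
  fix b assume b: "b \<in> B" "pair b e \<noteq> 0"
  have "subalgebra m u UNIV" by (simp add: subalgebra_def ksubspace_eq)
  from loc[unfolded local_algebra_iff[OF this]] b(2)
  obtain b' where b': "b' \<odot> b = u" by blast
  note bb' = left_inverse_two_sided[OF b']
  have lin: "flinear (\<lambda>x. x \<odot> b)" by (rule flinearI) (simp_all add: hmul_linear)
  have "(\<lambda>x. x \<odot> b) ` B = B"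
  proof (rule flinear_inj_on_surj[OF lin subalgebra_subspace[OF B]])
    show "(\<lambda>x. x \<odot> b) ` B \<subseteq> B" using subalgebra_mult[OF B] b by auto
    show "x = 0" if "x \<in> B" "x \<odot> b = 0" for x
    proof -
      have "x = x \<odot> b \<odot> b'" by (simp add: mult_assoc bb' mult_one_right)
      then show ?thesis using that by simp
    qed
  qed
  then show "\<exists>b'\<in>B. b' \<odot> b = u" using subalgebra_u[OF B] by (metis imageE)
qed

text \<open>For \<open>a\<close> in \<open>A\<close> of counit 0 the element \<open>u - a\<close> is
  invertible because \<open>A\<close> is local, and it annihilates every fixed vector of
  \<open>R a\<close>. The Engel-type lemma applies.\<close>

lemma socle_chain_local:
  assumes A: "subalgebra m u A" and loc: "local_algebra m A"
  shows "\<exists>d. socle_chain (R ` {a \<in> A. pair a e = 0}) UNIV d = UNIV"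
proof (rule socle_chain_exhausts)
  note sA = subalgebra_subspace[OF A]
  let ?I = "{a \<in> A. pair a e = 0}"
  let ?\<Phi> = "R ` ?I"
  have sI: "fv.subspace ?I" using sA by (auto simp: fv.subspace_def pair_linear)
  show "?\<Phi> \<noteq> {}" using fv.subspace_0[OF sI] by blast
  show "flinear \<phi>" if "\<phi> \<in> ?\<Phi>" for \<phi> using that flinear_R by auto
  show "t = 0" if \<phi>: "\<phi> \<in> ?\<Phi>" and fp: "\<phi> t = t" for \<phi> t
  proof -
    obtain a where a: "\<phi> = R a" "a \<in> A" "pair a e = 0" using \<phi> by auto
    have "u - a \<in> A" "pair (u - a) e \<noteq> 0"
      using a fv.subspace_diff[OF sA subalgebra_u[OF A]] by (auto simp: pair_linear counit_one)
    then obtain b where "b \<odot> (u - a) = u" using loc[unfolded local_algebra_iff[OF A]] by blast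
    then have "(u - a) \<odot> b = u" by (rule left_inverse_two_sided)
    then have "t = R b (R (u - a) t)" by (simp add: R_R R_one)
    also have "R (u - a) t = 0" using fp a by (simp add: R_linear R_one)
    finally show ?thesis by (simp add: R_linear)
  qed
  fix \<phi> \<psi> assume "\<phi> \<in> ?\<Phi>" "\<psi> \<in> ?\<Phi>"
  then obtain a b where ab: "\<phi> = R a" "\<psi> = R b" "a \<in> ?I" "b \<in> ?I" by blast
  have "(\<lambda>t. \<phi> t + \<psi> t) = R (a + b)" by (auto simp: ab R_linear)
  then show "(\<lambda>t. \<phi> t + \<psi> t) \<in> ?\<Phi>" using imageI[OF fv.subspace_add[OF sI ab(3,4)], of R] by simp
  have "(\<lambda>t. \<phi> (\<psi> t)) = R (b \<odot> a)" by (auto simp: ab R_R)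
  moreover have "b \<odot> a \<in> ?I" using ab subalgebra_mult[OF A] by (auto simp: counit_mult)
  ultimately show "(\<lambda>t. \<phi> (\<psi> t)) \<in> ?\<Phi>" using imageI[of "b \<odot> a" ?I R] by simp
next
  let ?I = "{a \<in> A. pair a e = 0}"
  fix \<phi> t assume "\<phi> \<in> R ` ?I"
  then obtain a where a: "\<phi> = R a" "a \<in> ?I" by blast
  have "(\<lambda>x. scl t (\<phi> x)) = R (scl t a)" by (auto simp: a R_linear)
  moreover have "scl t a \<in> ?I"
    using a fv.subspace_scale[OF subalgebra_subspace[OF A]] by (auto simp: pair_linear)
  ultimately show "(\<lambda>x. scl t (\<phi> x)) \<in> R ` ?I" using imageI[of "scl t a" ?I R] by simp
qed simp_all

lemma nilp_UNIV:
  assumes A: "subalgebra m u A" and loc: "local_algebra m A" and prim: "prim UNIV \<subseteq> A"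
  shows "nilp UNIV"
proof -
  let ?T = "socle_chain (R ` {a \<in> A. pair a e = 0}) UNIV"
  obtain d where d: "?T d = UNIV" using socle_chain_local[OF A loc] ..
  have "R h f \<in> ?T i" if "h \<in> prim UNIV" "f \<in> ?T (Suc i)" for h f i
    using that prim by (auto simp: prim_def)
  then show ?thesis
    unfolding nilp_def using d by (intro exI[of _ ?T] exI[of _ d]) auto
qed

text \<open>A reduced sub-bialgebra \<open>Q\<close> meets the annihilator of the coradical trivially, so every functional
  on \<open>Q\<close> is represented in the coradical.\<close>

lemma reduced_represented_in_coradical:
  assumes Q: "fv.subspace Q" and red: "\<And>f n. f \<in> Q \<Longrightarrow> pw f n = 0 \<Longrightarrow> f = 0"
  obtains a where "a \<in> coradical c" "\<forall>f\<in>Q. pair h f = pair a f"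
proof -
  define W where "W = {w. \<forall>f\<in>Q. pair w f = 0}"
  have W: "fv.subspace W" by (auto simp: W_def fv.subspace_def pair_linear)
  define U where "U = {x + y | x y. x \<in> coradical c \<and> y \<in> W}"
  have U: "fv.subspace U" unfolding U_def by (rule fv.subspace_sums[OF subspace_coradical W])
  have "h \<in> U"
  proof (rule ccontr)
    assume "h \<notin> U"
    then obtain f where f: "\<And>z. z \<in> U \<Longrightarrow> pair z f = 0" "pair h f \<noteq> 0"
      using separating_functional[OF U] by blast
    have "z \<in> U" if "z \<in> coradical c" for z
      using that fv.subspace_0[OF W] unfolding U_def by force
    then obtain n where n: "pw f n = 0" using nilpotent_if_perp_coradical f(1) by blast
    have fW: "pair z f = 0" if "z \<in> W" for z
      using that fv.subspace_0[OF subspace_coradical] f(1) unfolding U_def by force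
    \<comment> \<open>The double annihilator: \<open>f\<close> vanishes on the annihilator
      \<open>W\<close> of \<open>Q\<close>, and a functional separating \<open>f\<close> from
      \<open>Q\<close> would belong to \<open>W\<close>.\<close>
    have "f \<in> Q"
    proof (rule ccontr)
      assume "f \<notin> Q"
      then obtain g where g: "\<And>z. z \<in> Q \<Longrightarrow> pair z g = 0" "pair f g \<noteq> 0"
        using separating_functional[OF Q] by blast
      then have "g \<in> W" by (simp add: W_def pair_commute[of g])
      then show False using fW[of g] g(2) pair_commute[of f g] by simp
    qed
    then have "f = 0" using red n by blast
    then show False using f(2) by (simp add: pair_linear)
  qed
  then obtain a w where "h = a + w" "a \<in> coradical c" "w \<in> W" unfolding U_def by blast
  then show thesis using that by (auto simp: W_def pair_linear)
qed

text \<open>Inside \<open>V0\<close> take a minimal nonzero stable \<open>V\<close> and a reduced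
  \<open>Q\<close> containing it. Nilpotency provides a nonzero \<open>f\<close> in \<open>V\<close>
  killed by the part of \<open>A\<close> of counit 0; the coradical represents all of
  \<open>H\<close> on \<open>Q\<close>, so \<open>f\<close> is killed by every element of counit 0
  and is a multiple of \<open>e\<close>.\<close>

lemma stable_subspace_contains_e:
  assumes A: "subalgebra m u A" and loc: "local_algebra m A"
    and cor: "coradical c \<subseteq> A" and prim: "prim UNIV \<subseteq> A"
    and V0: "fv.subspace V0" "V0 \<noteq> {0}" "\<And>h f. f \<in> V0 \<Longrightarrow> R h f \<in> V0"
  shows "e \<in> V0"
proof -
  define P where "P V \<longleftrightarrow> fv.subspace V \<and> V \<noteq> {0} \<and> (\<forall>h. \<forall>f\<in>V. R h f \<in> V) \<and> V \<subseteq> V0" for V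
  have "P V0" using V0 by (auto simp: P_def)
  then obtain V where PV: "P V"
    and min: "\<And>U'. P U' \<Longrightarrow> fv.subspace V \<Longrightarrow> fv.subspace U' \<Longrightarrow> U' \<subseteq> V \<Longrightarrow> U' = V"
    using finite_dim_min[of P] by metis
  then have V: "fv.subspace V" "V \<noteq> {0}" "\<And>h f. f \<in> V \<Longrightarrow> R h f \<in> V" "V \<subseteq> V0" by (auto simp: P_def)
  have Vmin: "V' = V"
    if "fv.subspace V'" "V' \<noteq> {0}" "\<And>h f. f \<in> V' \<Longrightarrow> R h f \<in> V'" "V' \<subseteq> V" for V'
    using min[of V'] that V(1,4) by (auto simp: P_def)
  have nil: "nilp UNIV" by (rule nilp_UNIV[OF A loc prim])
  obtain Q where Q: "subbialg Q" "V \<subseteq> Q" and red: "\<And>f n. f \<in> Q \<Longrightarrow> pw f n = 0 \<Longrightarrow> f = 0"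
  proof (cases "CHAR('k) = 0")
    case True
    then have "of_nat n \<noteq> (0::'k)" if "n > 0" for n using that by (simp add: of_nat_eq_0_iff_char_dvd)
    from reduced_char_0[OF this nil] show thesis
      by (intro that[OF subbialg_UNIV subset_UNIV])
  next
    case False
    then have "prime CHAR('k)" by (intro prime_CHAR_semidom) simp
    then interpret hopf_char m u c e s "CHAR('k)" by unfold_locales simp_all
    show thesis by (rule reduced_envelope_char[OF nil V(1,2,3) Vmin]) (use that in blast)+
  qed
  let ?T = "socle_chain (R ` {a \<in> A. pair a e = 0}) UNIV"
  obtain d where d: "?T d = UNIV" using socle_chain_local[OF A loc] ..
  have "?T 0 \<subseteq> {0}" "V \<subseteq> ?T d" using d by simp_all
  then obtain f k where f: "f \<in> V" "f \<noteq> 0" "f \<in> ?T (Suc k)" "\<forall>g\<in>V. g \<in> ?T k \<longrightarrow> g = 0"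
    by (rule chain_first_meet[OF V(1,2)])
  have Ra: "R a f = 0" if "a \<in> A" "pair a e = 0" for a
    using f(3,4) V(3)[OF f(1)] that by simp
  have Rh: "R h f = 0" if h: "pair h e = 0" for h
  proof -
    obtain a where a: "a \<in> coradical c" "\<forall>f\<in>Q. pair h f = pair a f"
      by (rule reduced_represented_in_coradical[OF subbialg_subspace[OF Q(1)] red])
    \<comment> \<open>Both sides evaluate \<open>h\<close> and \<open>a\<close> on the translate
      \<open>L x f\<close>, which lies in \<open>Q\<close>, where the two agree.\<close>
    have "pair x (R h f) = pair x (R a f)" for x
    proof -
      have "L x f \<in> Q" using f(1) Q(2) subbialg_L[OF Q(1)] by blast
      then show ?thesis using bspec[OF a(2), of "L x f"] by (simp add: pair_L pair_R)
    qed
    then have "R h f = R a f" by (rule pair_eqI)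
    moreover have "pair a e = 0" using bspec[OF a(2) subbialg_e[OF Q(1)]] h by simp
    ultimately show ?thesis using Ra a(1) cor by auto
  qed
  \<comment> \<open>Subtracting its counit times \<open>u\<close> from \<open>h\<close> leaves an
    element of counit 0, which kills \<open>f\<close>.\<close>
  have "pair h f = pair h (scl (pair u f) e)" for h
  proof -
    have "R (h - scl (pair h e) u) f = 0" by (rule Rh) (simp add: pair_linear counit_one)
    then have "pair (h - scl (pair h e) u) f = 0"
      using counit_R[of "h - scl (pair h e) u" f] by (simp add: pair_0_right)
    then show ?thesis by (simp add: pair_linear mult.commute)
  qed
  then have fe: "f = scl (pair u f) e" by (rule pair_eqI)
  then have "pair u f \<noteq> 0" using f(2) by (metis fv.scale_zero_left)
  then have "e = scl (1 / pair u f) f" by (subst fe) simp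
  then show ?thesis using fv.subspace_scale[OF V(1) f(1)] V(4) by (metis subsetD)
qed

text \<open>If \<open>b\<close> has no left inverse, the annihilator of the left ideal generated by
  \<open>b\<close> is a nonzero stable subspace of the dual. It contains the counit
  \<open>e\<close>, so \<open>b\<close> has counit 0.\<close>

lemma local_if_subalgebra_local:
  assumes A: "subalgebra m u A" and loc: "local_algebra m A"
    and cor: "coradical c \<subseteq> A" and prim: "prim UNIV \<subseteq> A"
  shows "local_algebra m UNIV"
proof -
  have U: "subalgebra m u UNIV" by (simp add: subalgebra_def ksubspace_eq)
  show ?thesis
    unfolding local_algebra_iff[OF U]
  proof (intro ballI impI, rule ccontr)
    fix b assume b: "pair b e \<noteq> 0" "\<not> (\<exists>b'\<in>UNIV. b' \<odot> b = u)"
    let ?I = "range (\<lambda>x. x \<odot> b)"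
    have "flinear (\<lambda>x. x \<odot> b)" by (rule flinearI) (simp_all add: hmul_linear)
    then have sI: "fv.subspace ?I" by (rule subspace_flinear_image[OF _ fv.subspace_UNIV])
    have "u \<notin> ?I" using b(2) by (metis imageE UNIV_I)
    then obtain f where f: "\<And>z. z \<in> ?I \<Longrightarrow> pair z f = 0" "pair u f \<noteq> 0"
      using separating_functional[OF sI] by blast
    define V where "V = {f. \<forall>z\<in>?I. pair z f = 0}"
    have "e \<in> V"
    proof (rule stable_subspace_contains_e[OF A loc cor prim])
      show "fv.subspace V" by (auto simp: V_def fv.subspace_def pair_linear)
      have "f \<in> V" "f \<noteq> 0" using f by (auto simp: V_def pair_linear)
      then show "V \<noteq> {0}" by blast
      show "R h g \<in> V" if "g \<in> V" for h g
        using that by (auto simp: V_def pair_R mult_assoc[symmetric])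
    qed
    then have "pair (u \<odot> b) e = 0" unfolding V_def by blast
    then show False using b(1) by (simp add: mult_one_left)
  qed
qed

lemma subalgebra_gen: "subalgebra m u (gen_subalgebra m u X)"
proof -
  have "fv.subspace (gen_subalgebra m u X)"
    unfolding gen_subalgebra_def by (rule fv.subspace_Inter) (auto simp: subalgebra_subspace)
  then show ?thesis
    unfolding subalgebra_def ksubspace_eq by (auto simp: gen_subalgebra_def subalgebra_def)
qed

lemma gen_subalgebra_superset: "X \<subseteq> gen_subalgebra m u X"
  by (auto simp: gen_subalgebra_def)

end

theorem theoremA:
  fixes m :: "'n::finite \<Rightarrow> 'n \<Rightarrow> 'n \<Rightarrow> 'k::field"
    and u :: "'n \<Rightarrow> 'k" and c :: "'n \<Rightarrow> 'n \<Rightarrow> 'n \<Rightarrow> 'k"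
    and e :: "'n \<Rightarrow> 'k" and s :: "'n \<Rightarrow> 'n \<Rightarrow> 'k"
  assumes "hopf_algebra m u c e s"
    and "cocommutative c"
  shows "local_algebra m UNIV \<longleftrightarrow> local_algebra m (gen_subalgebra m u (coradical_one c))"
proof -
  interpret hopf m u c e s by (rule hopf.intro) (fact assms)+
  let ?A = "gen_subalgebra m u (coradical_one c)"
  \<comment> \<open>The coradical and the primitive elements both lie in \<open>H\<^sub>1\<close>,
    which allows locality to pass from the subalgebra to \<open>H\<close>; the other direction holds
    for every subalgebra.\<close>
  have "coradical c \<subseteq> ?A" "prim UNIV \<subseteq> ?A"
    using coradical_sub_one prim_sub_coradical_one gen_subalgebra_superset by blast+
  then show ?thesis
    using local_subalgebra[OF subalgebra_gen] local_if_subalgebra_local[OF subalgebra_gen] by blast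
qed

end
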